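(* Let $\zeta=(P,B,\Delta_P)$ be a quantum principal $\mathcal G$-bundle with a differential calculus, let $\omega$ be any quantum principal connection on $\zeta$, and let $\delta^V$ be a finite-dimensional $\mathcal G$-corepresentation. Let $\nabla^\omega_V$ be the induced quantum linear connection on the associated left quantum vector bundle $E^V_{\mathrm L}=\mathrm{Mor}(\delta^V,\Delta_P)$ and let $d^{\nabla^\omega_V}:\Omega^\bullet(B)\otimes_B E^V_{\mathrm L}\to \Omega^\bullet(B)\otimes_B E^V_{\mathrm L}$ be its exterior covariant derivative. Then $$d^{\nabla^{\omega}_{V}}= \Upsilon_{V}\circ D^{\omega}\circ \Upsilon^{-1}_{V},$$ where $D^\omega$ acts on $\mathrm{Mor}(\delta^V,\Delta_{\mathrm{Hor}})$ by $\tau\mapsto D^\omega\circ\tau$.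
   Context: All algebras are associative unital $\ast$-algebras over $\mathbb C$. $\mathcal G$ is a compact matrix quantum group (Woronowicz) with dense $\ast$-Hopf algebra $(H,\Delta,\epsilon,S,\ast)$; Sweedler notation is used. A corepresentation is a linear map $\delta^V:V\to V\otimes H$ with $(\mathrm{id}\otimes\epsilon)\delta^V=\mathrm{id}$, $(\mathrm{id}\otimes\Delta)\delta^V=(\delta^V\otimes\mathrm{id})\delta^V$; $\mathrm{Mor}(\delta^V,\delta^W)$ is the set of linear $T:V\to W$ with $(T\otimes \mathrm{id})\delta^V=\delta^W T$. Every finite-dimensional corepresentation is taken unitary for a chosen inner product. A quantum principal $\mathcal G$-bundle (qpb) $\zeta=(P,B,\Delta_P)$: a $\ast$-algebra $P$, a $\ast$-subalgebra $B$, and a $\ast$-algebra morphism $\Delta_P:P\to P\otimes H$ that is a corepresentation, such that $\Delta_P(x)=x\otimes 1$ iff $x\in B$, and $x\otimes y\mapsto (x\otimes 1)\Delta_P(y)$ maps $P\otimes P$ onto $P\otimes H$. Standing assumption: $B$ can be completed to a $C^\ast$-algebra, and (as follows in this setting) for every irreducible finite-dimensional $\delta^V$ with orthonormal basis $\{e_i\}_{i=1}^{n_V}$ there are $T^{\mathrm L}_1,\dots,T^{\mathrm L}_{d_V}\in\mathrm{Mor}(\delta^V,\Delta_P)$ with $\sum_k T^{\mathrm L}_k(e_i)^\ast T^{\mathrm L}_k(e_j)=\delta_{ij}1$. Graded differential $\ast$-algebras have $d(w^\ast)=(dw)^\ast$, $(wv)^\ast=(-1)^{kl}v^\ast w^\ast$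 for degrees $k,l$, and tensor products are graded. Let $(\Gamma,d)$ be a bicovariant first-order differential $\ast$-calculus over $H$, $\mathfrak{qg}^\#\subset\Gamma$ its space of left-invariant elements, $\pi:H\to\mathfrak{qg}^\#$, $\pi(g)=S(g^{(1)})dg^{(2)}$ (surjective), and $\mathrm{ad}:\mathfrak{qg}^\#\to\mathfrak{qg}^\#\otimes H$ the corepresentation with $\mathrm{ad}(\pi(g))=\pi(g^{(2)})\otimes S(g^{(1)})g^{(3)}$. $\Gamma^\wedge$ is the universal differential envelope: the quotient of $\bigoplus_k\Gamma^{\otimes_H k}$ by the two-sided ideal generated by $\sum_i dg_i\otimes_H dh_i$ whenever $\sum_i g_i\,dh_i=0$; $\Delta$ extends to a graded differential $\ast$-morphism $\Gamma^\wedge\to\Gamma^\wedge\otimes\Gamma^\wedge$. A differential calculus on $\zeta$: such a $(\Gamma,d)$ together with a graded differential $\ast$-algebra $\Omega^\bullet(P)$ generated by $\Omega^0(P)=P$ such that $\Delta_P$ extends to a graded differential $\ast$-algebra morphism $\Delta_{\Omega^\bullet(P)}:\Omega^\bullet(P)\to\Omega^\bullet(P)\otimes\Gamma^\wedge$. Horizontal forms: $\mathrm{Hor}^\bullet P=\{\varphi:\Delta_{\Omega^\bullet(P)}(\varphi)\in\Omega^\bullet(P)\otimes H\}$, with corepresentation $\Delta_{\mathrm{Hor}}=\Delta_{\Omega^\bullet(P)}|_{\mathrm{Hor}^\bullet P}$, written $\varphi\mapsto\varphi^{(0)}\otimes\varphi^{(1)}$. Base forms: $\Omega^\bullet(B)=\{\mu\in\Omega^\bullet(P):\Delta_{\Omega^\bullet(P)}(\mu)=\mu\otimes1\}$.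 A quantum principal connection (qpc) is a linear map $\omega:\mathfrak{qg}^\#\to\Omega^1(P)$ with $\Delta_{\Omega^\bullet(P)}(\omega(\theta))=(\omega\otimes\mathrm{id}_H)\mathrm{ad}(\theta)+1\otimes\theta$. Its covariant derivative $D^\omega:\mathrm{Hor}^\bullet P\to\mathrm{Hor}^{\bullet+1}P$ is $D^\omega(\varphi)=d\varphi-(-1)^k\varphi^{(0)}\omega(\pi(\varphi^{(1)}))$ for $\varphi\in \mathrm{Hor}^kP$; it lies in $\mathrm{Mor}(\Delta_{\mathrm{Hor}},\Delta_{\mathrm{Hor}})$. $E^V_{\mathrm L}=\mathrm{Mor}(\delta^V,\Delta_P)$ as a left $B$-module, $(bT)(v)=b\,T(v)$. $\Upsilon_V:\mathrm{Mor}(\delta^V,\Delta_{\mathrm{Hor}})\to\Omega^\bullet(B)\otimes_BE^V_{\mathrm L}$ is the inverse of the bijection $\Upsilon_V^{-1}(\mu\otimes_BT)=\mu T$. The induced quantum linear connection is $\nabla^\omega_V(T)=\Upsilon_V(D^\omega\circ T)$, $\nabla^\omega_V:E^V_{\mathrm L}\to\Omega^1(B)\otimes_BE^V_{\mathrm L}$ (it satisfies the left Leibniz rule), and $d^{\nabla^\omega_V}(\mu\otimes_BT)=d\mu\otimes_BT+(-1)^k\mu\,\nabla^\omega_V(T)$ for $\mu\in\Omega^k(B)$. *)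

theory Defs
  imports Complex_Main "HOL-Library.Poly_Mapping" "HOL-Library.Function_Algebras"
    "HOL-Library.FuncSet"
begin

section \<open>Complex vector spaces and \<open>*\<close>-algebras\<close>

class complex_space = ab_group_add +
  fixes cscale :: "complex \<Rightarrow> 'a \<Rightarrow> 'a" (infixr "*\<^sub>C" 75)
  assumes cscale_add_right: "c *\<^sub>C (x + y) = c *\<^sub>C x + c *\<^sub>C y"
    and cscale_add_left: "(b + c) *\<^sub>C x = b *\<^sub>C x + c *\<^sub>C x"
    and cscale_cscale: "b *\<^sub>C (c *\<^sub>C x) = (b * c) *\<^sub>C x"
    and cscale_one: "1 *\<^sub>C x = x"

global_interpretation cvs: vector_space "cscale :: complex \<Rightarrow> 'a \<Rightarrow> 'a :: complex_space"
  by unfold_locales (simp_all add: cscale_add_right cscale_add_left cscale_cscale cscale_one)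

abbreviation cspan :: "'a::complex_space set \<Rightarrow> 'a set"
  where "cspan \<equiv> module.span cscale"

abbreviation csubspace :: "'a::complex_space set \<Rightarrow> bool"
  where "csubspace \<equiv> module.subspace cscale"

abbreviation clinear :: "('a::complex_space \<Rightarrow> 'b::complex_space) \<Rightarrow> bool"
  where "clinear \<equiv> Vector_Spaces.linear cscale cscale"

lemma clinearI:
  fixes f :: "'a::complex_space \<Rightarrow> 'b::complex_space"
  assumes "\<And>x y. f (x + y) = f x + f y" and "\<And>c x. f (c *\<^sub>C x) = c *\<^sub>C f x"
  shows "clinear f"
  by (simp add: Vector_Spaces.linear_iff cvs.vector_space_axioms assms)

(* Unital, associative; 0 = 1 is not excluded. *)
class complex_algebra = complex_space + ring + monoid_mult +
  assumes cscale_mult_left: "(c *\<^sub>C x) * y = c *\<^sub>C (x * y)"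
    and cscale_mult_right: "x * (c *\<^sub>C y) = c *\<^sub>C (x * y)"

class involutive_space = complex_space +
  fixes star :: "'a \<Rightarrow> 'a"
  assumes star_star: "star (star x) = x"
    and star_add: "star (x + y) = star x + star y"
    and star_cscale: "star (c *\<^sub>C x) = cnj c *\<^sub>C star x"

(* No compatibility of star with the product: for graded algebras the rule carries a sign
   and is part of graded_diff_star_algebra below. *)
class involutive_algebra = complex_algebra + involutive_space

class star_algebra = involutive_algebra +
  assumes star_mult: "star (x * y) = star y * star x"

instantiation complex :: star_algebra
begin

definition cscale_complex :: "complex \<Rightarrow> complex \<Rightarrow> complex" where "cscale_complex = (*)"

definition star_complex :: "complex \<Rightarrow> complex" where "star_complex = cnj"

instance
  by standard (simp_all add: cscale_complex_def star_complex_def algebra_simps)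

end

instantiation "fun" :: (type, complex_space) complex_space
begin

definition cscale_fun :: "complex \<Rightarrow> ('a \<Rightarrow> 'b) \<Rightarrow> 'a \<Rightarrow> 'b"
  where "cscale_fun c f = (\<lambda>x. c *\<^sub>C f x)"

instance
  by standard
    (simp_all add: cscale_fun_def fun_eq_iff cscale_add_right cscale_add_left cscale_cscale cscale_one)

end

instantiation poly_mapping :: (type, complex_space) complex_space
begin

lift_definition cscale_poly_mapping :: "complex \<Rightarrow> ('a \<Rightarrow>\<^sub>0 'b) \<Rightarrow> 'a \<Rightarrow>\<^sub>0 'b"
  is "\<lambda>c f x. c *\<^sub>C f x"
  by (erule finite_subset[rotated]) auto

instance
  by standard
    (transfer, simp add: fun_eq_iff cscale_add_right cscale_add_left cscale_cscale cscale_one)+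

end

definition star_subalgebra :: "'a::star_algebra set \<Rightarrow> bool" where
  "star_subalgebra S \<longleftrightarrow> csubspace S \<and> 1 \<in> S \<and> (\<forall>x\<in>S. \<forall>y\<in>S. x * y \<in> S) \<and> (\<forall>x\<in>S. star x \<in> S)"

definition cstar_norm_on :: "'a::star_algebra set \<Rightarrow> ('a \<Rightarrow> real) \<Rightarrow> bool" where
  "cstar_norm_on S N \<longleftrightarrow>
     (\<forall>x\<in>S. N x \<ge> 0 \<and> (N x = 0 \<longleftrightarrow> x = 0)) \<and>
     (\<forall>c. \<forall>x\<in>S. N (c *\<^sub>C x) = cmod c * N x) \<and>
     (\<forall>x\<in>S. \<forall>y\<in>S. N (x + y) \<le> N x + N y \<and> N (x * y) \<le> N x * N y) \<and>
     (\<forall>x\<in>S. N (star x * x) = (N x)\<^sup>2)"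

(* The C*-algebras containing S as a dense *-subalgebra are the completions of S for its
   C*-norms. *)
definition cstar_completable :: "'a::star_algebra set \<Rightarrow> bool" where
  "cstar_completable S \<longleftrightarrow> (\<exists>N. cstar_norm_on S N)"


section \<open>Tensor products over the complex numbers\<close>

definition lin_ext :: "('x \<Rightarrow> 'c::complex_space) \<Rightarrow> ('x \<Rightarrow>\<^sub>0 complex) \<Rightarrow> 'c" where
  "lin_ext f p = (\<Sum>x\<in>Poly_Mapping.keys p. Poly_Mapping.lookup p x *\<^sub>C f x)"

definition antilin_ext :: "('x \<Rightarrow> 'c::complex_space) \<Rightarrow> ('x \<Rightarrow>\<^sub>0 complex) \<Rightarrow> 'c" where
  "antilin_ext f p = (\<Sum>x\<in>Poly_Mapping.keys p. cnj (Poly_Mapping.lookup p x) *\<^sub>C f x)"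

abbreviation gen :: "'x \<Rightarrow> 'x \<Rightarrow>\<^sub>0 complex" where
  "gen x \<equiv> Poly_Mapping.single x 1"

definition tensor_rels :: "('a::complex_space \<times> 'b::complex_space \<Rightarrow>\<^sub>0 complex) set" where
  "tensor_rels =
     {gen (a + a', b) - gen (a, b) - gen (a', b) | a a' b. True} \<union>
     {gen (a, b + b') - gen (a, b) - gen (a, b') | a b b'. True} \<union>
     {gen (c *\<^sub>C a, b) - c *\<^sub>C gen (a, b) | c a b. True} \<union>
     {gen (a, c *\<^sub>C b) - c *\<^sub>C gen (a, b) | c a b. True}"

quotient_type (overloaded) ('a, 'b) tensor =
    "('a::complex_space \<times> 'b::complex_space) \<Rightarrow>\<^sub>0 complex" /
    "\<lambda>p q. p - q \<in> cspan tensor_rels"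
proof (rule equivpI)
  show "reflp (\<lambda>p q. p - q \<in> cspan (tensor_rels :: ('a \<times> 'b \<Rightarrow>\<^sub>0 complex) set))"
    by (rule reflpI) (simp add: cvs.span_zero)
  show "symp (\<lambda>p q. p - q \<in> cspan (tensor_rels :: ('a \<times> 'b \<Rightarrow>\<^sub>0 complex) set))"
    by (rule sympI) (drule cvs.span_neg, simp)
  show "transp (\<lambda>p q. p - q \<in> cspan (tensor_rels :: ('a \<times> 'b \<Rightarrow>\<^sub>0 complex) set))"
    by (rule transpI) (drule (1) cvs.span_add, simp)
qed

instantiation tensor :: (complex_space, complex_space) complex_space
begin

lift_definition zero_tensor :: "('a, 'b) tensor" is 0 .

lift_definition plus_tensor :: "('a, 'b) tensor \<Rightarrow> ('a, 'b) tensor \<Rightarrow> ('a, 'b) tensor" is "(+)"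
  by (drule (1) cvs.span_add) (simp add: algebra_simps)

lift_definition uminus_tensor :: "('a, 'b) tensor \<Rightarrow> ('a, 'b) tensor" is uminus
  by (drule cvs.span_neg) (simp add: algebra_simps)

lift_definition minus_tensor :: "('a, 'b) tensor \<Rightarrow> ('a, 'b) tensor \<Rightarrow> ('a, 'b) tensor" is "(-)"
proof -
  fix p1 q1 p2 q2 :: "('a \<times> 'b) \<Rightarrow>\<^sub>0 complex"
  assume "p1 - q1 \<in> cspan tensor_rels" "p2 - q2 \<in> cspan tensor_rels"
  then have "(p1 - q1) - (p2 - q2) \<in> cspan tensor_rels" by (rule cvs.span_diff)
  then show "p1 - p2 - (q1 - q2) \<in> cspan tensor_rels" by (simp add: algebra_simps)
qed

lift_definition cscale_tensor :: "complex \<Rightarrow> ('a, 'b) tensor \<Rightarrow> ('a, 'b) tensor" is "cscale"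
  by (drule cvs.span_scale) (simp add: cvs.scale_right_diff_distrib)

instance
proof
  fix x y z :: "('a, 'b) tensor" and b c :: complex
  show "x + y + z = x + (y + z)" by transfer (simp add: add.assoc cvs.span_zero)
  show "x + y = y + x" by transfer (simp add: add.commute cvs.span_zero)
  show "0 + x = x" by transfer (simp add: cvs.span_zero)
  show "- x + x = 0" by transfer (simp add: cvs.span_zero)
  show "x - y = x + - y" by transfer (simp add: cvs.span_zero)
  show "c *\<^sub>C (x + y) = c *\<^sub>C x + c *\<^sub>C y"
    by transfer (simp add: cscale_add_right cvs.span_zero)
  show "(b + c) *\<^sub>C x = b *\<^sub>C x + c *\<^sub>C x"
    by transfer (simp add: cscale_add_left cvs.span_zero)
  show "b *\<^sub>C (c *\<^sub>C x) = (b * c) *\<^sub>C x" by transfer (simp add: cscale_cscale cvs.span_zero)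
  show "1 *\<^sub>C x = x" by transfer (simp add: cscale_one cvs.span_zero)
qed

end

lift_definition tensor_elem ::
    "'a::complex_space \<Rightarrow> 'b::complex_space \<Rightarrow> ('a, 'b) tensor" (infixr "\<otimes>" 72)
  is "\<lambda>a b. gen (a, b)" .

(* The linear map on the tensor product induced by a bilinear map f (tlift_tensor, clinear_tlift);
   only meaningful for bilinear f. *)
definition tlift ::
    "('a::complex_space \<Rightarrow> 'b::complex_space \<Rightarrow> 'c::complex_space) \<Rightarrow> ('a, 'b) tensor \<Rightarrow> 'c" where
  "tlift f t = lin_ext (\<lambda>(a, b). f a b) (rep_tensor t)"

definition tmap :: "('a::complex_space \<Rightarrow> 'c::complex_space) \<Rightarrow> ('b::complex_space \<Rightarrow> 'd::complex_space)
    \<Rightarrow> ('a, 'b) tensor \<Rightarrow> ('c, 'd) tensor" where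
  "tmap f g = tlift (\<lambda>a b. f a \<otimes> g b)"

definition tassoc :: "(('a::complex_space, 'b::complex_space) tensor, 'c::complex_space) tensor
    \<Rightarrow> ('a, ('b, 'c) tensor) tensor" where
  "tassoc = tlift (\<lambda>s c. tlift (\<lambda>a b. a \<otimes> (b \<otimes> c)) s)"

definition tmult :: "('a::complex_algebra, 'b::complex_algebra) tensor \<Rightarrow> ('a, 'b) tensor
    \<Rightarrow> ('a, 'b) tensor" where
  "tmult s t = tlift (\<lambda>a b. tlift (\<lambda>a' b'. (a * a') \<otimes> (b * b')) t) s"

(* The antilinear map a (x) b |-> a* (x) b* (tstar_tensor). *)
definition tstar :: "('a::involutive_space, 'b::involutive_space) tensor \<Rightarrow> ('a, 'b) tensor" where
  "tstar t = antilin_ext (\<lambda>(a, b). star a \<otimes> star b) (rep_tensor t)"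

definition subtensor :: "'a::complex_space set \<Rightarrow> 'b::complex_space set \<Rightarrow> ('a, 'b) tensor set" where
  "subtensor V W = cspan {v \<otimes> w | v w. v \<in> V \<and> w \<in> W}"

subsection \<open>Well-definedness of the induced maps\<close>

lemma lin_ext_superset:
  assumes "finite S" "Poly_Mapping.keys p \<subseteq> S"
  shows "lin_ext f p = (\<Sum>x\<in>S. Poly_Mapping.lookup p x *\<^sub>C f x)"
  unfolding lin_ext_def using assms
  by (intro sum.mono_neutral_left) (auto simp: in_keys_iff)

lemma lookup_cscale [simp]:
  "Poly_Mapping.lookup (c *\<^sub>C p) x = c *\<^sub>C Poly_Mapping.lookup p x"
  by transfer simp

lemma lin_ext_add: "lin_ext f (p + q) = lin_ext f p + lin_ext f q"
proof -
  let ?S = "Poly_Mapping.keys p \<union> Poly_Mapping.keys q"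
  have "lin_ext f r = (\<Sum>x\<in>?S. Poly_Mapping.lookup r x *\<^sub>C f x)" if "Poly_Mapping.keys r \<subseteq> ?S" for r
    using that by (intro lin_ext_superset) auto
  then show ?thesis
    using Poly_Mapping.keys_add[of p q]
    by (simp add: lookup_add cscale_add_left sum.distrib)
qed

lemma lin_ext_cscale: "lin_ext f (c *\<^sub>C p) = c *\<^sub>C lin_ext f p"
proof -
  have "Poly_Mapping.keys (c *\<^sub>C p) \<subseteq> Poly_Mapping.keys p"
    by (auto simp: in_keys_iff cscale_complex_def)
  then have "lin_ext f (c *\<^sub>C p) = (\<Sum>x\<in>Poly_Mapping.keys p. Poly_Mapping.lookup (c *\<^sub>C p) x *\<^sub>C f x)"
    by (intro lin_ext_superset) auto
  then show ?thesis
    by (simp add: lin_ext_def cvs.scale_sum_right cscale_cscale cscale_complex_def)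
qed

lemma clinear_lin_ext: "clinear (lin_ext f)"
  by (intro clinearI lin_ext_add lin_ext_cscale)

lemma lin_ext_diff: "lin_ext f (p - q) = lin_ext f p - lin_ext f q"
  using lin_ext_add[of f "p - q" q] by simp

lemma lin_ext_gen [simp]: "lin_ext f (gen x) = f x"
  by (simp add: lin_ext_def cscale_one)

definition cbilinear :: "('a::complex_space \<Rightarrow> 'b::complex_space \<Rightarrow> 'c::complex_space) \<Rightarrow> bool" where
  "cbilinear f \<longleftrightarrow> (\<forall>b. clinear (\<lambda>a. f a b)) \<and> (\<forall>a. clinear (f a))"

lemma lin_ext_tensor_rels:
  assumes "cbilinear f" "r \<in> cspan tensor_rels"
  shows "lin_ext (\<lambda>(a, b). f a b) r = 0"
  using assms(2)
proof (induction rule: cvs.span_induct_alt)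
  case base
  show ?case by (simp add: lin_ext_def)
next
  case (step c x y)
  have "lin_ext (\<lambda>(a, b). f a b) x = 0"
    using step(1) assms(1) unfolding tensor_rels_def cbilinear_def Vector_Spaces.linear_iff
    by (auto simp: lin_ext_diff lin_ext_cscale)
  then show ?case using step by (simp add: lin_ext_add lin_ext_cscale)
qed

lemma rep_abs_tensor_rel: "rep_tensor (abs_tensor p) - p \<in> cspan tensor_rels"
  by (rule rep_abs_rsp_left[OF Quotient3_tensor]) (simp add: cvs.span_zero)

lemma tlift_abs:
  assumes "cbilinear f"
  shows "tlift f (abs_tensor p) = lin_ext (\<lambda>(a, b). f a b) p"
  using lin_ext_tensor_rels[OF assms rep_abs_tensor_rel, of p]
  by (simp add: tlift_def lin_ext_diff)

lemma tlift_tensor: "cbilinear f \<Longrightarrow> tlift f (a \<otimes> b) = f a b"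
  by (simp add: tensor_elem.abs_eq tlift_abs)

lemma clinear_tlift:
  assumes "cbilinear f"
  shows "clinear (tlift f)"
proof (rule clinearI)
  show "tlift f (x + y) = tlift f x + tlift f y" for x y
    by (induction x rule: tensor.abs_induct, induction y rule: tensor.abs_induct)
      (simp add: plus_tensor.abs_eq tlift_abs[OF assms] lin_ext_add)
  show "tlift f (c *\<^sub>C x) = c *\<^sub>C tlift f x" for c x
    by (induction x rule: tensor.abs_induct)
      (simp add: cscale_tensor.abs_eq tlift_abs[OF assms] lin_ext_cscale)
qed

lemma tensor_add_left: "(a + a') \<otimes> b = a \<otimes> b + a' \<otimes> b"
proof -
  have "gen (a + a', b) - gen (a, b) - gen (a', b) \<in> tensor_rels"
    unfolding tensor_rels_def by blast
  then show ?thesis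
    by (simp add: tensor_elem.abs_eq plus_tensor.abs_eq tensor.abs_eq_iff cvs.span_base diff_diff_eq)
qed

lemma tensor_add_right: "a \<otimes> (b + b') = a \<otimes> b + a \<otimes> b'"
proof -
  have "gen (a, b + b') - gen (a, b) - gen (a, b') \<in> tensor_rels"
    unfolding tensor_rels_def by blast
  then show ?thesis
    by (simp add: tensor_elem.abs_eq plus_tensor.abs_eq tensor.abs_eq_iff cvs.span_base diff_diff_eq)
qed

lemma tensor_cscale_left: "(c *\<^sub>C a) \<otimes> b = c *\<^sub>C (a \<otimes> b)"
proof -
  have "gen (c *\<^sub>C a, b) - c *\<^sub>C gen (a, b) \<in> tensor_rels"
    unfolding tensor_rels_def by blast
  then show ?thesis
    by (simp add: tensor_elem.abs_eq cscale_tensor.abs_eq tensor.abs_eq_iff cvs.span_base)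
qed

lemma tensor_cscale_right: "a \<otimes> (c *\<^sub>C b) = c *\<^sub>C (a \<otimes> b)"
proof -
  have "gen (a, c *\<^sub>C b) - c *\<^sub>C gen (a, b) \<in> tensor_rels"
    unfolding tensor_rels_def by blast
  then show ?thesis
    by (simp add: tensor_elem.abs_eq cscale_tensor.abs_eq tensor.abs_eq_iff cvs.span_base)
qed

lemma antilin_ext_superset:
  assumes "finite S" "Poly_Mapping.keys p \<subseteq> S"
  shows "antilin_ext f p = (\<Sum>x\<in>S. cnj (Poly_Mapping.lookup p x) *\<^sub>C f x)"
  unfolding antilin_ext_def using assms
  by (intro sum.mono_neutral_left) (auto simp: in_keys_iff)

lemma antilin_ext_add: "antilin_ext f (p + q) = antilin_ext f p + antilin_ext f q"
proof -
  let ?S = "Poly_Mapping.keys p \<union> Poly_Mapping.keys q"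
  have "antilin_ext f r = (\<Sum>x\<in>?S. cnj (Poly_Mapping.lookup r x) *\<^sub>C f x)"
    if "Poly_Mapping.keys r \<subseteq> ?S" for r
    using that by (intro antilin_ext_superset) auto
  then show ?thesis
    using Poly_Mapping.keys_add[of p q]
    by (simp add: lookup_add cscale_add_left sum.distrib)
qed

lemma antilin_ext_cscale: "antilin_ext f (c *\<^sub>C p) = cnj c *\<^sub>C antilin_ext f p"
proof -
  have "Poly_Mapping.keys (c *\<^sub>C p) \<subseteq> Poly_Mapping.keys p"
    by (auto simp: in_keys_iff cscale_complex_def)
  then have "antilin_ext f (c *\<^sub>C p) =
      (\<Sum>x\<in>Poly_Mapping.keys p. cnj (Poly_Mapping.lookup (c *\<^sub>C p) x) *\<^sub>C f x)"
    by (intro antilin_ext_superset) auto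
  then show ?thesis
    by (simp add: antilin_ext_def cvs.scale_sum_right cscale_cscale cscale_complex_def)
qed

lemma antilin_ext_diff: "antilin_ext f (p - q) = antilin_ext f p - antilin_ext f q"
  using antilin_ext_add[of f "p - q" q] by simp

lemma antilin_ext_gen [simp]: "antilin_ext f (gen x) = f x"
  by (simp add: antilin_ext_def cscale_one)

lemma antilin_ext_tensor_rels:
  assumes "r \<in> cspan tensor_rels"
  shows "antilin_ext (\<lambda>(a, b). star a \<otimes> star b) r = 0"
  using assms
proof (induction rule: cvs.span_induct_alt)
  case base
  show ?case by (simp add: antilin_ext_def)
next
  case (step c x y)
  have "antilin_ext (\<lambda>(a, b). star a \<otimes> star b) x = 0"
    using step(1) unfolding tensor_rels_def
    by (auto simp: antilin_ext_diff antilin_ext_cscale star_add star_cscale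
        tensor_add_left tensor_add_right tensor_cscale_left tensor_cscale_right)
  then show ?case using step by (simp add: antilin_ext_add antilin_ext_cscale)
qed

lemma tstar_abs: "tstar (abs_tensor p) = antilin_ext (\<lambda>(a, b). star a \<otimes> star b) p"
  using antilin_ext_tensor_rels[OF rep_abs_tensor_rel, of p] by (simp add: tstar_def antilin_ext_diff)

lemma tstar_tensor: "tstar (a \<otimes> b) = star a \<otimes> star b"
  by (simp add: tensor_elem.abs_eq tstar_abs)

lemma tstar_add: "tstar (x + y) = tstar x + tstar y"
  by (induction x rule: tensor.abs_induct, induction y rule: tensor.abs_induct)
    (simp add: plus_tensor.abs_eq tstar_abs antilin_ext_add)

lemma tstar_cscale: "tstar (c *\<^sub>C x) = cnj c *\<^sub>C tstar x"
  by (induction x rule: tensor.abs_induct)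
    (simp add: cscale_tensor.abs_eq tstar_abs antilin_ext_cscale)


section \<open>Hopf algebras and compact matrix quantum groups\<close>

definition star_hom_tensor ::
    "('a::star_algebra \<Rightarrow> ('b::star_algebra, 'c::star_algebra) tensor) \<Rightarrow> bool" where
  "star_hom_tensor F \<longleftrightarrow> clinear F \<and> F 1 = 1 \<otimes> 1 \<and>
     (\<forall>x y. F (x * y) = tmult (F x) (F y)) \<and> (\<forall>x. F (star x) = tstar (F x))"

definition star_hom :: "('a::star_algebra \<Rightarrow> 'b::involutive_algebra) \<Rightarrow> bool" where
  "star_hom f \<longleftrightarrow> clinear f \<and> f 1 = 1 \<and> (\<forall>x y. f (x * y) = f x * f y) \<and> (\<forall>x. f (star x) = star (f x))"

definition star_hopf_algebra ::
    "('h::star_algebra \<Rightarrow> ('h, 'h) tensor) \<Rightarrow> ('h \<Rightarrow> complex) \<Rightarrow> ('h \<Rightarrow> 'h) \<Rightarrow> bool" where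
  "star_hopf_algebra \<Delta> \<epsilon> S \<longleftrightarrow>
     star_hom_tensor \<Delta> \<and> star_hom \<epsilon> \<and> clinear S \<and>
     (\<forall>g. tassoc (tmap \<Delta> id (\<Delta> g)) = tmap id \<Delta> (\<Delta> g)) \<and>
     (\<forall>g. tlift (\<lambda>a b. \<epsilon> a *\<^sub>C b) (\<Delta> g) = g \<and> tlift (\<lambda>a b. \<epsilon> b *\<^sub>C a) (\<Delta> g) = g) \<and>
     (\<forall>g. tlift (\<lambda>a b. S a * b) (\<Delta> g) = \<epsilon> g *\<^sub>C 1 \<and> tlift (\<lambda>a b. a * S b) (\<Delta> g) = \<epsilon> g *\<^sub>C 1)"

(* The states of the completion of 'h for N, restricted to 'h. *)
definition states :: "('h::star_algebra \<Rightarrow> real) \<Rightarrow> ('h \<Rightarrow> complex) set" where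
  "states N = {\<phi>. clinear \<phi> \<and> \<phi> 1 = 1 \<and> (\<forall>x. cmod (\<phi> x) \<le> N x) \<and>
                  (\<forall>x. Im (\<phi> (star x * x)) = 0 \<and> Re (\<phi> (star x * x)) \<ge> 0)}"

(* Woronowicz's axioms, read on the dense *-algebra: H is generated as a *-algebra by the entries
   of a matrix u with comult (u i j) = sum_k u i k (x) u k j, and carries a C*-norm N for which
   comult extends to the completion A with values in the minimal C*-tensor product of A with A.
   The last clause states that comult is contractive for the minimal (spatial) norm, computed
   from the GNS representations of the product states: the squared minimal norm of t is the
   supremum of (phi (x) psi)(s* t* t s) / (phi (x) psi)(s* s). *)
definition compact_matrix_quantum_group ::
    "('h::star_algebra \<Rightarrow> ('h, 'h) tensor) \<Rightarrow> ('h \<Rightarrow> complex) \<Rightarrow> ('h \<Rightarrow> 'h) \<Rightarrow> bool" where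
  "compact_matrix_quantum_group \<Delta> \<epsilon> S \<longleftrightarrow>
     star_hopf_algebra \<Delta> \<epsilon> S \<and>
     (\<exists>(n::nat) u.
        (\<forall>i<n. \<forall>j<n. \<Delta> (u i j) = (\<Sum>k<n. u i k \<otimes> u k j)) \<and>
        (\<forall>A. star_subalgebra A \<and> (\<forall>i<n. \<forall>j<n. u i j \<in> A) \<longrightarrow> A = UNIV)) \<and>
     (\<exists>N. cstar_norm_on UNIV N \<and>
        (\<forall>\<phi>\<in>states N. \<forall>\<psi>\<in>states N. \<forall>g s.
           Re (tlift (\<lambda>a b. \<phi> a * \<psi> b) (tmult (tstar (tmult (\<Delta> g) s)) (tmult (\<Delta> g) s)))
           \<le> (N g)\<^sup>2 * Re (tlift (\<lambda>a b. \<phi> a * \<psi> b) (tmult (tstar s) s))))"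


section \<open>Corepresentations\<close>

(* The space is a subspace V of the type 'v. Here and in Mor, linear maps on V are represented by
   linear maps on all of 'v, of which only the restriction to V is used; every linear map on V has
   such an extension. *)
definition corepresentation :: "('h::star_algebra \<Rightarrow> ('h, 'h) tensor) \<Rightarrow> ('h \<Rightarrow> complex) \<Rightarrow>
    'v::complex_space set \<Rightarrow> ('v \<Rightarrow> ('v, 'h) tensor) \<Rightarrow> bool" where
  "corepresentation \<Delta> \<epsilon> V \<delta> \<longleftrightarrow>
     csubspace V \<and> clinear \<delta> \<and>
     (\<forall>v\<in>V. \<delta> v \<in> subtensor V UNIV \<and>
        tlift (\<lambda>w h. \<epsilon> h *\<^sub>C w) (\<delta> v) = v \<and>
        tassoc (tmap \<delta> id (\<delta> v)) = tmap id \<Delta> (\<delta> v))"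

definition Mor :: "'v::complex_space set \<Rightarrow> ('v \<Rightarrow> ('v, 'h::star_algebra) tensor) \<Rightarrow>
    'w::complex_space set \<Rightarrow> ('w \<Rightarrow> ('w, 'h) tensor) \<Rightarrow> ('v \<Rightarrow> 'w) set" where
  "Mor V \<delta>V W \<delta>W =
     {T. clinear T \<and> T ` V \<subseteq> W \<and> (\<forall>v\<in>V. tmap T id (\<delta>V v) = \<delta>W (T v))}"

(* Linear in the second argument. *)
definition inner_product_on :: "'v::complex_space set \<Rightarrow> ('v \<Rightarrow> 'v \<Rightarrow> complex) \<Rightarrow> bool" where
  "inner_product_on V ip \<longleftrightarrow>
     (\<forall>x\<in>V. \<forall>y\<in>V. \<forall>z\<in>V. ip x (y + z) = ip x y + ip x z) \<and>
     (\<forall>x\<in>V. \<forall>y\<in>V. \<forall>c. ip x (c *\<^sub>C y) = c * ip x y) \<and>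
     (\<forall>x\<in>V. \<forall>y\<in>V. ip y x = cnj (ip x y)) \<and>
     (\<forall>x\<in>V. x \<noteq> 0 \<longrightarrow> Re (ip x x) > 0)"

definition orthonormal_basis ::
    "'v::complex_space set \<Rightarrow> ('v \<Rightarrow> 'v \<Rightarrow> complex) \<Rightarrow> nat \<Rightarrow> (nat \<Rightarrow> 'v) \<Rightarrow> bool" where
  "orthonormal_basis V ip n e \<longleftrightarrow>
     cspan (e ` {..<n}) = V \<and> (\<forall>i<n. \<forall>j<n. ip (e i) (e j) = (if i = j then 1 else 0))"

definition unitary_corepresentation :: "('h::star_algebra \<Rightarrow> ('h, 'h) tensor) \<Rightarrow> ('h \<Rightarrow> complex) \<Rightarrow>
    'v::complex_space set \<Rightarrow> ('v \<Rightarrow> ('v, 'h) tensor) \<Rightarrow> ('v \<Rightarrow> 'v \<Rightarrow> complex) \<Rightarrow> bool" where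
  "unitary_corepresentation \<Delta> \<epsilon> V \<delta> ip \<longleftrightarrow>
     corepresentation \<Delta> \<epsilon> V \<delta> \<and> (\<exists>A. finite A \<and> cspan A = V) \<and> inner_product_on V ip \<and>
     (\<forall>n e. orthonormal_basis V ip n e \<longrightarrow>
        (\<exists>u. (\<forall>j<n. \<delta> (e j) = (\<Sum>i<n. e i \<otimes> u i j)) \<and>
           (\<forall>i<n. \<forall>j<n. (\<Sum>k<n. star (u k i) * u k j) = (if i = j then 1 else 0) \<and>
                        (\<Sum>k<n. u i k * star (u j k)) = (if i = j then 1 else 0))))"

definition irreducible_corepresentation ::
    "'v::complex_space set \<Rightarrow> ('v \<Rightarrow> ('v, 'h::star_algebra) tensor) \<Rightarrow> bool" where
  "irreducible_corepresentation V \<delta> \<longleftrightarrow>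
     V \<noteq> {0} \<and>
     (\<forall>U. csubspace U \<and> U \<subseteq> V \<and> (\<forall>x\<in>U. \<delta> x \<in> subtensor U UNIV) \<longrightarrow> U = {0} \<or> U = V)"


section \<open>Quantum principal bundles\<close>

definition quantum_principal_bundle :: "('h::star_algebra \<Rightarrow> ('h, 'h) tensor) \<Rightarrow> ('h \<Rightarrow> complex) \<Rightarrow>
    'p::star_algebra set \<Rightarrow> ('p \<Rightarrow> ('p, 'h) tensor) \<Rightarrow> bool" where
  "quantum_principal_bundle \<Delta> \<epsilon> B \<Delta>P \<longleftrightarrow>
     star_subalgebra B \<and> star_hom_tensor \<Delta>P \<and> corepresentation \<Delta> \<epsilon> UNIV \<Delta>P \<and>
     (\<forall>x. \<Delta>P x = x \<otimes> 1 \<longleftrightarrow> x \<in> B) \<and>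
     surj (tlift (\<lambda>x y. tmult (x \<otimes> 1) (\<Delta>P y)))"

(* The maps T^L_1, ..., T^L_d attached to irreducible corepresentations. Up to isomorphism every
   finite-dimensional space is a subspace of the space of finitely supported sequences. *)
definition has_left_frames :: "('h::star_algebra \<Rightarrow> ('h, 'h) tensor) \<Rightarrow> ('h \<Rightarrow> complex) \<Rightarrow>
    ('p::star_algebra \<Rightarrow> ('p, 'h) tensor) \<Rightarrow> bool" where
  "has_left_frames \<Delta> \<epsilon> \<Delta>P \<longleftrightarrow>
     (\<forall>(V :: (nat \<Rightarrow>\<^sub>0 complex) set) \<delta> ip n e.
        unitary_corepresentation \<Delta> \<epsilon> V \<delta> ip \<and> irreducible_corepresentation V \<delta> \<and>
        orthonormal_basis V ip n e \<longrightarrow>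
        (\<exists>(d::nat) T. (\<forall>k<d. T k \<in> Mor V \<delta> UNIV \<Delta>P) \<and>
           (\<forall>i<n. \<forall>j<n. (\<Sum>k<d. star (T k (e i)) * T k (e j)) = (if i = j then 1 else 0))))"


section \<open>Graded differential \<open>*\<close>-algebras\<close>

definition decomposition :: "(nat \<Rightarrow> 'a::complex_space set) \<Rightarrow> 'a \<Rightarrow> (nat \<Rightarrow> 'a) \<Rightarrow> bool" where
  "decomposition G x f \<longleftrightarrow>
     (\<forall>k. f k \<in> G k) \<and> finite {k. f k \<noteq> 0} \<and> x = (\<Sum>k | f k \<noteq> 0. f k)"

definition hcomp :: "(nat \<Rightarrow> 'a::complex_space set) \<Rightarrow> nat \<Rightarrow> 'a \<Rightarrow> 'a" where
  "hcomp G k x = (THE f. decomposition G x f) k"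

definition degs :: "(nat \<Rightarrow> 'a::complex_space set) \<Rightarrow> 'a \<Rightarrow> nat set" where
  "degs G x = {k. hcomp G k x \<noteq> 0}"

definition graded_diff_star_algebra ::
    "(nat \<Rightarrow> 'a::involutive_algebra set) \<Rightarrow> ('a \<Rightarrow> 'a) \<Rightarrow> bool" where
  "graded_diff_star_algebra G d \<longleftrightarrow>
     (\<forall>k. csubspace (G k)) \<and> (\<forall>x. \<exists>!f. decomposition G x f) \<and>
     1 \<in> G 0 \<and> (\<forall>k l. \<forall>x\<in>G k. \<forall>y\<in>G l. x * y \<in> G (k + l)) \<and>
     clinear d \<and> (\<forall>k. \<forall>x\<in>G k. d x \<in> G (Suc k)) \<and> (\<forall>x. d (d x) = 0) \<and>
     (\<forall>k. \<forall>x\<in>G k. \<forall>y. d (x * y) = d x * y + (-1) ^ k *\<^sub>C (x * d y)) \<and>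
     (\<forall>k. \<forall>x\<in>G k. star x \<in> G k) \<and>
     (\<forall>k l. \<forall>x\<in>G k. \<forall>y\<in>G l. star (x * y) = (-1) ^ (k * l) *\<^sub>C (star y * star x)) \<and>
     (\<forall>x. d (star x) = star (d x))"

definition generated_in_degree_0 ::
    "(nat \<Rightarrow> 'a::involutive_algebra set) \<Rightarrow> ('a \<Rightarrow> 'a) \<Rightarrow> bool" where
  "generated_in_degree_0 G d \<longleftrightarrow>
     (\<forall>A. csubspace A \<and> G 0 \<subseteq> A \<and> (\<forall>x\<in>A. \<forall>y\<in>A. x * y \<in> A) \<and> (\<forall>x\<in>A. d x \<in> A) \<and>
        (\<forall>x\<in>A. star x \<in> A) \<longrightarrow> A = UNIV)"

(* Graded tensor product: (a (x) b)(a' (x) b') = (-1)^(deg b * deg a') a a' (x) b b'. The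
   involution is tstar: the sign from (xy)* = (-1)^(kl) y* x* cancels the one from commuting
   b* past a*. *)
definition gtgrade :: "(nat \<Rightarrow> 'a::complex_space set) \<Rightarrow> (nat \<Rightarrow> 'b::complex_space set) \<Rightarrow>
    nat \<Rightarrow> ('a, 'b) tensor set" where
  "gtgrade G G' n = cspan {a \<otimes> b | a b k l. k + l = n \<and> a \<in> G k \<and> b \<in> G' l}"

definition gtmult :: "(nat \<Rightarrow> 'a::complex_algebra set) \<Rightarrow> (nat \<Rightarrow> 'b::complex_algebra set) \<Rightarrow>
    ('a, 'b) tensor \<Rightarrow> ('a, 'b) tensor \<Rightarrow> ('a, 'b) tensor" where
  "gtmult G G' s t =
     tlift (\<lambda>a b. tlift (\<lambda>a' b'. \<Sum>k\<in>degs G' b. \<Sum>l\<in>degs G a'.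
       (-1) ^ (k * l) *\<^sub>C ((a * hcomp G l a') \<otimes> (hcomp G' k b * b'))) t) s"

definition gtdiff :: "(nat \<Rightarrow> 'a::complex_space set) \<Rightarrow> ('a \<Rightarrow> 'a) \<Rightarrow> ('b::complex_space \<Rightarrow> 'b) \<Rightarrow>
    ('a, 'b) tensor \<Rightarrow> ('a, 'b) tensor" where
  "gtdiff G d d' =
     tlift (\<lambda>a b. d a \<otimes> b + (\<Sum>k\<in>degs G a. (-1) ^ k *\<^sub>C (hcomp G k a \<otimes> d' b)))"


section \<open>Bicovariant calculi and the universal differential envelope\<close>

definition fodc :: "('h::star_algebra \<Rightarrow> 'g::involutive_space \<Rightarrow> 'g) \<Rightarrow> ('g \<Rightarrow> 'h \<Rightarrow> 'g) \<Rightarrow>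
    ('h \<Rightarrow> 'g) \<Rightarrow> bool" where
  "fodc la ra d \<longleftrightarrow>
     cbilinear la \<and> cbilinear ra \<and>
     (\<forall>x. la 1 x = x \<and> ra x 1 = x) \<and>
     (\<forall>g h x. la (g * h) x = la g (la h x) \<and> ra x (g * h) = ra (ra x g) h \<and>
        ra (la g x) h = la g (ra x h)) \<and>
     clinear d \<and> (\<forall>g h. d (g * h) = ra (d g) h + la g (d h)) \<and>
     cspan {la g (d h) | g h. True} = UNIV \<and>
     (\<forall>g x. star (la g x) = ra (star x) (star g) \<and> star (ra x g) = la (star g) (star x)) \<and>
     (\<forall>g. star (d g) = d (star g))"

(* Woronowicz: the maps g dh |-> comult(g) (id (x) d) comult(h) and
   g dh |-> comult(g) (d (x) id) comult(h) are well defined on Gamma. *)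
definition is_left_coaction :: "('h::star_algebra \<Rightarrow> ('h, 'h) tensor) \<Rightarrow>
    ('h \<Rightarrow> 'g::involutive_space \<Rightarrow> 'g) \<Rightarrow> ('h \<Rightarrow> 'g) \<Rightarrow> ('g \<Rightarrow> ('h, 'g) tensor) \<Rightarrow> bool" where
  "is_left_coaction \<Delta> la d \<Phi> \<longleftrightarrow> clinear \<Phi> \<and>
     (\<forall>g h. \<Phi> (la g (d h)) = tlift (\<lambda>a b. tlift (\<lambda>a' b'. (a * a') \<otimes> la b (d b')) (\<Delta> h)) (\<Delta> g))"

definition is_right_coaction :: "('h::star_algebra \<Rightarrow> ('h, 'h) tensor) \<Rightarrow>
    ('h \<Rightarrow> 'g::involutive_space \<Rightarrow> 'g) \<Rightarrow> ('h \<Rightarrow> 'g) \<Rightarrow> ('g \<Rightarrow> ('g, 'h) tensor) \<Rightarrow> bool" where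
  "is_right_coaction \<Delta> la d \<Phi> \<longleftrightarrow> clinear \<Phi> \<and>
     (\<forall>g h. \<Phi> (la g (d h)) = tlift (\<lambda>a b. tlift (\<lambda>a' b'. la a (d a') \<otimes> (b * b')) (\<Delta> h)) (\<Delta> g))"

definition bicovariant_fodc :: "('h::star_algebra \<Rightarrow> ('h, 'h) tensor) \<Rightarrow>
    ('h \<Rightarrow> 'g::involutive_space \<Rightarrow> 'g) \<Rightarrow> ('g \<Rightarrow> 'h \<Rightarrow> 'g) \<Rightarrow> ('h \<Rightarrow> 'g) \<Rightarrow> bool" where
  "bicovariant_fodc \<Delta> la ra d \<longleftrightarrow>
     fodc la ra d \<and> (\<exists>\<Phi>. is_left_coaction \<Delta> la d \<Phi>) \<and> (\<exists>\<Phi>. is_right_coaction \<Delta> la d \<Phi>)"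

(* In the free vector space on nonempty words over Gamma, a word [x1, ..., xk] stands for
   x1 (x)_H ... (x)_H xk. Dividing by the following relations gives the sum over k >= 1 of the
   k-fold tensor powers of Gamma over H. *)
definition tensor_power_rels :: "('h::star_algebra \<Rightarrow> 'g::involutive_space \<Rightarrow> 'g) \<Rightarrow>
    ('g \<Rightarrow> 'h \<Rightarrow> 'g) \<Rightarrow> ('g list \<Rightarrow>\<^sub>0 complex) set" where
  "tensor_power_rels la ra =
     {gen (xs @ (x + y) # ys) - gen (xs @ x # ys) - gen (xs @ y # ys) | xs x y ys. True} \<union>
     {gen (xs @ (c *\<^sub>C x) # ys) - c *\<^sub>C gen (xs @ x # ys) | xs c x ys. True} \<union>
     {gen (xs @ ra x h # y # ys) - gen (xs @ x # la h y # ys) | xs x h y ys. True}"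

(* Spans, modulo tensor_power_rels, the two-sided ideal generated by the elements
   sum_i dg_i (x)_H dh_i with sum_i g_i dh_i = 0. *)
definition envelope_ideal_gens :: "('h::star_algebra \<Rightarrow> 'g::involutive_space \<Rightarrow> 'g) \<Rightarrow>
    ('g \<Rightarrow> 'h \<Rightarrow> 'g) \<Rightarrow> ('h \<Rightarrow> 'g) \<Rightarrow> ('g list \<Rightarrow>\<^sub>0 complex) set" where
  "envelope_ideal_gens la ra d =
     {(\<Sum>i<n. gen (xs @ la a (d (g i)) # ra (d (h i)) b # ys)) | (n::nat) xs a g h b ys.
        (\<Sum>i<n. la (g i) (d (h i))) = 0}"

(* The algebra 'e with grading G, differential D and structure maps i0, i1 is the quotient of the
   tensor algebra H + Gamma + (Gamma (x)_H Gamma) + ... by the above ideal: the ideal lives in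
   degrees >= 2, so degree 0 is H, and in degrees k >= 1 the multiplication map on words is onto
   with the stated kernel. *)
definition universal_envelope :: "('h::star_algebra \<Rightarrow> 'g::involutive_space \<Rightarrow> 'g) \<Rightarrow>
    ('g \<Rightarrow> 'h \<Rightarrow> 'g) \<Rightarrow> ('h \<Rightarrow> 'g) \<Rightarrow> ('h \<Rightarrow> 'e::involutive_algebra) \<Rightarrow> ('g \<Rightarrow> 'e) \<Rightarrow>
    (nat \<Rightarrow> 'e set) \<Rightarrow> ('e \<Rightarrow> 'e) \<Rightarrow> bool" where
  "universal_envelope la ra d i0 i1 G D \<longleftrightarrow>
     graded_diff_star_algebra G D \<and>
     star_hom i0 \<and> bij_betw i0 UNIV (G 0) \<and>
     clinear i1 \<and> (\<forall>h x. i1 (la h x) = i0 h * i1 x \<and> i1 (ra x h) = i1 x * i0 h) \<and>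
     (\<forall>x. i1 (star x) = star (i1 x)) \<and> (\<forall>h. D (i0 h) = i1 (d h)) \<and>
     (\<forall>k\<ge>1. G k = lin_ext (\<lambda>xs. prod_list (map i1 xs)) `
                     {p. \<forall>xs\<in>Poly_Mapping.keys p. length xs = k}) \<and>
     (\<forall>p. [] \<notin> Poly_Mapping.keys p \<longrightarrow>
        (lin_ext (\<lambda>xs. prod_list (map i1 xs)) p = 0 \<longleftrightarrow>
         p \<in> cspan (tensor_power_rels la ra \<union> envelope_ideal_gens la ra d)))"


section \<open>Differential calculi on quantum principal bundles\<close>

(* einc0, einc1: embeddings of H and Gamma into the envelope; pinc: identification of P with the
   degree 0 part of the algebra of forms; ocoact: the extension of the coaction to forms. *)
record (overloaded) ('h::star_algebra, 'p::star_algebra, 'g::involutive_space,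
    'e::involutive_algebra, 'o::involutive_algebra) qpb_calculus =
  comult :: "'h \<Rightarrow> ('h, 'h) tensor"
  counit :: "'h \<Rightarrow> complex"
  antipode :: "'h \<Rightarrow> 'h"
  base :: "'p set"
  coact :: "'p \<Rightarrow> ('p, 'h) tensor"
  lact :: "'h \<Rightarrow> 'g \<Rightarrow> 'g"
  ract :: "'g \<Rightarrow> 'h \<Rightarrow> 'g"
  gdiff :: "'h \<Rightarrow> 'g"
  einc0 :: "'h \<Rightarrow> 'e"
  einc1 :: "'g \<Rightarrow> 'e"
  egrade :: "nat \<Rightarrow> 'e set"
  ediff :: "'e \<Rightarrow> 'e"
  pinc :: "'p \<Rightarrow> 'o"
  ograde :: "nat \<Rightarrow> 'o set"
  odiff :: "'o \<Rightarrow> 'o"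
  ocoact :: "'o \<Rightarrow> ('o, 'e) tensor"

definition differential_calculus :: "('h::star_algebra, 'p::star_algebra, 'g::involutive_space,
    'e::involutive_algebra, 'o::involutive_algebra) qpb_calculus \<Rightarrow> bool" where
  "differential_calculus Z \<longleftrightarrow>
     bicovariant_fodc (comult Z) (lact Z) (ract Z) (gdiff Z) \<and>
     universal_envelope (lact Z) (ract Z) (gdiff Z) (einc0 Z) (einc1 Z) (egrade Z) (ediff Z) \<and>
     graded_diff_star_algebra (ograde Z) (odiff Z) \<and>
     generated_in_degree_0 (ograde Z) (odiff Z) \<and>
     star_hom (pinc Z) \<and> bij_betw (pinc Z) UNIV (ograde Z 0) \<and>
     clinear (ocoact Z) \<and> ocoact Z 1 = 1 \<otimes> 1 \<and>
     (\<forall>x y. ocoact Z (x * y) = gtmult (ograde Z) (egrade Z) (ocoact Z x) (ocoact Z y)) \<and>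
     (\<forall>x. ocoact Z (star x) = tstar (ocoact Z x)) \<and>
     (\<forall>k. \<forall>x\<in>ograde Z k. ocoact Z x \<in> gtgrade (ograde Z) (egrade Z) k) \<and>
     (\<forall>x. ocoact Z (odiff Z x) = gtdiff (ograde Z) (odiff Z) (ediff Z) (ocoact Z x)) \<and>
     (\<forall>p. ocoact Z (pinc Z p) = tmap (pinc Z) (einc0 Z) (coact Z p))"

type_synonym ('o, 'p, 'v) bfree = "'o \<times> ('v \<Rightarrow> 'p) \<Rightarrow>\<^sub>0 complex"

context
  fixes Z :: "('h::star_algebra, 'p::star_algebra, 'g::involutive_space,
      'e::involutive_algebra, 'o::involutive_algebra) qpb_calculus"
    and \<omega> :: "'g \<Rightarrow> 'o"
    and \<delta> :: "'v::complex_space \<Rightarrow> ('v, 'h) tensor"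
begin

definition left_invariant_forms :: "'g set" where
  "left_invariant_forms =
     {x. (THE \<Phi>. is_left_coaction (comult Z) (lact Z) (gdiff Z) \<Phi>) x = 1 \<otimes> x}"

definition qgerm :: "'h \<Rightarrow> 'g" where
  "qgerm h = tlift (\<lambda>a b. lact Z (antipode Z a) (gdiff Z b)) (comult Z h)"

(* h |-> h_2 (x) S(h_1) h_3 *)
definition Ad :: "'h \<Rightarrow> ('h, 'h) tensor" where
  "Ad h = tlift (\<lambda>s h3. tlift (\<lambda>h1 h2. h2 \<otimes> (antipode Z h1 * h3)) s)
              (tmap (comult Z) id (comult Z h))"

definition ad :: "'g \<Rightarrow> ('g, 'h) tensor" where
  "ad x = (THE t. \<exists>h. x = qgerm h \<and> t = tmap qgerm id (Ad h))"

definition Hor :: "'o set" where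
  "Hor = {\<phi>. ocoact Z \<phi> \<in> subtensor UNIV (range (einc0 Z))}"

definition coact_Hor :: "'o \<Rightarrow> ('o, 'h) tensor" where
  "coact_Hor \<phi> = (THE t. tmap id (einc0 Z) t = ocoact Z \<phi>)"

definition base_forms :: "'o set" where
  "base_forms = {\<mu>. ocoact Z \<mu> = \<mu> \<otimes> 1}"


subsection \<open>Connections and their covariant derivatives\<close>

(* The linear map omega on the left-invariant forms is represented by a linear map on all of
   Gamma, of which only the restriction is used. *)
definition quantum_principal_connection :: bool where
  "quantum_principal_connection \<longleftrightarrow>
     clinear \<omega> \<and>
     (\<forall>\<theta>\<in>left_invariant_forms. \<omega> \<theta> \<in> ograde Z 1 \<and>
        ocoact Z (\<omega> \<theta>) = tmap \<omega> (einc0 Z) (ad \<theta>) + 1 \<otimes> einc1 Z \<theta>)"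

definition cov_deriv :: "'o \<Rightarrow> 'o" where
  "cov_deriv \<phi> =
     odiff Z \<phi> - (\<Sum>k\<in>degs (ograde Z) \<phi>. (-1) ^ k *\<^sub>C
        tlift (\<lambda>\<psi> h. \<psi> * \<omega> (qgerm h)) (coact_Hor (hcomp (ograde Z) k \<phi>)))"


subsection \<open>Associated bundles\<close>

definition assoc_bundle :: "('v \<Rightarrow> 'p) set" where
  "assoc_bundle = Mor UNIV \<delta> UNIV (coact Z)"

(* The tensor product of base forms and the associated bundle over the algebra of the base is
   built as a quotient of the free vector space on their cartesian product; its elements are
   cosets. *)
definition btensor_rels :: "('o, 'p, 'v) bfree set" where
  "btensor_rels =
     {gen (\<mu> + \<nu>, T) - gen (\<mu>, T) - gen (\<nu>, T) | \<mu> \<nu> T.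
        \<mu> \<in> base_forms \<and> \<nu> \<in> base_forms \<and> T \<in> assoc_bundle} \<union>
     {gen (\<mu>, T + U) - gen (\<mu>, T) - gen (\<mu>, U) | \<mu> T U.
        \<mu> \<in> base_forms \<and> T \<in> assoc_bundle \<and> U \<in> assoc_bundle} \<union>
     {gen (c *\<^sub>C \<mu>, T) - c *\<^sub>C gen (\<mu>, T) | c \<mu> T.
        \<mu> \<in> base_forms \<and> T \<in> assoc_bundle} \<union>
     {gen (\<mu> * pinc Z b, T) - gen (\<mu>, \<lambda>v. b * T v) | \<mu> b T.
        \<mu> \<in> base_forms \<and> b \<in> base Z \<and> T \<in> assoc_bundle}"

definition bcoset :: "('o, 'p, 'v) bfree \<Rightarrow> ('o, 'p, 'v) bfree set" where
  "bcoset p = {q. q - p \<in> cspan btensor_rels}"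

definition btensor :: "('o, 'p, 'v) bfree set set" where
  "btensor =
     bcoset ` {p. Poly_Mapping.keys p \<subseteq> base_forms \<times> assoc_bundle}"

definition bpure :: "'o \<Rightarrow> ('v \<Rightarrow> 'p) \<Rightarrow> ('o, 'p, 'v) bfree set" where
  "bpure \<mu> T = bcoset (gen (\<mu>, T))"

definition badd :: "('o, 'p, 'v) bfree set \<Rightarrow> ('o, 'p, 'v) bfree set \<Rightarrow> ('o, 'p, 'v) bfree set" where
  "badd X Y = (\<Union>x\<in>X. \<Union>y\<in>Y. bcoset (x + y))"

definition bscale :: "complex \<Rightarrow> ('o, 'p, 'v) bfree set \<Rightarrow> ('o, 'p, 'v) bfree set" where
  "bscale c X = (\<Union>x\<in>X. bcoset (c *\<^sub>C x))"

definition blmult :: "'o \<Rightarrow> ('o, 'p, 'v) bfree set \<Rightarrow> ('o, 'p, 'v) bfree set" where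
  "blmult \<mu> X = (\<Union>x\<in>X. bcoset (lin_ext (\<lambda>(\<nu>, T). gen (\<mu> * \<nu>, T)) x))"

definition Upsilon_inv :: "('o, 'p, 'v) bfree set \<Rightarrow> 'v \<Rightarrow> 'o" where
  "Upsilon_inv X = (THE \<tau>. \<forall>x\<in>X. \<tau> = lin_ext (\<lambda>(\<mu>, T) v. \<mu> * pinc Z (T v)) x)"

definition Upsilon :: "('v \<Rightarrow> 'o) \<Rightarrow> ('o, 'p, 'v) bfree set" where
  "Upsilon =
     restrict (the_inv_into btensor Upsilon_inv) (Mor UNIV \<delta> Hor coact_Hor)"

definition linear_connection :: "('v \<Rightarrow> 'p) \<Rightarrow> ('o, 'p, 'v) bfree set" where
  "linear_connection T = Upsilon (cov_deriv \<circ> (pinc Z \<circ> T))"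

definition ext_cov_deriv :: "('o, 'p, 'v) bfree set \<Rightarrow> ('o, 'p, 'v) bfree set" where
  "ext_cov_deriv =
     (THE f. f \<in> btensor \<rightarrow>\<^sub>E btensor \<and>
        (\<forall>X\<in>btensor. \<forall>Y\<in>btensor. f (badd X Y) = badd (f X) (f Y)) \<and>
        (\<forall>c. \<forall>X\<in>btensor. f (bscale c X) = bscale c (f X)) \<and>
        (\<forall>k. \<forall>\<mu>\<in>base_forms \<inter> ograde Z k. \<forall>T\<in>assoc_bundle.
           f (bpure \<mu> T) =
             badd (bpure (odiff Z \<mu>) T)
               (bscale ((-1) ^ k) (blmult \<mu> (linear_connection T)))))"

end

end

(*
The horizontal morphisms tau (elements of Mor(delta, Delta_Hor)) are exactly the combinations
sum_k mu_k T_k with base forms mu_k: for a frame T_1, ..., T_d of the associated bundle, i.e.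
sum_k T_k(x)* T_k(y) = <x, y> 1, take mu_k = sum_i tau(e_i) T_k(e_i)*. The same expansion of
mu T shows that it determines mu (x)_B T, so Upsilon_V^-1 is bijective. Frames exist for irreducible
corepresentations by hypothesis; in general they are assembled along an orthogonal decomposition
into invariant subspaces, the complement of an invariant subspace being invariant because the
matrix coefficients satisfy S(u_ij) = u_ji*.

On degree 0, D = d - (.)omega(pi(.)) is covariant because the inhomogeneous term 1 (x) theta in the
coaction of omega cancels the term from d of the coaction. Together with the Leibniz rule
D(mu phi) = d(mu) phi + (-1)^k mu D(phi) for a base form mu of degree k this shows that
Upsilon_V o D o Upsilon_V^-1 satisfies the properties that characterise the exterior covariant
derivative, and these determine it since pure tensors with homogeneous base forms span.
*)
theory Submission
  imports Defs
begin

section \<open>Linear maps and tensor products\<close>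

text \<open>Several objects of the statement are definite descriptions (\<open>coact_Hor\<close>,
  \<open>ad\<close>, \<open>Upsilon_inv\<close>, \<open>ext_cov_deriv\<close>), and each must be
  replaced by an equation before anything can be computed. For \<open>ad\<close> the source is
  bicovariance: the right coaction of \<Gamma> sends \<pi>(h) to \<pi>(h2) \<otimes> S(h1)h3, which
  therefore depends on \<pi>(h) alone. Frames are given only for irreducible corepresentations on
  subspaces of the finitely supported sequences, whereas \<delta> lives on an arbitrary type.
  Invariant subspaces are transported to sequences by coordinates, and a frame for a summand is a
  family that reproduces the orthogonal projection onto it; with this convention frames of
  complementary summands are simply concatenated. The balanced tensor product consists of cosets
  without a vector space type. The map \<open>ev\<close> on representatives stands in for
  \<open>Upsilon_inv\<close>: its kernel on the span of admissible generators is exactly the span of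
  the relations, and every statement about cosets is reduced to it.\<close>

lemma clinear_add: "clinear f \<Longrightarrow> f (x + y) = f x + f y"
  and clinear_scale: "clinear f \<Longrightarrow> f (c *\<^sub>C x) = c *\<^sub>C f x"
  by (simp_all add: Vector_Spaces.linear_iff)

global_interpretation cvp: vector_space_pair
  "cscale :: complex \<Rightarrow> 'a \<Rightarrow> 'a :: complex_space" "cscale :: complex \<Rightarrow> 'b \<Rightarrow> 'b :: complex_space"
  by unfold_locales

lemmas clinear_0 = cvp.linear_0
lemmas clinear_diff = cvp.linear_diff
lemmas clinear_sum = cvp.linear_sum

lemma clinear_comp: "clinear f \<Longrightarrow> clinear g \<Longrightarrow> clinear (\<lambda>x. f (g x))"
  by (simp add: Vector_Spaces.linear_iff cvs.vector_space_axioms)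

lemma clinear_id: "clinear (\<lambda>x. x)" "clinear id"
  by (simp_all add: clinearI)

lemma clinear_sum_fun:
  "(\<And>i. i \<in> A \<Longrightarrow> clinear (f i)) \<Longrightarrow> clinear (\<lambda>x. \<Sum>i\<in>A. f i x)"
  by (intro clinearI)
    (simp_all add: clinear_add clinear_scale sum.distrib cvs.scale_sum_right)

lemma clinear_cscale_fun: "clinear f \<Longrightarrow> clinear (\<lambda>x. c *\<^sub>C f x)"
  by (intro clinearI)
    (simp_all add: clinear_add clinear_scale cscale_add_right cvs.scale_left_commute[of c])

lemma clinear_add_fun: "clinear f \<Longrightarrow> clinear g \<Longrightarrow> clinear (\<lambda>x. f x + g x)"
  by (intro clinearI) (simp_all add: clinear_add clinear_scale cscale_add_right)

lemma clinear_diff_fun: "clinear f \<Longrightarrow> clinear g \<Longrightarrow> clinear (\<lambda>x. f x - g x)"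
  by (intro clinearI) (simp_all add: clinear_add clinear_scale cvs.scale_right_diff_distrib)

lemma cbilinearI:
  assumes "\<And>x y b. f (x + y) b = f x b + f y b" "\<And>c x b. f (c *\<^sub>C x) b = c *\<^sub>C f x b"
    and "\<And>a x y. f a (x + y) = f a x + f a y" "\<And>c a x. f a (c *\<^sub>C x) = c *\<^sub>C f a x"
  shows "cbilinear f"
  unfolding cbilinear_def by (auto intro!: clinearI assms)

lemma cbilinearD:
  assumes "cbilinear f"
  shows "clinear (\<lambda>a. f a b)" "clinear (f a)"
    "f (x + y) b = f x b + f y b" "f (c *\<^sub>C x) b = c *\<^sub>C f x b"
    "f a (v + w) = f a v + f a w" "f a (c *\<^sub>C v) = c *\<^sub>C f a v"
proof -
  show l: "clinear (\<lambda>a. f a b)" and r: "clinear (f a)" for a b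
    using assms by (auto simp: cbilinear_def)
  show "f (x + y) b = f x b + f y b" "f (c *\<^sub>C x) b = c *\<^sub>C f x b"
    using clinear_add[OF l] clinear_scale[OF l] by auto
  show "f a (v + w) = f a v + f a w" "f a (c *\<^sub>C v) = c *\<^sub>C f a v"
    using clinear_add[OF r] clinear_scale[OF r] by auto
qed

text \<open>Coassociativity rearranges expressions in three Sweedler legs. Multilinearity has to be
  tracked explicitly, because \<open>tlift\<close> of a function that is not bilinear depends on the
  representative chosen by \<open>rep_tensor\<close>.\<close>

definition ctrilinear ::
    "('a::complex_space \<Rightarrow> 'b::complex_space \<Rightarrow> 'c::complex_space \<Rightarrow> 'd::complex_space) \<Rightarrow> bool" where
  "ctrilinear f \<longleftrightarrow>
     (\<forall>b c. clinear (\<lambda>a. f a b c)) \<and> (\<forall>a c. clinear (\<lambda>b. f a b c)) \<and> (\<forall>a b. clinear (f a b))"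

lemma ctrilinearI:
  assumes "\<And>x y b c. f (x + y) b c = f x b c + f y b c" "\<And>k x b c. f (k *\<^sub>C x) b c = k *\<^sub>C f x b c"
    and "\<And>a x y c. f a (x + y) c = f a x c + f a y c" "\<And>k a x c. f a (k *\<^sub>C x) c = k *\<^sub>C f a x c"
    and "\<And>a b x y. f a b (x + y) = f a b x + f a b y" "\<And>k a b x. f a b (k *\<^sub>C x) = k *\<^sub>C f a b x"
  shows "ctrilinear f"
  unfolding ctrilinear_def by (auto intro!: clinearI assms)

lemma ctrilinear_cbilinear:
  assumes "ctrilinear f"
  shows "cbilinear (\<lambda>a b. f a b c)" "cbilinear (f a)"
  using assms by (auto simp: ctrilinear_def cbilinear_def)

lemma poly_mapping_sum_gen:
  "p = (\<Sum>x\<in>Poly_Mapping.keys p. Poly_Mapping.lookup p x *\<^sub>C gen x)"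
  by (rule poly_mapping_eqI)
    (auto simp: lookup_sum lookup_single when_def cscale_complex_def in_keys_iff
      if_distrib[of "\<lambda>y. _ * y"] cong: if_cong)

lemma abs_tensor_lin_ext: "abs_tensor p = lin_ext (\<lambda>(a, b). a \<otimes> b) p"
proof -
  have "clinear (abs_tensor :: _ \<Rightarrow> ('a, 'b) tensor)"
    by (intro clinearI) (simp_all add: plus_tensor.abs_eq cscale_tensor.abs_eq)
  note abs = clinear_sum[OF this] clinear_scale[OF this]
  have "abs_tensor p = abs_tensor (\<Sum>x\<in>Poly_Mapping.keys p. Poly_Mapping.lookup p x *\<^sub>C gen x)"
    by (rule arg_cong[OF poly_mapping_sum_gen])
  then show ?thesis
    by (simp add: abs lin_ext_def tensor_elem.abs_eq case_prod_beta)
qed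

text \<open>A scalar can be absorbed into the left factor of a pure tensor, so closure under sums is
  enough.\<close>

lemma tensor_induct [case_names pure add]:
  assumes pure: "\<And>a b. Q (a \<otimes> b)" and add: "\<And>s t. Q s \<Longrightarrow> Q t \<Longrightarrow> Q (s + t)"
  shows "Q t"
proof (induction t rule: tensor.abs_induct)
  fix p :: "('a \<times> 'b) \<Rightarrow>\<^sub>0 complex"
  have "Q (\<Sum>x\<in>S. Poly_Mapping.lookup p x *\<^sub>C (fst x \<otimes> snd x))" if "finite S" for S
    using that
  proof (induction S)
    case empty
    have "(0 :: 'a) \<otimes> (0 :: 'b) = 0"
      using tensor_cscale_left[of 0 "0::'a" "0::'b"] by simp
    then show ?case using pure[of 0 0] by simp
  next
    case (insert x S)
    then show ?case
      using pure[of "Poly_Mapping.lookup p x *\<^sub>C fst x" "snd x"]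
      by (simp add: add tensor_cscale_left)
  qed
  then show "Q (abs_tensor p)"
    by (simp add: abs_tensor_lin_ext lin_ext_def case_prod_beta)
qed

lemma clinear_tensor_eqI:
  assumes "clinear f" "clinear g" "\<And>a b. f (a \<otimes> b) = g (a \<otimes> b)"
  shows "f t = g t"
  by (induction t rule: tensor_induct) (simp_all add: assms clinear_add)

lemma cbilinear_tensor: "cbilinear (\<otimes>)"
  by (intro cbilinearI tensor_add_left tensor_add_right tensor_cscale_left tensor_cscale_right)

lemmas tensor_sum_left = clinear_sum[OF cbilinearD(1)[OF cbilinear_tensor]]
lemmas tensor_sum_right = clinear_sum[OF cbilinearD(2)[OF cbilinear_tensor]]
lemmas tensor_0_left [simp] = clinear_0[OF cbilinearD(1)[OF cbilinear_tensor]]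
lemmas tensor_0_right [simp] = clinear_0[OF cbilinearD(2)[OF cbilinear_tensor]]
lemmas tensor_diff_left = clinear_diff[OF cbilinearD(1)[OF cbilinear_tensor]]

text \<open>\<open>tlift\<close> evaluates its function on one fixed representative of
  \<open>t\<close>, hence is linear in the function, whatever that function is. The next lemmas are
  instances of this.\<close>

lemma tlift_fun_comp: "clinear L \<Longrightarrow> L (tlift f t) = tlift (\<lambda>a b. L (f a b)) t"
  by (simp add: tlift_def lin_ext_def clinear_sum clinear_scale case_prod_beta)

lemma tlift_fun_add: "tlift (\<lambda>a b. f a b + g a b) t = tlift f t + tlift g t"
  by (simp add: tlift_def lin_ext_def case_prod_beta cscale_add_right sum.distrib)

lemma tlift_fun_cscale: "tlift (\<lambda>a b. c *\<^sub>C f a b) t = c *\<^sub>C tlift f t"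
  using tlift_fun_comp[of "(*\<^sub>C) c" f t] by (simp add: clinear_cscale_fun clinear_id)

lemma tlift_fun_diff: "tlift (\<lambda>a b. f a b - g a b) t = tlift f t - tlift g t"
  using tlift_fun_add[of "\<lambda>a b. f a b - g a b" g t] by simp

lemma tlift_fun_0 [simp]: "tlift (\<lambda>a b. 0) t = 0"
  by (simp add: tlift_def lin_ext_def case_prod_beta)

lemma tlift_fun_sum: "tlift (\<lambda>a b. \<Sum>i\<in>A. f i a b) t = (\<Sum>i\<in>A. tlift (f i) t)"
  by (induction A rule: infinite_finite_induct) (simp_all add: tlift_fun_add)

lemmas linear_simps = tensor_add_left tensor_add_right tensor_cscale_left tensor_cscale_right
  cscale_add_right cvs.scale_left_commute ring_distribs cscale_mult_left cscale_mult_right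
  tlift_fun_add tlift_fun_cscale

lemma clinear_tlift_arg:
  assumes "cbilinear f" "clinear g"
  shows "clinear (\<lambda>x. tlift f (g x))"
  by (rule clinear_comp[OF clinear_tlift[OF assms(1)] assms(2)])

lemma tlift_add: "cbilinear f \<Longrightarrow> tlift f (s + t) = tlift f s + tlift f t"
  and tlift_cscale: "cbilinear f \<Longrightarrow> tlift f (c *\<^sub>C s) = c *\<^sub>C tlift f s"
  and tlift_sum: "cbilinear f \<Longrightarrow> tlift f (\<Sum>i\<in>A. h i) = (\<Sum>i\<in>A. tlift f (h i))"
  by (simp_all add: clinear_add clinear_scale clinear_sum clinear_tlift)

lemma cbilinear_tensor_comp:
  "clinear f \<Longrightarrow> clinear g \<Longrightarrow> cbilinear (\<lambda>a b. f a \<otimes> g b)"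
  by (intro cbilinearI) (simp_all add: clinear_add clinear_scale linear_simps)

lemma clinear_tmap: "clinear f \<Longrightarrow> clinear g \<Longrightarrow> clinear (tmap f g)"
  unfolding tmap_def by (intro clinear_tlift cbilinear_tensor_comp)

lemma tmap_tensor: "clinear f \<Longrightarrow> clinear g \<Longrightarrow> tmap f g (a \<otimes> b) = f a \<otimes> g b"
  by (simp add: tmap_def tlift_tensor cbilinear_tensor_comp)

lemma cbilinear_comp:
  "cbilinear h \<Longrightarrow> clinear f \<Longrightarrow> clinear g \<Longrightarrow> cbilinear (\<lambda>a b. h (f a) (g b))"
  by (intro cbilinearI) (simp_all add: clinear_add clinear_scale cbilinearD)

lemma tlift_tmap:
  assumes "cbilinear h" "clinear f" "clinear g"
  shows "tlift h (tmap f g t) = tlift (\<lambda>a b. h (f a) (g b)) t"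
  by (rule clinear_tensor_eqI)
    (simp_all add: assms clinear_tlift_arg clinear_tmap clinear_tlift tmap_tensor tlift_tensor
      cbilinear_comp)

lemma tmap_tmap:
  assumes "clinear f" "clinear g" "clinear f'" "clinear g'"
  shows "tmap f' g' (tmap f g t) = tmap (\<lambda>a. f' (f a)) (\<lambda>b. g' (g b)) t"
  by (subst (1) tmap_def, subst tlift_tmap)
    (simp_all add: assms cbilinear_tensor_comp tmap_def)

lemma tmap_ident: "tmap id id t = t" "tmap (\<lambda>x. x) (\<lambda>x. x) t = t"
  by (rule clinear_tensor_eqI; simp add: clinear_tmap clinear_id tmap_tensor)+

lemma tlift_tensor_id: "tlift (\<otimes>) t = t"
  by (rule clinear_tensor_eqI) (simp_all add: clinear_tlift clinear_id tlift_tensor cbilinear_tensor)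

lemma clinear_left_inverse:
  assumes "clinear (f :: 'a::complex_space \<Rightarrow> 'b::complex_space)" "inj f"
  obtains g where "clinear g" "\<And>x. g (f x) = x"
  using cvp.linear_injective_left_inverse[OF assms] by (auto simp: fun_eq_iff)

text \<open>Over a field injective linear maps split, and the tensor product of the left inverses is
  a left inverse. This is what lets coactions be compared after embedding into the tensor product
  with the envelope.\<close>

lemma inj_tmap:
  assumes "clinear f" "inj f" "clinear g" "inj g"
  shows "inj (tmap f g)"
proof -
  obtain f' g' where f': "clinear f'" "\<And>x. f' (f x) = x" and g': "clinear g'" "\<And>x. g' (g x) = x"
    using clinear_left_inverse assms by metis
  then have "tmap f' g' (tmap f g t) = t" for t
    using assms by (simp add: tmap_tmap tmap_ident)
  then show ?thesis by (rule inj_on_inverseI)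
qed

lemma subtensor_image_tmap:
  assumes "clinear f" "clinear g"
  shows "subtensor (range f) (range g) = range (tmap f g)"
proof
  have "csubspace (range (tmap f g))"
    using cvp.linear_subspace_image[OF clinear_tmap[OF assms] cvs.subspace_UNIV] .
  then show "subtensor (range f) (range g) \<subseteq> range (tmap f g)"
    unfolding subtensor_def
    by (intro cvs.span_minimal) (auto simp: tmap_tensor[OF assms, symmetric])
  have "tmap f g t \<in> subtensor (range f) (range g)" for t
  proof (induction t rule: tensor_induct)
    case (pure a b)
    then show ?case
      unfolding subtensor_def tmap_tensor[OF assms] by (intro cvs.span_base) blast
  next
    case (add s t)
    then show ?case
      unfolding clinear_add[OF clinear_tmap[OF assms]] by (simp add: subtensor_def cvs.span_add)
  qed
  then show "range (tmap f g) \<subseteq> subtensor (range f) (range g)" by blast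
qed

lemma subtensor_mono: "V \<subseteq> V' \<Longrightarrow> W \<subseteq> W' \<Longrightarrow> subtensor V W \<subseteq> subtensor V' W'"
  unfolding subtensor_def by (intro cvs.span_mono) blast

lemma tmap_in_subtensor:
  assumes "clinear f" "clinear g" "range f \<subseteq> V" "range g \<subseteq> W"
  shows "tmap f g t \<in> subtensor V W"
  using subtensor_image_tmap[OF assms(1,2)] subtensor_mono[OF assms(3,4)] by blast

lemma subtensor_induct [consumes 1, case_names zero step]:
  assumes "t \<in> subtensor V W" "Q 0"
    and "\<And>c v w s. v \<in> V \<Longrightarrow> w \<in> W \<Longrightarrow> Q s \<Longrightarrow> Q (c *\<^sub>C (v \<otimes> w) + s)"
  shows "Q t"
  using assms(1) unfolding subtensor_def
  by (induction rule: cvs.span_induct_alt) (auto intro: assms)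

subsection \<open>Sweedler calculus\<close>

lemma
  fixes a :: "'a::complex_space" and b :: "'b::complex_space" and c :: "'c::complex_space"
  shows clinear_tassoc: "clinear (tassoc :: (('a, 'b) tensor, 'c) tensor \<Rightarrow> _)"
    and tassoc_tensor: "tassoc ((a \<otimes> b) \<otimes> c) = a \<otimes> (b \<otimes> c)"
proof -
  have b: "cbilinear (\<lambda>(a :: 'a) (b :: 'b). a \<otimes> (b \<otimes> c))" for c :: 'c
    by (intro cbilinearI) (simp_all add: linear_simps)
  have "cbilinear (\<lambda>(s :: ('a, 'b) tensor) (c :: 'c). tlift (\<lambda>a b. a \<otimes> (b \<otimes> c)) s)"
    by (intro cbilinearI) (simp_all add: linear_simps tlift_add[OF b] tlift_cscale[OF b])
  then show "clinear (tassoc :: (('a, 'b) tensor, 'c) tensor \<Rightarrow> _)"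
    and "tassoc ((a \<otimes> b) \<otimes> c) = a \<otimes> (b \<otimes> c)"
    by (simp_all add: tassoc_def clinear_tlift tlift_tensor b)
qed

lemma cbilinear_tlift_left:
  assumes "ctrilinear f" "clinear d"
  shows "cbilinear (\<lambda>a b. tlift (\<lambda>x y. f x y b) (d a))"
  using assms unfolding ctrilinear_def
  by (intro cbilinearI)
    (simp_all add: clinear_add clinear_scale tlift_add tlift_cscale ctrilinear_cbilinear[OF assms(1)]
      tlift_fun_add tlift_fun_cscale)

lemma cbilinear_tlift_right:
  assumes "ctrilinear f" "clinear d"
  shows "cbilinear (\<lambda>a b. tlift (f a) (d b))"
proof -
  have "f (x + y) = (\<lambda>b c. f x b c + f y b c)" "f (k *\<^sub>C x) = (\<lambda>b c. k *\<^sub>C f x b c)" for x y k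
    using assms(1) by (auto simp: ctrilinear_def fun_eq_iff Vector_Spaces.linear_iff)
  then show ?thesis
    by (intro cbilinearI)
      (simp_all add: clinear_add clinear_scale tlift_add tlift_cscale assms
        ctrilinear_cbilinear[OF assms(1)] tlift_fun_add tlift_fun_cscale)
qed

lemma tlift_tassoc:
  assumes "ctrilinear f"
  shows "tlift (\<lambda>a s. tlift (f a) s) (tassoc u) = tlift (\<lambda>s c. tlift (\<lambda>a b. f a b c) s) u"
proof (induction u rule: tensor_induct)
  note bil = cbilinear_tlift_right[OF assms clinear_id(1)] cbilinear_tlift_left[OF assms clinear_id(1)]
  case (pure s c)
  show ?case
  proof (induction s rule: tensor_induct)
    case (pure a b)
    then show ?case
      by (simp add: tassoc_tensor tlift_tensor bil ctrilinear_cbilinear[OF assms])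
  next
    case (add s t)
    then show ?case
      by (simp add: tensor_add_left clinear_add[OF clinear_tassoc] tlift_add[OF bil(1)]
          tlift_add[OF bil(2)])
  qed
next
  note bil = cbilinear_tlift_right[OF assms clinear_id(1)] cbilinear_tlift_left[OF assms clinear_id(1)]
  case (add s t)
  then show ?case
    by (simp add: clinear_add[OF clinear_tassoc] tlift_add[OF bil(1)] tlift_add[OF bil(2)])
qed

text \<open>The Sweedler rule: summing f(v_00, v_01, v_1) is summing f(v_0, v_11, v_12). With
  \<open>\<delta>\<close> and \<open>\<Delta>\<close> kept apart it serves the comultiplication, the
  coaction on the bundle and corepresentations alike.\<close>

lemma coassoc_tlift:
  assumes "tassoc (tmap \<delta> id (\<delta> v)) = tmap id \<Delta> (\<delta> v)" "clinear \<delta>" "clinear \<Delta>" "ctrilinear f"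
  shows "tlift (\<lambda>a b. tlift (\<lambda>a' a''. f a' a'' b) (\<delta> a)) (\<delta> v) =
    tlift (\<lambda>a b. tlift (f a) (\<Delta> b)) (\<delta> v)"
proof -
  have "tlift (\<lambda>a b. tlift (\<lambda>a' a''. f a' a'' b) (\<delta> a)) (\<delta> v) =
      tlift (\<lambda>s c. tlift (\<lambda>a b. f a b c) s) (tmap \<delta> id (\<delta> v))"
    by (simp add: tlift_tmap[OF cbilinear_tlift_left[OF assms(4) clinear_id(1)]] assms clinear_id)
  also have "\<dots> = tlift (\<lambda>a s. tlift (f a) s) (tmap id \<Delta> (\<delta> v))"
    by (simp add: tlift_tassoc[OF assms(4), symmetric] assms(1))
  also have "\<dots> = tlift (\<lambda>a b. tlift (f a) (\<Delta> b)) (\<delta> v)"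
    by (simp add: tlift_tmap[OF cbilinear_tlift_right[OF assms(4) clinear_id(1)]] assms clinear_id)
  finally show ?thesis .
qed

subsection \<open>Products of tensors\<close>

lemma cbilinear_mult: "cbilinear (\<lambda>a b :: 'a::complex_algebra. a * b)"
  by (intro cbilinearI) (simp_all add: linear_simps)

lemma
  fixes a a' :: "'a::complex_algebra" and b b' :: "'b::complex_algebra"
  shows tmult_tensor: "tmult (a \<otimes> b) (a' \<otimes> b') = (a * a') \<otimes> (b * b')"
    and cbilinear_tmult: "cbilinear (tmult :: ('a, 'b) tensor \<Rightarrow> _)"
proof -
  have b: "cbilinear (\<lambda>a' b'. (a * a') \<otimes> (b * b'))" for a :: 'a and b :: 'b
    by (intro cbilinearI) (simp_all add: linear_simps)
  have c: "cbilinear (\<lambda>a b. tlift (\<lambda>a' b'. (a * a') \<otimes> (b * b')) t)" for t :: "('a, 'b) tensor"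
    by (intro cbilinearI) (simp_all add: linear_simps)
  have "cbilinear (\<lambda>a b. (a * a') \<otimes> (b * b'))"
    by (intro cbilinearI) (simp_all add: linear_simps)
  then show "tmult (a \<otimes> b) (a' \<otimes> b') = (a * a') \<otimes> (b * b')"
    by (simp add: tmult_def tlift_tensor b)
  show "cbilinear (tmult :: ('a, 'b) tensor \<Rightarrow> _)"
    by (intro cbilinearI)
      (simp_all add: tmult_def tlift_add tlift_cscale b c linear_simps)
qed

section \<open>Graded spaces\<close>

locale graded_space =
  fixes G :: "nat \<Rightarrow> 'a::complex_space set"
  assumes subspace_grade: "csubspace (G k)"
    and ex1_decomposition: "\<exists>!f. decomposition G x f"
begin

lemma hcomp_eq: "decomposition G x f \<Longrightarrow> hcomp G k x = f k"
  unfolding hcomp_def using ex1_decomposition[of x] by (simp add: the1_equality)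

lemma decomposition_hcomp: "decomposition G x (\<lambda>k. hcomp G k x)"
proof -
  obtain f where f: "decomposition G x f" using ex1_decomposition by blast
  then have "(\<lambda>k. hcomp G k x) = f" by (simp add: hcomp_eq fun_eq_iff)
  with f show ?thesis by simp
qed

lemma hcomp_in [simp]: "hcomp G k x \<in> G k"
  and finite_degs [simp]: "finite (degs G x)"
  and sum_hcomp: "(\<Sum>k\<in>degs G x. hcomp G k x) = x"
  using decomposition_hcomp[of x] by (auto simp: decomposition_def degs_def)

lemma decompositionI:
  assumes "finite A" "\<And>k. f k \<in> G k" "\<And>k. k \<notin> A \<Longrightarrow> f k = 0" "x = (\<Sum>k\<in>A. f k)"
  shows "decomposition G x f"
proof -
  have *: "{k. f k \<noteq> 0} \<subseteq> A" using assms(3) by blast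
  then have "(\<Sum>k | f k \<noteq> 0. f k) = (\<Sum>k\<in>A. f k)"
    using assms(1) by (intro sum.mono_neutral_left) auto
  with * assms show ?thesis
    by (auto simp: decomposition_def intro: finite_subset)
qed

lemma sum_hcomp_superset:
  assumes "finite A" "degs G x \<subseteq> A"
  shows "x = (\<Sum>k\<in>A. hcomp G k x)"
  using assms by (subst sum_hcomp[symmetric]) (intro sum.mono_neutral_left, auto simp: degs_def)

lemma clinear_hcomp: "clinear (hcomp G k)"
proof (rule clinearI)
  fix x y
  have "decomposition G (x + y) (\<lambda>k. hcomp G k x + hcomp G k y)"
  proof (rule decompositionI)
    let ?A = "degs G x \<union> degs G y"
    show "finite ?A" by simp
    show "hcomp G k x + hcomp G k y \<in> G k" for k by (simp add: cvs.subspace_add subspace_grade)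
    show "hcomp G k x + hcomp G k y = 0" if "k \<notin> ?A" for k using that by (simp add: degs_def)
    show "x + y = (\<Sum>k\<in>?A. hcomp G k x + hcomp G k y)"
      by (simp add: sum.distrib flip: sum_hcomp_superset)
  qed
  then show "hcomp G k (x + y) = hcomp G k x + hcomp G k y" by (rule hcomp_eq)
next
  fix c x
  have "decomposition G (c *\<^sub>C x) (\<lambda>k. c *\<^sub>C hcomp G k x)"
  proof (rule decompositionI)
    show "finite (degs G x)" by simp
    show "c *\<^sub>C hcomp G k x \<in> G k" for k by (simp add: cvs.subspace_scale subspace_grade)
    show "c *\<^sub>C hcomp G k x = 0" if "k \<notin> degs G x" for k using that by (simp add: degs_def)
    show "c *\<^sub>C x = (\<Sum>k\<in>degs G x. c *\<^sub>C hcomp G k x)"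
      by (simp add: sum_hcomp flip: cvs.scale_sum_right)
  qed
  then show "hcomp G k (c *\<^sub>C x) = c *\<^sub>C hcomp G k x" by (rule hcomp_eq)
qed

lemma hcomp_homogeneous:
  assumes "x \<in> G j"
  shows "hcomp G k x = (if k = j then x else 0)"
proof -
  have "decomposition G x (\<lambda>k. if k = j then x else 0)"
    by (rule decompositionI[of "{j}"]) (auto simp: assms cvs.subspace_0 subspace_grade)
  then show ?thesis by (rule hcomp_eq)
qed

lemma graded_induct [case_names homogeneous add]:
  assumes "\<And>k x. x \<in> G k \<Longrightarrow> Q x" "\<And>x y. Q x \<Longrightarrow> Q y \<Longrightarrow> Q (x + y)"
  shows "Q x"
proof -
  have "Q (\<Sum>k\<in>A. hcomp G k x)" if "finite A" for A
    using that
  proof (induction A)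
    case empty
    then show ?case using assms(1)[of 0 0] by (simp add: cvs.subspace_0 subspace_grade)
  next
    case (insert k A)
    then show ?case using assms(2) assms(1)[of "hcomp G k x" k] by simp
  qed
  from this[of "degs G x"] show ?thesis by (simp add: sum_hcomp)
qed

lemma sum_degs_superset:
  assumes "finite A" "degs G x \<subseteq> A" "\<And>k. F k 0 = 0"
  shows "(\<Sum>k\<in>degs G x. F k (hcomp G k x)) = (\<Sum>k\<in>A. F k (hcomp G k x))"
  using assms by (intro sum.mono_neutral_left) (auto simp: degs_def)

text \<open>The index set varies with x, so linearity is not termwise. The sums are first extended
  to a common finite set of degrees; the added terms vanish because
  \<open>F k 0 = 0\<close>.\<close>

lemma clinear_sum_degs:
  assumes F: "\<And>k. clinear (F k)"
  shows "clinear (\<lambda>x. \<Sum>k\<in>degs G x. F k (hcomp G k x))"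
proof (rule clinearI)
  note F0 = clinear_0[OF F]
  note lin = clinear_add[OF clinear_hcomp] clinear_scale[OF clinear_hcomp]
    clinear_add[OF F] clinear_scale[OF F]
  fix x y c
  let ?A = "degs G x \<union> degs G y \<union> degs G (x + y)"
  have *: "(\<Sum>k\<in>degs G z. F k (hcomp G k z)) = (\<Sum>k\<in>?A. F k (hcomp G k z))"
    if "degs G z \<subseteq> ?A" for z
    using that by (intro sum_degs_superset) (auto simp: F0)
  show "(\<Sum>k\<in>degs G (x + y). F k (hcomp G k (x + y))) =
      (\<Sum>k\<in>degs G x. F k (hcomp G k x)) + (\<Sum>k\<in>degs G y. F k (hcomp G k y))"
    by (subst (1 2 3) *) (auto simp: lin sum.distrib)
  have "degs G (c *\<^sub>C x) \<subseteq> degs G x"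
    by (auto simp: degs_def lin)
  then have "(\<Sum>k\<in>degs G (c *\<^sub>C x). F k (hcomp G k (c *\<^sub>C x))) =
      (\<Sum>k\<in>degs G x. F k (hcomp G k (c *\<^sub>C x)))"
    by (intro sum_degs_superset) (auto simp: F0)
  then show "(\<Sum>k\<in>degs G (c *\<^sub>C x). F k (hcomp G k (c *\<^sub>C x))) =
      c *\<^sub>C (\<Sum>k\<in>degs G x. F k (hcomp G k x))"
    by (simp add: lin cvs.scale_sum_right)
qed

lemma sum_degs_homogeneous:
  assumes "x \<in> G j" "\<And>k. F k 0 = 0"
  shows "(\<Sum>k\<in>degs G x. F k (hcomp G k x)) = F j x"
proof -
  have "degs G x \<subseteq> {j}" by (auto simp: degs_def hcomp_homogeneous[OF assms(1)])
  then have "(\<Sum>k\<in>degs G x. F k (hcomp G k x)) = (\<Sum>k\<in>{j}. F k (hcomp G k x))"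
    by (intro sum_degs_superset) (auto simp: assms)
  then show ?thesis by (simp add: hcomp_homogeneous[OF assms(1)])
qed

lemma
  assumes "clinear d" "clinear d'"
  shows clinear_gtdiff: "clinear (gtdiff G d d')"
    and gtdiff_tensor: "x \<in> G k \<Longrightarrow> gtdiff G d d' (x \<otimes> y) = d x \<otimes> y + (-1) ^ k *\<^sub>C (x \<otimes> d' y)"
proof -
  have l: "clinear (\<lambda>x. \<Sum>k\<in>degs G x. (-1) ^ k *\<^sub>C (hcomp G k x \<otimes> d' y))" for y
    by (rule clinear_sum_degs[where F = "\<lambda>k x. (-1) ^ k *\<^sub>C (x \<otimes> d' y)"])
      (intro clinearI; simp add: linear_simps)
  have b: "cbilinear (\<lambda>a b. d a \<otimes> b + (\<Sum>k\<in>degs G a. (-1) ^ k *\<^sub>C (hcomp G k a \<otimes> d' b)))"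
    by (intro cbilinearI)
      (simp_all only: clinear_add[OF l] clinear_scale[OF l],
       simp_all add: assms clinear_add clinear_scale linear_simps sum.distrib cvs.scale_sum_right
         mult.commute)
  show "clinear (gtdiff G d d')"
    unfolding gtdiff_def by (rule clinear_tlift[OF b])
  show "gtdiff G d d' (x \<otimes> y) = d x \<otimes> y + (-1) ^ k *\<^sub>C (x \<otimes> d' y)" if "x \<in> G k"
    unfolding gtdiff_def tlift_tensor[OF b]
    by (subst sum_degs_homogeneous[OF that, where F = "\<lambda>k x. (-1) ^ k *\<^sub>C (x \<otimes> d' y)"]) simp_all
qed

end

section \<open>Graded tensor products and the projections by total degree\<close>

locale graded_pair = left: graded_space G + right: graded_space G'
  for G :: "nat \<Rightarrow> 'a::complex_algebra set" and G' :: "nat \<Rightarrow> 'b::complex_algebra set"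
begin

abbreviation gtmult_pure :: "'a \<Rightarrow> 'b \<Rightarrow> 'a \<Rightarrow> 'b \<Rightarrow> ('a, 'b) tensor" where
  "gtmult_pure a b a' b' \<equiv> \<Sum>k\<in>degs G' b. \<Sum>l\<in>degs G a'.
     (-1) ^ (k * l) *\<^sub>C ((a * hcomp G l a') \<otimes> (hcomp G' k b * b'))"

lemma cbilinear_gtmult_pure:
  "cbilinear (\<lambda>a' b'. gtmult_pure a b a' b')" "cbilinear (\<lambda>a b. gtmult_pure a b a' b')"
proof -
  have 1: "clinear (\<lambda>a'. \<Sum>l\<in>degs G a'. (-1) ^ (k * l) *\<^sub>C ((a * hcomp G l a') \<otimes> y))" for a k y
    by (rule left.clinear_sum_degs[where F = "\<lambda>l x. (-1) ^ (k * l) *\<^sub>C ((a * x) \<otimes> y)"])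
      (intro clinearI; simp add: linear_simps)
  have 2: "clinear (\<lambda>b. gtmult_pure a b a' b')" for a a' b'
    by (rule right.clinear_sum_degs[where F = "\<lambda>k y. \<Sum>l\<in>degs G a'.
          (-1) ^ (k * l) *\<^sub>C ((a * hcomp G l a') \<otimes> (y * b'))"])
      (intro clinearI; simp add: linear_simps sum.distrib cvs.scale_sum_right mult.commute)
  show "cbilinear (\<lambda>a' b'. gtmult_pure a b a' b')"
    by (intro cbilinearI)
      (simp_all only: clinear_add[OF 1] clinear_scale[OF 1],
       simp_all add: linear_simps sum.distrib cvs.scale_sum_right mult.commute)
  show "cbilinear (\<lambda>a b. gtmult_pure a b a' b')"
    by (intro cbilinearI)
      (simp_all only: clinear_add[OF 2] clinear_scale[OF 2],
       simp_all add: linear_simps sum.distrib cvs.scale_sum_right mult.commute)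
qed

lemma cbilinear_gtmult_aux: "cbilinear (\<lambda>a b. tlift (gtmult_pure a b) t)"
  using cbilinearD(3-6)[OF cbilinear_gtmult_pure(2)]
  by (intro cbilinearI) (simp_all add: tlift_fun_add tlift_fun_cscale)

lemma cbilinear_gtmult: "cbilinear (gtmult G G')"
  unfolding gtmult_def
  by (intro cbilinearI)
    (simp_all add: tlift_add[OF cbilinear_gtmult_pure(1)] tlift_cscale[OF cbilinear_gtmult_pure(1)]
      tlift_add[OF cbilinear_gtmult_aux] tlift_cscale[OF cbilinear_gtmult_aux]
      tlift_fun_add tlift_fun_cscale)

lemma gtmult_tensor: "gtmult G G' (a \<otimes> b) (a' \<otimes> b') = gtmult_pure a b a' b'"
  unfolding gtmult_def
  by (simp only: tlift_tensor[OF cbilinear_gtmult_pure(1)] tlift_tensor[OF cbilinear_gtmult_pure(2)])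

text \<open>With \<open>b\<close> of degree 0 every sign is 1, and the components of
  \<open>a'\<close> add up again. Products whose left factor is the coaction of a horizontal form
  all fall under this case.\<close>

lemma gtmult_tensor_degree_0_left:
  assumes "b \<in> G' 0"
  shows "gtmult G G' (a \<otimes> b) (a' \<otimes> b') = (a * a') \<otimes> (b * b')"
proof -
  have "gtmult_pure a b a' b' = (\<Sum>l\<in>degs G a'. (a * hcomp G l a') \<otimes> (b * b'))"
    by (subst right.sum_degs_homogeneous[OF assms, where F = "\<lambda>k y. \<Sum>l\<in>degs G a'.
          (-1) ^ (k * l) *\<^sub>C ((a * hcomp G l a') \<otimes> (y * b'))"])
      (simp_all add: cscale_one)
  then show ?thesis
    unfolding gtmult_tensor
    by (simp add: left.sum_hcomp flip: tensor_sum_left sum_distrib_left)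
qed

text \<open>Projection onto total degree \<open>n\<close>. Since the coaction preserves total
  degree, it shows that homogeneous components of base or horizontal forms are again base or
  horizontal.\<close>

definition gtproj :: "nat \<Rightarrow> ('a, 'b) tensor \<Rightarrow> ('a, 'b) tensor" where
  "gtproj n t = (\<Sum>k\<le>n. tmap (hcomp G k) (hcomp G' (n - k)) t)"

lemma clinear_gtproj: "clinear (gtproj n)"
  unfolding gtproj_def
  by (intro clinear_sum_fun clinear_tmap left.clinear_hcomp right.clinear_hcomp)

lemma gtproj_tensor: "gtproj n (a \<otimes> b) = (\<Sum>k\<le>n. hcomp G k a \<otimes> hcomp G' (n - k) b)"
  by (simp add: gtproj_def tmap_tensor left.clinear_hcomp right.clinear_hcomp)

lemma gtproj_tensor_degree_0:
  assumes "b \<in> G' 0"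
  shows "gtproj n (a \<otimes> b) = hcomp G n a \<otimes> b"
proof -
  have "gtproj n (a \<otimes> b) = (\<Sum>k\<le>n. if k = n then hcomp G n a \<otimes> b else 0)"
    unfolding gtproj_tensor
    by (intro sum.cong) (auto simp: right.hcomp_homogeneous[OF assms])
  then show ?thesis by simp
qed

lemma gtproj_gtgrade:
  assumes "t \<in> gtgrade G G' j"
  shows "gtproj n t = (if n = j then t else 0)"
  using assms unfolding gtgrade_def
proof (induction rule: cvs.span_induct_alt)
  case base
  then show ?case by (simp add: clinear_0[OF clinear_gtproj])
next
  case (step c x y)
  then obtain a b k l where x: "x = a \<otimes> b" "k + l = j" "a \<in> G k" "b \<in> G' l" by blast
  have "gtproj n x = (\<Sum>i\<le>n. if i = k then if n - k = l then a \<otimes> b else 0 else 0)"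
    unfolding x gtproj_tensor using x
    by (intro sum.cong) (auto simp: left.hcomp_homogeneous right.hcomp_homogeneous)
  then have "gtproj n x = (if n = j then x else 0)"
    using x by auto
  with step show ?case
    by (simp add: clinear_add[OF clinear_gtproj] clinear_scale[OF clinear_gtproj])
qed

lemma gtproj_degree_preserving:
  assumes f: "clinear f" "\<And>k x. x \<in> G k \<Longrightarrow> f x \<in> gtgrade G G' k"
  shows "f (hcomp G n x) = gtproj n (f x)"
proof (induction x rule: left.graded_induct)
  case (homogeneous k x)
  then show ?case
    by (simp add: left.hcomp_homogeneous gtproj_gtgrade[OF f(2)] clinear_0[OF f(1)])
next
  case (add x y)
  then show ?case
    by (simp add: clinear_add[OF f(1)] clinear_add[OF clinear_gtproj]
        clinear_add[OF left.clinear_hcomp])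
qed

end

lemma graded_diff_star_algebra_graded: "graded_diff_star_algebra G d \<Longrightarrow> graded_space G"
  by (simp add: graded_diff_star_algebra_def graded_space_def)

section \<open>Hopf algebras and bicovariant calculi\<close>

locale hopf =
  fixes \<Delta> :: "'h::star_algebra \<Rightarrow> ('h, 'h) tensor" and \<epsilon> :: "'h \<Rightarrow> complex" and S :: "'h \<Rightarrow> 'h"
  assumes star_hopf: "star_hopf_algebra \<Delta> \<epsilon> S"
begin

lemma clinear_comult: "clinear \<Delta>" and clinear_counit: "clinear \<epsilon>" and clinear_antipode: "clinear S"
  and comult_1: "\<Delta> 1 = 1 \<otimes> 1" and comult_mult: "\<Delta> (g * h) = tmult (\<Delta> g) (\<Delta> h)"
  and coassoc: "tassoc (tmap \<Delta> id (\<Delta> g)) = tmap id \<Delta> (\<Delta> g)"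
  and counit_left: "tlift (\<lambda>a b. \<epsilon> a *\<^sub>C b) (\<Delta> g) = g"
  and antipode_left: "tlift (\<lambda>a b. S a * b) (\<Delta> g) = \<epsilon> g *\<^sub>C 1"
  and antipode_right: "tlift (\<lambda>a b. a * S b) (\<Delta> g) = \<epsilon> g *\<^sub>C 1"
  using star_hopf by (auto simp: star_hopf_algebra_def star_hom_tensor_def star_hom_def)

lemmas hopf_linear = clinear_add[OF clinear_comult] clinear_scale[OF clinear_comult]
  clinear_add[OF clinear_counit] clinear_scale[OF clinear_counit]
  clinear_add[OF clinear_antipode] clinear_scale[OF clinear_antipode]

lemmas sweedler = coassoc_tlift[OF coassoc clinear_comult clinear_comult]

lemma counit_left_linear:
  assumes "clinear F"
  shows "tlift (\<lambda>a b. \<epsilon> a *\<^sub>C F b) (\<Delta> g) = F g"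
  using tlift_fun_comp[OF assms, of "\<lambda>a b. \<epsilon> a *\<^sub>C b" "\<Delta> g"]
  by (simp add: counit_left clinear_scale[OF assms])

lemma antipode_left_linear:
  assumes "clinear F"
  shows "tlift (\<lambda>a b. F (S a * b)) (\<Delta> g) = \<epsilon> g *\<^sub>C F 1"
  using tlift_fun_comp[OF assms, of "\<lambda>a b. S a * b" "\<Delta> g"]
  by (simp add: antipode_left clinear_scale[OF assms])

lemma antipode_right_linear:
  assumes "clinear F"
  shows "tlift (\<lambda>a b. F (a * S b)) (\<Delta> g) = \<epsilon> g *\<^sub>C F 1"
  using tlift_fun_comp[OF assms, of "\<lambda>a b. a * S b" "\<Delta> g"]
  by (simp add: antipode_right clinear_scale[OF assms])

text \<open>After coassociativity S(h1)h2 acts through the counit, so the antipode undoes the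
  convolution of \<open>F\<close> with the action.\<close>

lemma antipode_action:
  assumes act: "cbilinear act" "\<And>g h x. act (g * h) x = act g (act h x)" "\<And>x. act 1 x = x"
    and F: "clinear F"
  shows "tlift (\<lambda>a b. act (S a) (tlift (\<lambda>x y. act x (F y)) (\<Delta> b))) (\<Delta> h) = F h"
proof -
  note lin = cbilinearD[OF act(1)] clinear_add[OF F] clinear_scale[OF F]
  have "tlift (\<lambda>a b. act (S a) (tlift (\<lambda>x y. act x (F y)) (\<Delta> b))) (\<Delta> h) =
      tlift (\<lambda>a b. tlift (\<lambda>x y. act (S a * x) (F y)) (\<Delta> b)) (\<Delta> h)"
    by (simp add: tlift_fun_comp[OF lin(2)] act)
  also have "\<dots> = tlift (\<lambda>a b. tlift (\<lambda>a' a''. act (S a' * a'') (F b)) (\<Delta> a)) (\<Delta> h)"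
    by (rule sweedler[symmetric])
      (intro ctrilinearI; simp add: linear_simps lin hopf_linear)
  also have "\<dots> = tlift (\<lambda>a b. \<epsilon> a *\<^sub>C F b) (\<Delta> h)"
    by (simp add: antipode_left_linear[where F = "\<lambda>x. act x _",  OF lin(1)] act(3))
  also have "\<dots> = F h" by (rule counit_left_linear[OF F])
  finally show ?thesis .
qed

(* A function is recovered from its convolution with the action by convolving with the antipode;
   this replaces the anticomultiplicativity of the antipode. *)
lemma action_cancel:
  assumes "cbilinear act" "\<And>g h x. act (g * h) x = act g (act h x)" "\<And>x. act 1 x = x"
    and "clinear F" "clinear F'"
    and "\<And>h. tlift (\<lambda>a b. act a (F b)) (\<Delta> h) = tlift (\<lambda>a b. act a (F' b)) (\<Delta> h)"
  shows "F h = F' h"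
  using antipode_action[OF assms(1-4), of h] antipode_action[OF assms(1-3,5), of h] assms(6) by simp

end

section \<open>Componentwise actions of tensor products of algebras\<close>

definition tact :: "('a::complex_space \<Rightarrow> 'm::complex_space \<Rightarrow> 'm) \<Rightarrow>
    ('b::complex_space \<Rightarrow> 'n::complex_space \<Rightarrow> 'n) \<Rightarrow> ('a, 'b) tensor \<Rightarrow> ('m, 'n) tensor \<Rightarrow> ('m, 'n) tensor"
  where "tact l l' s t = tlift (\<lambda>a b. tmap (l a) (l' b) t) s"

lemma cbilinear_tact_aux:
  assumes "cbilinear l" "cbilinear l'"
  shows "cbilinear (\<lambda>a b. tmap (l a) (l' b) t)"
proof -
  note lin = cbilinearD[OF assms(1)] cbilinearD[OF assms(2)]
  have "(\<lambda>x. l (a + a') x) = (\<lambda>x. l a x + l a' x)" "(\<lambda>x. l (c *\<^sub>C a) x) = (\<lambda>x. c *\<^sub>C l a x)"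
    "(\<lambda>x. l' (b + b') x) = (\<lambda>x. l' b x + l' b' x)" "(\<lambda>x. l' (c *\<^sub>C b) x) = (\<lambda>x. c *\<^sub>C l' b x)"
    for a a' b b' c
    by (simp_all add: lin)
  then show ?thesis
    by (intro cbilinearI) (simp_all add: tmap_def lin linear_simps)
qed

lemma
  assumes "cbilinear l" "cbilinear l'"
  shows tact_tensor: "tact l l' (a \<otimes> b) t = tmap (l a) (l' b) t"
    and cbilinear_tact: "cbilinear (tact l l')"
proof -
  note lin = cbilinearD[OF assms(1)] cbilinearD[OF assms(2)]
  note b = cbilinear_tact_aux[OF assms]
  show "tact l l' (a \<otimes> b) t = tmap (l a) (l' b) t"
    by (simp add: tact_def tlift_tensor[OF b])
  show "cbilinear (tact l l')"
    by (intro cbilinearI)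
      (simp_all add: tact_def tlift_add[OF b] tlift_cscale[OF b]
        clinear_add[OF clinear_tmap[OF lin(2) lin(8)]] clinear_scale[OF clinear_tmap[OF lin(2) lin(8)]]
        tlift_fun_add tlift_fun_cscale)
qed

text \<open>Composed with the multiplicative \<open>\<Delta>\<close>, the componentwise action
  becomes an action of H on a tensor product, which is the setting for
  \<open>action_cancel\<close>.\<close>

lemma tact_tmult:
  assumes l: "cbilinear l" "\<And>a b x. l (a * b) x = l a (l b x)"
    and l': "cbilinear l'" "\<And>a b x. l' (a * b) x = l' a (l' b x)"
  shows "tact l l' (tmult s s') t = tact l l' s (tact l l' s' t)"
proof -
  note lin = cbilinearD[OF cbilinear_tact[OF l(1) l'(1)]] cbilinearD[OF cbilinear_tmult]
  note lin2 = cbilinearD(2)[OF l(1)] cbilinearD(2)[OF l'(1)]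
  have comp: "l (a * b) = (\<lambda>x. l a (l b x))" "l' (c * d) = (\<lambda>x. l' c (l' d x))" for a b c d
    by (simp_all add: fun_eq_iff l l')
  show ?thesis
  proof (induction s rule: tensor_induct)
    case (pure a b)
    show ?case
    proof (induction s' rule: tensor_induct)
      case (pure a' b')
      then show ?case
        by (simp add: tmult_tensor tact_tensor[OF l(1) l'(1)] tmap_tmap lin2 comp)
    qed (simp add: lin)
  qed (simp add: lin)
qed

lemma tact_1:
  assumes "cbilinear l" "\<And>x. l 1 x = x" "cbilinear l'" "\<And>x. l' 1 x = x"
  shows "tact l l' (1 \<otimes> 1) t = t"
proof -
  have "l 1 = id" "l' 1 = id" using assms by auto
  then show ?thesis by (simp add: tact_tensor assms tmap_ident)
qed

section \<open>Left and right coactions of a bicovariant calculus\<close>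

locale bicovariant_calculus = hopf +
  fixes la :: "'a::star_algebra \<Rightarrow> 'g::involutive_space \<Rightarrow> 'g" and ra :: "'g \<Rightarrow> 'a \<Rightarrow> 'g"
    and d :: "'a \<Rightarrow> 'g"
  assumes bicovariant: "bicovariant_fodc \<Delta> la ra d"
begin

lemma cbilinear_la: "cbilinear la"
  and la_1: "la 1 x = x"
  and la_mult: "la (g * h) x = la g (la h x)"
  and clinear_d: "clinear d"
  and span_la_d: "cspan {la g (d h) | g h. True} = UNIV"
  using bicovariant by (auto simp: bicovariant_fodc_def fodc_def)

lemmas calculus_linear = cbilinearD[OF cbilinear_la] clinear_add[OF clinear_d] clinear_scale[OF clinear_d]

text \<open>The quantum germs map \<pi> over the locale parameters; \<open>qgerm_eq_germ\<close>
  identifies it with \<open>qgerm\<close>.\<close>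

definition germ :: "'a \<Rightarrow> 'g" where
  "germ h = tlift (\<lambda>a b. la (S a) (d b)) (\<Delta> h)"

lemma clinear_germ: "clinear germ"
  unfolding germ_def[abs_def]
  by (intro clinear_tlift_arg clinear_comult)
    (intro cbilinearI; simp add: hopf_linear calculus_linear)

lemmas germ_linear = clinear_add[OF clinear_germ] clinear_scale[OF clinear_germ]

text \<open>In h1 S(h2) dh3 the first two legs collapse to the counit. So d is the convolution of
  the left action with \<pi>, and covariance of d can be turned into statements about \<pi>.\<close>

lemma d_eq_germ: "tlift (\<lambda>a b. la a (germ b)) (\<Delta> h) = d h"
proof -
  have "tlift (\<lambda>a b. la a (germ b)) (\<Delta> h) =
      tlift (\<lambda>a b. tlift (\<lambda>x y. la (a * S x) (d y)) (\<Delta> b)) (\<Delta> h)"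
    by (simp add: germ_def tlift_fun_comp[OF calculus_linear(2)] la_mult)
  also have "\<dots> = tlift (\<lambda>a b. tlift (\<lambda>x y. la (x * S y) (d b)) (\<Delta> a)) (\<Delta> h)"
    by (rule sweedler[symmetric])
      (intro ctrilinearI; simp add: linear_simps hopf_linear calculus_linear)
  also have "\<dots> = tlift (\<lambda>a b. \<epsilon> a *\<^sub>C d b) (\<Delta> h)"
    by (simp add: antipode_right_linear[where F = "\<lambda>x. la x _", OF calculus_linear(1)] la_1)
  also have "\<dots> = d h" by (rule counit_left_linear[OF clinear_d])
  finally show ?thesis .
qed

lemma clinear_eq_on_la_d:
  assumes "clinear f" "clinear f'" "\<And>g h. f (la g (d h)) = f' (la g (d h))"
  shows "f x = f' x"
proof -
  have "x \<in> cspan {la g (d h) | g h. True}" unfolding span_la_d by simp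
  then show ?thesis
    by (induction rule: cvs.span_induct_alt)
      (auto simp: assms clinear_0 clinear_add clinear_scale)
qed

abbreviation right_act :: "('a, 'a) tensor \<Rightarrow> ('g, 'a) tensor \<Rightarrow> ('g, 'a) tensor" where
  "right_act \<equiv> tact la (*)"

abbreviation left_act :: "('a, 'a) tensor \<Rightarrow> ('a, 'g) tensor \<Rightarrow> ('a, 'g) tensor" where
  "left_act \<equiv> tact (*) la"

lemma right_act_comult:
  "cbilinear (\<lambda>g. right_act (\<Delta> g))" "right_act (\<Delta> (g * h)) t = right_act (\<Delta> g) (right_act (\<Delta> h) t)"
  "right_act (\<Delta> 1) t = t"
  using cbilinear_comp[OF cbilinear_tact[OF cbilinear_la cbilinear_mult] clinear_comult clinear_id(1)]
  by (simp_all add: comult_mult comult_1 tact_tmult tact_1 cbilinear_la cbilinear_mult la_mult la_1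
      mult.assoc)

lemma left_act_comult:
  "cbilinear (\<lambda>g. left_act (\<Delta> g))" "left_act (\<Delta> (g * h)) t = left_act (\<Delta> g) (left_act (\<Delta> h) t)"
  "left_act (\<Delta> 1) t = t"
  using cbilinear_comp[OF cbilinear_tact[OF cbilinear_mult cbilinear_la] clinear_comult clinear_id(1)]
  by (simp_all add: comult_mult comult_1 tact_tmult tact_1 cbilinear_la cbilinear_mult la_mult la_1
      mult.assoc)

lemma right_coaction_la_d:
  assumes "is_right_coaction \<Delta> la d \<Phi>"
  shows "\<Phi> (la g (d h)) = right_act (\<Delta> g) (tmap d id (\<Delta> h))"
proof -
  have "tmap (la a) ((*) b) (tmap d id t) = tlift (\<lambda>a' b'. la a (d a') \<otimes> (b * b')) t" for a b :: 'a and t :: "('a, 'a) tensor"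
    by (simp add: tmap_tmap[OF clinear_d clinear_id(2) calculus_linear(2) cbilinearD(2)[OF cbilinear_mult]])
      (simp add: tmap_def)
  then show ?thesis using assms by (simp add: is_right_coaction_def tact_def)
qed

lemma left_coaction_la_d:
  assumes "is_left_coaction \<Delta> la d \<Phi>"
  shows "\<Phi> (la g (d h)) = left_act (\<Delta> g) (tmap id d (\<Delta> h))"
proof -
  have "tmap ((*) a) (la b) (tmap id d t) = tlift (\<lambda>a' b'. (a * a') \<otimes> la b (d b')) t" for a b :: 'a and t :: "('a, 'a) tensor"
    by (simp add: tmap_tmap[OF clinear_id(2) clinear_d cbilinearD(2)[OF cbilinear_mult] calculus_linear(2)])
      (simp add: tmap_def)
  then show ?thesis using assms by (simp add: is_left_coaction_def tact_def)
qed

text \<open>The coaction is prescribed only on the elements g dh. These span \<Gamma> and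
  \<open>\<Delta>\<close> is multiplicative, so it is compatible with left multiplication
  everywhere.\<close>

lemma right_coaction:
  assumes \<Phi>: "is_right_coaction \<Delta> la d \<Phi>"
  shows "\<Phi> (d h) = tmap d id (\<Delta> h)" "\<Phi> (la g x) = right_act (\<Delta> g) (\<Phi> x)"
proof -
  have lin: "clinear \<Phi>" using \<Phi> by (simp add: is_right_coaction_def)
  show "\<Phi> (d h) = tmap d id (\<Delta> h)"
    using right_coaction_la_d[OF \<Phi>, of 1 h] by (simp add: la_1 right_act_comult)
  show "\<Phi> (la g x) = right_act (\<Delta> g) (\<Phi> x)"
    by (rule clinear_eq_on_la_d[where f = "\<lambda>x. \<Phi> (la g x)"])
      (simp_all add: clinear_comp lin calculus_linear(2) cbilinearD(2)[OF right_act_comult(1)]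
        right_coaction_la_d[OF \<Phi>] right_act_comult flip: la_mult)
qed

lemma left_coaction:
  assumes \<Phi>: "is_left_coaction \<Delta> la d \<Phi>"
  shows "\<Phi> (d h) = tmap id d (\<Delta> h)" "\<Phi> (la g x) = left_act (\<Delta> g) (\<Phi> x)"
proof -
  have lin: "clinear \<Phi>" using \<Phi> by (simp add: is_left_coaction_def)
  show "\<Phi> (d h) = tmap id d (\<Delta> h)"
    using left_coaction_la_d[OF \<Phi>, of 1 h] by (simp add: la_1 left_act_comult)
  show "\<Phi> (la g x) = left_act (\<Delta> g) (\<Phi> x)"
    by (rule clinear_eq_on_la_d[where f = "\<lambda>x. \<Phi> (la g x)"])
      (simp_all add: clinear_comp lin calculus_linear(2) cbilinearD(2)[OF left_act_comult(1)]
        left_coaction_la_d[OF \<Phi>] left_act_comult flip: la_mult)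
qed

text \<open>Both sides have the same convolution with the left action, namely h1 \<otimes> dh2, the
  coaction of dh; \<open>action_cancel\<close> removes the convolution.\<close>

lemma left_coaction_germ:
  assumes \<Phi>: "is_left_coaction \<Delta> la d \<Phi>"
  shows "\<Phi> (germ h) = 1 \<otimes> germ h"
proof (rule action_cancel[where F = "\<lambda>h. \<Phi> (germ h)" and F' = "\<lambda>h. 1 \<otimes> germ h", OF left_act_comult])
  have lin: "clinear \<Phi>" using \<Phi> by (simp add: is_left_coaction_def)
  then show "clinear (\<lambda>h. \<Phi> (germ h))" by (rule clinear_comp[OF _ clinear_germ])
  show "clinear (\<lambda>h. 1 \<otimes> germ h)"
    by (intro clinearI) (simp_all add: germ_linear linear_simps)
  fix h
  have "tlift (\<lambda>a b. left_act (\<Delta> a) (\<Phi> (germ b))) (\<Delta> h) = \<Phi> (tlift (\<lambda>a b. la a (germ b)) (\<Delta> h))"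
    by (simp add: tlift_fun_comp[OF lin] left_coaction[OF \<Phi>])
  also have "\<dots> = tmap id d (\<Delta> h)" by (simp add: d_eq_germ left_coaction[OF \<Phi>])
  also have "\<dots> = tlift (\<lambda>a b. a \<otimes> tlift (\<lambda>x y. la x (germ y)) (\<Delta> b)) (\<Delta> h)"
    by (simp add: tmap_def d_eq_germ)
  also have "\<dots> = tlift (\<lambda>a b. tlift (\<lambda>x y. a \<otimes> la x (germ y)) (\<Delta> b)) (\<Delta> h)"
    by (simp add: tlift_fun_comp[OF cbilinearD(2)[OF cbilinear_tensor]])
  also have "\<dots> = tlift (\<lambda>a b. tlift (\<lambda>x y. x \<otimes> la y (germ b)) (\<Delta> a)) (\<Delta> h)"
    by (rule sweedler[symmetric])
      (intro ctrilinearI; simp add: linear_simps germ_linear calculus_linear)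
  also have "\<dots> = tlift (\<lambda>a b. left_act (\<Delta> a) (1 \<otimes> germ b)) (\<Delta> h)"
    by (simp add: tact_def tmap_tensor calculus_linear cbilinearD(2)[OF cbilinear_mult])
  finally show "tlift (\<lambda>a b. left_act (\<Delta> a) (\<Phi> (germ b))) (\<Delta> h) =
    tlift (\<lambda>a b. left_act (\<Delta> a) (1 \<otimes> germ b)) (\<Delta> h)" .
qed

section \<open>The adjoint coaction on quantum germs\<close>

abbreviation ad_germ :: "'a \<Rightarrow> ('g, 'a) tensor" where
  "ad_germ h \<equiv> tlift (\<lambda>s z. tlift (\<lambda>x y. germ y \<otimes> (S x * z)) (\<Delta> s)) (\<Delta> h)"

lemma ctrilinear_ad_germ: "ctrilinear (\<lambda>x y z. germ y \<otimes> (a * (S x * z)))"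
  by (intro ctrilinearI) (simp_all add: linear_simps germ_linear hopf_linear)

lemma clinear_ad_germ: "clinear ad_germ"
  using cbilinear_tlift_left[OF ctrilinear_ad_germ[of 1] clinear_comult]
  by (intro clinear_tlift_arg clinear_comult) simp

text \<open>The factor h1 meets S(h2) and contracts to the counit, so that \<pi>(h3) \<otimes> h1
  S(h2) h4 becomes \<pi>(h1) \<otimes> h2. The same cancellation governs the coaction of germs and
  that of a connection.\<close>

lemma ad_germ_mult: "tlift (\<lambda>a b. tmap id ((*) a) (ad_germ b)) (\<Delta> h) = tmap germ id (\<Delta> h)"
proof -
  note m = clinear_tmap[OF clinear_id(2) cbilinearD(2)[OF cbilinear_mult]]
  have ctr: "ctrilinear (\<lambda>a x y. germ y \<otimes> (a * (S x * z)))" for z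
    by (intro ctrilinearI) (simp_all add: linear_simps germ_linear hopf_linear)
  have "tlift (\<lambda>a b. tmap id ((*) a) (ad_germ b)) (\<Delta> h) =
      tlift (\<lambda>a b. tlift (\<lambda>s z. tlift (\<lambda>x y. germ y \<otimes> (a * (S x * z))) (\<Delta> s)) (\<Delta> b)) (\<Delta> h)"
    by (simp add: tlift_fun_comp[OF m] tmap_tensor clinear_id cbilinearD(2)[OF cbilinear_mult])
  also have "\<dots> = tlift (\<lambda>c z. tlift (\<lambda>a s. tlift (\<lambda>x y. germ y \<otimes> (a * (S x * z))) (\<Delta> s)) (\<Delta> c)) (\<Delta> h)"
  proof (rule sweedler[symmetric, where f = "\<lambda>a s z. tlift (\<lambda>x y. germ y \<otimes> (a * (S x * z))) (\<Delta> s)"])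
    show "ctrilinear (\<lambda>a s z. tlift (\<lambda>x y. germ y \<otimes> (a * (S x * z))) (\<Delta> s))"
      by (intro ctrilinearI)
        (simp_all add: linear_simps hopf_linear
          tlift_add[OF ctrilinear_cbilinear(1)[OF ctrilinear_ad_germ]]
          tlift_cscale[OF ctrilinear_cbilinear(1)[OF ctrilinear_ad_germ]])
  qed
  also have "\<dots> = tlift (\<lambda>c z. tlift (\<lambda>w y. tlift (\<lambda>a x. germ y \<otimes> (a * (S x * z))) (\<Delta> w)) (\<Delta> c)) (\<Delta> h)"
    by (simp add: sweedler[OF ctr])
  also have "\<dots> = tlift (\<lambda>c z. tlift (\<lambda>w y. \<epsilon> w *\<^sub>C (germ y \<otimes> z)) (\<Delta> c)) (\<Delta> h)"
  proof -
    have "clinear (\<lambda>u :: 'a. germ y \<otimes> (u * z))" for y z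
      by (intro clinearI) (simp_all add: linear_simps)
    from antipode_right_linear[OF this] show ?thesis by (simp add: mult.assoc)
  qed
  also have "\<dots> = tlift (\<lambda>c z. germ c \<otimes> z) (\<Delta> h)"
  proof -
    have "clinear (\<lambda>y. germ y \<otimes> z)" for z :: 'a
      by (intro clinearI) (simp_all add: linear_simps germ_linear)
    from counit_left_linear[OF this] show ?thesis by simp
  qed
  finally show ?thesis by (simp add: tmap_def)
qed

text \<open>Convolved with the action through \<open>\<Delta>\<close>, either side gives dh1
  \<otimes> h2. The consequence used later is that \<open>ad_germ h\<close> depends on
  \<open>germ h\<close> only.\<close>

lemma right_coaction_germ:
  assumes \<Phi>: "is_right_coaction \<Delta> la d \<Phi>"
  shows "\<Phi> (germ h) = ad_germ h"
proof (rule action_cancel[where F = "\<lambda>h. \<Phi> (germ h)" and F' = "ad_germ", OF right_act_comult])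
  have lin: "clinear \<Phi>" using \<Phi> by (simp add: is_right_coaction_def)
  then show "clinear (\<lambda>h. \<Phi> (germ h))" by (rule clinear_comp[OF _ clinear_germ])
  show "clinear ad_germ" by (rule clinear_ad_germ)
  fix h
  note act = clinear_tmap[OF calculus_linear(2) clinear_id(2)] cbilinearD(2)[OF cbilinear_mult]
  have "tlift (\<lambda>a b. right_act (\<Delta> a) (ad_germ b)) (\<Delta> h) =
      tlift (\<lambda>a b. tlift (\<lambda>x y. tmap (la a) ((*) x) (ad_germ y)) (\<Delta> b)) (\<Delta> h)"
    unfolding tact_def
  proof (rule sweedler)
    note b = cbilinear_tact_aux[OF cbilinear_la cbilinear_mult]
    show "ctrilinear (\<lambda>a x y. tmap (la a) ((*) x) (ad_germ y))"
      by (intro ctrilinearI)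
        (simp_all add: cbilinearD[OF b] clinear_add[OF clinear_ad_germ] clinear_scale[OF clinear_ad_germ]
          clinear_add[OF clinear_tmap[OF calculus_linear(2) act(2)]]
          clinear_scale[OF clinear_tmap[OF calculus_linear(2) act(2)]])
  qed
  also have "\<dots> = tlift (\<lambda>a b. tmap (la a) id (tlift (\<lambda>x y. tmap id ((*) x) (ad_germ y)) (\<Delta> b))) (\<Delta> h)"
    by (simp add: tlift_fun_comp[OF act(1)] tmap_tmap clinear_id act(2) calculus_linear(2))
  also have "\<dots> = tlift (\<lambda>a b. tlift (\<lambda>x y. la a (germ x) \<otimes> y) (\<Delta> b)) (\<Delta> h)"
    unfolding ad_germ_mult
    by (simp add: tmap_tmap[OF clinear_germ clinear_id(2) calculus_linear(2) clinear_id(2)])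
      (simp add: tmap_def)
  also have "\<dots> = tlift (\<lambda>a b. tlift (\<lambda>x y. la x (germ y) \<otimes> b) (\<Delta> a)) (\<Delta> h)"
    by (rule sweedler[symmetric])
      (intro ctrilinearI; simp add: linear_simps germ_linear calculus_linear)
  also have "\<dots> = tlift (\<lambda>a b. d a \<otimes> b) (\<Delta> h)"
    by (simp flip: d_eq_germ tlift_fun_comp[OF cbilinearD(1)[OF cbilinear_tensor]])
  also have "\<dots> = \<Phi> (tlift (\<lambda>a b. la a (germ b)) (\<Delta> h))"
    by (simp add: d_eq_germ right_coaction[OF \<Phi>] tmap_def)
  also have "\<dots> = tlift (\<lambda>a b. right_act (\<Delta> a) (\<Phi> (germ b))) (\<Delta> h)"
    by (simp add: tlift_fun_comp[OF lin] right_coaction[OF \<Phi>])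
  finally show "tlift (\<lambda>a b. right_act (\<Delta> a) (\<Phi> (germ b))) (\<Delta> h) =
    tlift (\<lambda>a b. right_act (\<Delta> a) (ad_germ b)) (\<Delta> h)" by (rule sym)
qed

end

section \<open>Forms on a quantum principal bundle\<close>

lemma graded_diff_star_algebraD:
  assumes "graded_diff_star_algebra G d"
  shows "clinear d"
    "x \<in> G k \<Longrightarrow> d (x * y) = d x * y + (-1) ^ k *\<^sub>C (x * d y)"
    "x \<in> G k \<Longrightarrow> y \<in> G l \<Longrightarrow> x * y \<in> G (k + l)"
  using assms unfolding graded_diff_star_algebra_def by metis+

locale qpb_connection =
  fixes Z :: "('h::star_algebra, 'p::star_algebra, 'g::involutive_space,
      'e::involutive_algebra, 'o::involutive_algebra) qpb_calculus"
    and \<omega> :: "'g \<Rightarrow> 'o"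
  assumes hopf_Z: "star_hopf_algebra (comult Z) (counit Z) (antipode Z)"
    and bundle_Z: "quantum_principal_bundle (comult Z) (counit Z) (base Z) (coact Z)"
    and calculus_Z: "differential_calculus Z"
    and connection_Z: "quantum_principal_connection Z \<omega>"

sublocale qpb_connection \<subseteq> bicovariant_calculus "comult Z" "counit Z" "antipode Z"
    "lact Z" "ract Z" "gdiff Z"
  using hopf_Z calculus_Z by unfold_locales (simp_all add: differential_calculus_def)

sublocale qpb_connection \<subseteq> graded_pair "ograde Z" "egrade Z"
  using calculus_Z unfolding graded_pair_def differential_calculus_def universal_envelope_def
  by (blast intro: graded_diff_star_algebra_graded)

context qpb_connection
begin

lemma qgerm_eq_germ: "qgerm Z = germ"
  by (simp add: fun_eq_iff qgerm_def germ_def)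

lemma tmap_germ_Ad: "tmap germ id (Ad Z h) = ad_germ h"
proof -
  have ctr: "ctrilinear (\<lambda>x y z. y \<otimes> (antipode Z x * z))"
    by (intro ctrilinearI) (simp_all add: linear_simps hopf_linear)
  show ?thesis
    by (simp add: Ad_def tlift_tmap[OF cbilinear_tlift_left[OF ctr clinear_id(1)]]
        tlift_fun_comp[OF clinear_tmap[OF clinear_germ clinear_id(2)]] tmap_tensor
        clinear_germ clinear_id clinear_comult)
qed

lemma ad_germ_eq: "ad Z (germ h) = ad_germ h"
proof -
  obtain \<Phi> where \<Phi>: "is_right_coaction (comult Z) (lact Z) (gdiff Z) \<Phi>"
    using bicovariant unfolding bicovariant_fodc_def by blast
  \<comment> \<open>Both are values of the one coaction \<Phi> at the same element, so the
    description in \<open>ad\<close> has a unique solution.\<close>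
  have "ad_germ h' = ad_germ h" if "germ h = germ h'" for h'
    using right_coaction_germ[OF \<Phi>, of h] right_coaction_germ[OF \<Phi>, of h']
    unfolding that by (metis)
  then have "(THE t. \<exists>h'. germ h = germ h' \<and> t = ad_germ h') = ad_germ h"
    by (intro the_equality) blast+
  then show ?thesis
    unfolding ad_def qgerm_eq_germ tmap_germ_Ad .
qed

text \<open>\<open>left_invariant_forms\<close> names the left coaction by a definite description;
  two such coactions agree on the elements g dh, which span.\<close>

lemma germ_left_invariant: "germ h \<in> left_invariant_forms Z"
proof -
  obtain \<Phi> where \<Phi>: "is_left_coaction (comult Z) (lact Z) (gdiff Z) \<Phi>"
    using bicovariant unfolding bicovariant_fodc_def by blast
  have unique: "\<Psi> = \<Phi>" if "is_left_coaction (comult Z) (lact Z) (gdiff Z) \<Psi>" for \<Psi>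
  proof (rule ext)
    show "\<Psi> x = \<Phi> x" for x
      by (rule clinear_eq_on_la_d[where f = \<Psi> and f' = \<Phi>]) (use that \<Phi> in \<open>simp_all add: is_left_coaction_def\<close>)
  qed
  have "(THE \<Phi>. is_left_coaction (comult Z) (lact Z) (gdiff Z) \<Phi>) = \<Phi>"
    by (rule the_equality[where P = "is_left_coaction (comult Z) (lact Z) (gdiff Z)", OF \<Phi> unique])
  then show ?thesis
    by (simp add: left_invariant_forms_def left_coaction_germ[OF \<Phi>])
qed

lemma clinear_connection: "clinear \<omega>"
  and ocoact_connection:
    "ocoact Z (\<omega> (germ h)) = tmap \<omega> (einc0 Z) (ad_germ h) + 1 \<otimes> einc1 Z (germ h)"
  using connection_Z germ_left_invariant[of h]
  by (auto simp: quantum_principal_connection_def ad_germ_eq)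

lemma coact_linear: "clinear (coact Z)"
  and coact_coassoc: "tassoc (tmap (coact Z) id (coact Z p)) = tmap id (comult Z) (coact Z p)"
  and coact_eq_iff: "coact Z p = p \<otimes> 1 \<longleftrightarrow> p \<in> base Z"
  using bundle_Z by (auto simp: quantum_principal_bundle_def corepresentation_def)

lemma odiff_algebra: "graded_diff_star_algebra (ograde Z) (odiff Z)"
  and ediff_algebra: "graded_diff_star_algebra (egrade Z) (ediff Z)"
  and pinc_hom: "star_hom (pinc Z)" and pinc_bij: "bij_betw (pinc Z) UNIV (ograde Z 0)"
  and einc0_hom: "star_hom (einc0 Z)" and einc0_bij: "bij_betw (einc0 Z) UNIV (egrade Z 0)"
  and clinear_ocoact: "clinear (ocoact Z)"
  and ocoact_mult: "ocoact Z (x * y) = gtmult (ograde Z) (egrade Z) (ocoact Z x) (ocoact Z y)"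
  and ocoact_star: "ocoact Z (star x) = tstar (ocoact Z x)"
  and ocoact_degree: "x \<in> ograde Z k \<Longrightarrow> ocoact Z x \<in> gtgrade (ograde Z) (egrade Z) k"
  and ocoact_odiff: "ocoact Z (odiff Z x) = gtdiff (ograde Z) (odiff Z) (ediff Z) (ocoact Z x)"
  and ocoact_pinc: "ocoact Z (pinc Z p) = tmap (pinc Z) (einc0 Z) (coact Z p)"
  and clinear_einc1: "clinear (einc1 Z)"
  and einc1_la: "einc1 Z (lact Z h \<theta>) = einc0 Z h * einc1 Z \<theta>"
  and ediff_einc0: "ediff Z (einc0 Z h) = einc1 Z (gdiff Z h)"
  using calculus_Z by (simp_all only: differential_calculus_def universal_envelope_def)

lemma clinear_pinc: "clinear (pinc Z)" and pinc_1: "pinc Z 1 = 1"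
  and pinc_mult: "pinc Z (p * q) = pinc Z p * pinc Z q" and pinc_star: "pinc Z (star p) = star (pinc Z p)"
  and clinear_einc0: "clinear (einc0 Z)" and einc0_1: "einc0 Z 1 = 1"
  and einc0_mult: "einc0 Z (g * h) = einc0 Z g * einc0 Z h"
  and einc0_star: "einc0 Z (star h) = star (einc0 Z h)"
  using pinc_hom einc0_hom by (auto simp: star_hom_def)

lemma pinc_degree: "pinc Z p \<in> ograde Z 0" and inj_pinc: "inj (pinc Z)"
  and einc0_degree: "einc0 Z h \<in> egrade Z 0" and inj_einc0: "inj (einc0 Z)"
  using pinc_bij einc0_bij by (auto simp: bij_betw_def)

lemmas clinear_odiff = graded_diff_star_algebraD(1)[OF odiff_algebra]
  and odiff_mult = graded_diff_star_algebraD(2)[OF odiff_algebra]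
  and ograde_mult = graded_diff_star_algebraD(3)[OF odiff_algebra]
  and clinear_ediff = graded_diff_star_algebraD(1)[OF ediff_algebra]

lemma one_degree: "1 \<in> egrade Z 0"
  using einc0_degree[of 1] by (simp add: einc0_1)

lemma ediff_1: "ediff Z 1 = 0"
proof -
  have "ediff Z (1 * 1) = ediff Z 1 * 1 + (-1) ^ 0 *\<^sub>C (1 * ediff Z 1)"
    by (rule graded_diff_star_algebraD(2)[OF ediff_algebra one_degree])
  then show ?thesis by (simp add: cscale_one)
qed

lemmas form_linear = clinear_add[OF clinear_pinc] clinear_scale[OF clinear_pinc]
  clinear_add[OF clinear_einc0] clinear_scale[OF clinear_einc0]
  clinear_add[OF clinear_einc1] clinear_scale[OF clinear_einc1]
  clinear_add[OF clinear_odiff] clinear_scale[OF clinear_odiff]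
  clinear_add[OF clinear_connection] clinear_scale[OF clinear_connection]
  clinear_add[OF clinear_ocoact] clinear_scale[OF clinear_ocoact]

lemma cbilinear_mult_comp: "clinear f \<Longrightarrow> cbilinear (\<lambda>a b. f a * (b :: 'o))"
  "clinear f' \<Longrightarrow> cbilinear (\<lambda>a b. f' a * (b :: 'e))"
  by (intro cbilinearI; simp add: clinear_add clinear_scale linear_simps)+

text \<open>\<open>einc0\<close> lands in degree 0 of the envelope, so a left factor of this shape
  multiplies without signs, even when \<open>t\<close> has second legs of positive degree.\<close>

lemma gtmult_tmap_einc0:
  assumes "clinear f"
  shows "gtmult (ograde Z) (egrade Z) (tmap f (einc0 Z) s) t =
    tact (\<lambda>a. (*) (f a)) (\<lambda>h. (*) (einc0 Z h)) s t"
proof -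
  note b = cbilinear_mult_comp(1)[OF assms] cbilinear_mult_comp(2)[OF clinear_einc0]
  note lin = cbilinearD[OF cbilinear_gtmult] cbilinearD[OF cbilinear_tact[OF b]]
    clinear_add[OF clinear_tmap[OF assms clinear_einc0]]
  show ?thesis
  proof (induction s rule: tensor_induct)
    case (pure a h)
    show ?case
    proof (induction t rule: tensor_induct)
      case (pure x y)
      then show ?case
        by (simp add: tmap_tensor[OF assms clinear_einc0] tact_tensor[OF b] einc0_degree
            gtmult_tensor_degree_0_left tmap_tensor cbilinearD(2)[OF b(1)] cbilinearD(2)[OF b(2)])
    qed (simp add: lin)
  qed (simp add: lin)
qed

lemma gtmult_tensor_1:
  "gtmult (ograde Z) (egrade Z) (\<mu> \<otimes> 1) (tmap f (einc0 Z) t) = tmap (\<lambda>a. \<mu> * f a) (einc0 Z) t"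
  if "clinear f"
  unfolding tmap_def tlift_fun_comp[OF cbilinearD(2)[OF cbilinear_gtmult]]
  by (simp add: gtmult_tensor_degree_0_left one_degree)


subsection \<open>Horizontal forms and base forms\<close>

lemma inj_tmap_einc0: "inj (tmap id (einc0 Z))"
  by (rule inj_tmap) (simp_all add: clinear_id clinear_einc0 inj_einc0)

lemma Hor_iff: "\<phi> \<in> Hor Z \<longleftrightarrow> (\<exists>t. ocoact Z \<phi> = tmap id (einc0 Z) t)"
  using subtensor_image_tmap[OF clinear_id(2) clinear_einc0] by (auto simp: Hor_def)

text \<open>Injectivity of \<open>tmap id (einc0 Z)\<close> makes the preimage named by
  \<open>coact_Hor\<close> unique.\<close>

lemma coact_Hor_eq: "ocoact Z \<phi> = tmap id (einc0 Z) t \<Longrightarrow> coact_Hor Z \<phi> = t"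
  unfolding coact_Hor_def using inj_tmap_einc0 by (auto dest: injD)

lemma ocoact_coact_Hor: "\<phi> \<in> Hor Z \<Longrightarrow> tmap id (einc0 Z) (coact_Hor Z \<phi>) = ocoact Z \<phi>"
  using Hor_iff coact_Hor_eq by metis

text \<open>Horizontality of the values and the description \<open>coact_Hor\<close> are absorbed
  into one equation in the tensor product with the envelope, where coactions can be multiplied and
  differentiated.\<close>

lemma Mor_Hor_iff:
  "\<tau> \<in> Mor UNIV \<delta> (Hor Z) (coact_Hor Z) \<longleftrightarrow>
    clinear \<tau> \<and> (\<forall>v. ocoact Z (\<tau> v) = tmap \<tau> (einc0 Z) (\<delta> v))"
proof -
  have *: "tmap \<tau> (einc0 Z) t = tmap id (einc0 Z) (tmap \<tau> id t)" if "clinear \<tau>" for t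
    by (simp add: tmap_tmap clinear_id clinear_einc0 that)
  show ?thesis
  proof (safe, goal_cases)
    case 1 then show ?case by (simp add: Mor_def)
  next
    case (2 v)
    then have "clinear \<tau>" "\<tau> v \<in> Hor Z" "tmap \<tau> id (\<delta> v) = coact_Hor Z (\<tau> v)"
      by (auto simp: Mor_def)
    then show ?case by (simp add: * ocoact_coact_Hor)
  next
    case 3
    then have "ocoact Z (\<tau> v) = tmap id (einc0 Z) (tmap \<tau> id (\<delta> v))" for v by (simp add: *)
    then have "\<tau> v \<in> Hor Z" "coact_Hor Z (\<tau> v) = tmap \<tau> id (\<delta> v)" for v
      by (auto simp: Hor_iff coact_Hor_eq)
    with 3 show ?case by (auto simp: Mor_def)
  qed
qed

lemma subspace_base_forms: "csubspace (base_forms Z)"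
  by (rule cvs.subspaceI)
    (simp_all add: base_forms_def clinear_0[OF clinear_ocoact] form_linear linear_simps)

lemma base_forms_mult: "\<mu> \<in> base_forms Z \<Longrightarrow> \<nu> \<in> base_forms Z \<Longrightarrow> \<mu> * \<nu> \<in> base_forms Z"
  by (simp add: base_forms_def ocoact_mult gtmult_tensor_degree_0_left one_degree)

lemma base_forms_odiff:
  assumes "\<mu> \<in> base_forms Z"
  shows "odiff Z \<mu> \<in> base_forms Z"
proof -
  have "gtdiff (ograde Z) (odiff Z) (ediff Z) (x \<otimes> 1) = odiff Z x \<otimes> 1" for x
    by (induction x rule: left.graded_induct)
      (simp_all add: left.gtdiff_tensor[OF clinear_odiff clinear_ediff] ediff_1
        clinear_add[OF left.clinear_gtdiff[OF clinear_odiff clinear_ediff]] form_linear linear_simps)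
  with assms show ?thesis by (simp add: base_forms_def ocoact_odiff)
qed

lemma base_forms_hcomp: "\<mu> \<in> base_forms Z \<Longrightarrow> hcomp (ograde Z) k \<mu> \<in> base_forms Z"
  by (simp add: base_forms_def gtproj_degree_preserving[OF clinear_ocoact ocoact_degree]
      gtproj_tensor_degree_0 one_degree)

text \<open>The embeddings \<open>pinc\<close> and \<open>einc0\<close> are injective, so invariance
  can be tested in either tensor product. Coefficients constructed as forms are recognised as
  elements of B in this way.\<close>

lemma pinc_base_forms_iff: "pinc Z p \<in> base_forms Z \<longleftrightarrow> p \<in> base Z"
proof -
  have "ocoact Z (pinc Z p) = pinc Z p \<otimes> 1 \<longleftrightarrow>
      tmap (pinc Z) (einc0 Z) (coact Z p) = tmap (pinc Z) (einc0 Z) (p \<otimes> 1)"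
    by (simp add: ocoact_pinc tmap_tensor clinear_pinc clinear_einc0 einc0_1)
  also have "\<dots> \<longleftrightarrow> coact Z p = p \<otimes> 1"
    using inj_tmap[OF clinear_pinc inj_pinc clinear_einc0 inj_einc0] by (auto dest: injD)
  finally show ?thesis by (simp add: base_forms_def coact_eq_iff)
qed

lemma Hor_hcomp:
  assumes "\<phi> \<in> Hor Z"
  shows "hcomp (ograde Z) k \<phi> \<in> Hor Z"
proof -
  obtain t where t: "ocoact Z \<phi> = tmap id (einc0 Z) t" using assms by (auto simp: Hor_iff)
  have "gtproj k (tmap id (einc0 Z) t) = tmap id (einc0 Z) (tmap (hcomp (ograde Z) k) id t)"
    by (simp add: tmap_tmap clinear_id clinear_einc0 left.clinear_hcomp)
      (simp add: tmap_def tlift_fun_comp[OF clinear_gtproj] gtproj_tensor_degree_0 einc0_degree)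
  then show ?thesis
    by (auto simp: Hor_iff gtproj_degree_preserving[OF clinear_ocoact ocoact_degree] t)
qed


subsection \<open>The covariant derivative\<close>

lemma cbilinear_connection_term: "cbilinear (\<lambda>\<psi> h. \<psi> * \<omega> (germ h))"
  by (intro cbilinearI) (simp_all add: linear_simps form_linear germ_linear)

text \<open>\<open>cov_deriv\<close> passes through \<open>coact_Hor\<close>, which is meaningful on
  horizontal forms only. Putting a linear left inverse of \<open>einc0\<close> on the second leg of
  \<open>ocoact\<close> gives a linear map on all forms that agrees with it there.\<close>

lemma cov_deriv_extension:
  "\<exists>D. clinear D \<and> (\<forall>\<phi>\<in>Hor Z. cov_deriv Z \<omega> \<phi> = D \<phi>) \<and>
    (\<forall>k. \<forall>\<phi>\<in>ograde Z k. \<forall>t. ocoact Z \<phi> = tmap id (einc0 Z) t \<longrightarrow>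
      D \<phi> = odiff Z \<phi> - (-1) ^ k *\<^sub>C tlift (\<lambda>\<psi> h. \<psi> * \<omega> (germ h)) t)"
proof -
  obtain r where r: "clinear r" "r \<circ> einc0 Z = id"
    using cvp.linear_injective_left_inverse[OF clinear_einc0 inj_einc0] by blast
  then have r_einc0: "r (einc0 Z h) = h" for h by (simp add: fun_eq_iff)
  define F where "F k \<phi> = (-1) ^ k *\<^sub>C tlift (\<lambda>\<psi> h. \<psi> * \<omega> (germ h)) (tmap id r (ocoact Z \<phi>))" for k :: nat and \<phi>
  define D where "D \<phi> = odiff Z \<phi> - (\<Sum>k\<in>degs (ograde Z) \<phi>. F k (hcomp (ograde Z) k \<phi>))" for \<phi>
  have r_t: "tmap id r (tmap id (einc0 Z) t) = t" for t :: "('o, 'h) tensor"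
    by (simp add: tmap_tmap r(1) r_einc0 clinear_id clinear_einc0 tmap_ident)
  have F: "clinear (F k)" for k
    unfolding F_def[abs_def]
    by (intro clinear_cscale_fun clinear_tlift_arg cbilinear_connection_term
        clinear_comp[OF clinear_tmap clinear_ocoact] clinear_id r(1))
  show ?thesis
  proof (intro exI conjI ballI allI impI)
    show "clinear D"
      unfolding D_def[abs_def]
      by (intro clinear_diff_fun clinear_odiff left.clinear_sum_degs F)
    show "cov_deriv Z \<omega> \<phi> = D \<phi>" if "\<phi> \<in> Hor Z" for \<phi>
    proof -
      have "coact_Hor Z (hcomp (ograde Z) k \<phi>) = tmap id r (ocoact Z (hcomp (ograde Z) k \<phi>))" for k
        using ocoact_coact_Hor[OF Hor_hcomp[OF that, of k]] r_t by metis
      then show ?thesis by (simp add: cov_deriv_def D_def F_def qgerm_eq_germ)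
    qed
    show "D \<phi> = odiff Z \<phi> - (-1) ^ k *\<^sub>C tlift (\<lambda>\<psi> h. \<psi> * \<omega> (germ h)) t"
      if "\<phi> \<in> ograde Z k" "ocoact Z \<phi> = tmap id (einc0 Z) t" for \<phi> k t
      unfolding D_def
      by (subst left.sum_degs_homogeneous[OF that(1), where F = F])
        (simp_all add: clinear_0[OF F], simp add: F_def that r_t)
  qed
qed

lemma subspace_Hor: "csubspace (Hor Z)"
  by (rule cvs.subspaceI)
    (simp_all add: Hor_def subtensor_def clinear_0[OF clinear_ocoact] form_linear
      cvs.span_zero cvs.span_add cvs.span_scale)

lemma cov_deriv_linear:
  "\<phi> \<in> Hor Z \<Longrightarrow> \<psi> \<in> Hor Z \<Longrightarrow> cov_deriv Z \<omega> (\<phi> + \<psi>) = cov_deriv Z \<omega> \<phi> + cov_deriv Z \<omega> \<psi>"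
  "\<phi> \<in> Hor Z \<Longrightarrow> cov_deriv Z \<omega> (c *\<^sub>C \<phi>) = c *\<^sub>C cov_deriv Z \<omega> \<phi>"
  and cov_deriv_homogeneous: "\<phi> \<in> ograde Z k \<Longrightarrow> ocoact Z \<phi> = tmap id (einc0 Z) t \<Longrightarrow>
    cov_deriv Z \<omega> \<phi> = odiff Z \<phi> - (-1) ^ k *\<^sub>C tlift (\<lambda>\<psi> h. \<psi> * \<omega> (germ h)) t"
proof -
  obtain D where D: "clinear D" "\<And>\<phi>. \<phi> \<in> Hor Z \<Longrightarrow> cov_deriv Z \<omega> \<phi> = D \<phi>"
    "\<And>\<phi> k t. \<phi> \<in> ograde Z k \<Longrightarrow> ocoact Z \<phi> = tmap id (einc0 Z) t \<Longrightarrow>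
      D \<phi> = odiff Z \<phi> - (-1) ^ k *\<^sub>C tlift (\<lambda>\<psi> h. \<psi> * \<omega> (germ h)) t"
    using cov_deriv_extension by blast
  show "\<phi> \<in> Hor Z \<Longrightarrow> \<psi> \<in> Hor Z \<Longrightarrow> cov_deriv Z \<omega> (\<phi> + \<psi>) = cov_deriv Z \<omega> \<phi> + cov_deriv Z \<omega> \<psi>"
    by (simp add: D(2) cvs.subspace_add[OF subspace_Hor] clinear_add[OF D(1)])
  show "\<phi> \<in> Hor Z \<Longrightarrow> cov_deriv Z \<omega> (c *\<^sub>C \<phi>) = c *\<^sub>C cov_deriv Z \<omega> \<phi>"
    by (simp add: D(2) cvs.subspace_scale[OF subspace_Hor] clinear_scale[OF D(1)])
  show "cov_deriv Z \<omega> \<phi> = odiff Z \<phi> - (-1) ^ k *\<^sub>C tlift (\<lambda>\<psi> h. \<psi> * \<omega> (germ h)) t"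
    if "\<phi> \<in> ograde Z k" "ocoact Z \<phi> = tmap id (einc0 Z) t"
    using D(2)[of \<phi>] D(3)[OF that] that by (auto simp: Hor_iff)
qed

text \<open>The coaction of \<mu>\<phi> is \<mu>\<phi>_0 \<otimes> \<phi>_1, so \<mu> factors out of
  the connection term; (-1)^(k+l) splits into the Leibniz sign and the sign in the derivative of
  \<phi>.\<close>

lemma cov_deriv_mult:
  assumes \<mu>: "\<mu> \<in> base_forms Z" "\<mu> \<in> ograde Z k" and \<phi>: "\<phi> \<in> Hor Z" "\<phi> \<in> ograde Z l"
  shows "cov_deriv Z \<omega> (\<mu> * \<phi>) = odiff Z \<mu> * \<phi> + (-1) ^ k *\<^sub>C (\<mu> * cov_deriv Z \<omega> \<phi>)"
proof -
  obtain t where t: "ocoact Z \<phi> = tmap id (einc0 Z) t" using \<phi> by (auto simp: Hor_iff)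
  have "ocoact Z (\<mu> * \<phi>) = tmap id (einc0 Z) (tmap ((*) \<mu>) id t)"
    using \<mu> by (simp add: base_forms_def ocoact_mult t gtmult_tensor_1 clinear_id tmap_tmap
        clinear_einc0 cbilinearD(2)[OF cbilinear_mult])
  from cov_deriv_homogeneous[OF ograde_mult[OF \<mu>(2) \<phi>(2)] this]
  have "cov_deriv Z \<omega> (\<mu> * \<phi>) = odiff Z (\<mu> * \<phi>) -
      (-1) ^ (k + l) *\<^sub>C tlift (\<lambda>\<psi> h. \<mu> * (\<psi> * \<omega> (germ h))) t"
    by (simp add: tlift_tmap cbilinear_connection_term clinear_id cbilinearD(2)[OF cbilinear_mult] mult.assoc)
  also have "\<dots> = odiff Z \<mu> * \<phi> + (-1) ^ k *\<^sub>C (\<mu> * cov_deriv Z \<omega> \<phi>)"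
    by (simp add: odiff_mult[OF \<mu>(2)] cov_deriv_homogeneous[OF \<phi>(2) t] ring_distribs
        cscale_mult_right cvs.scale_right_diff_distrib cscale_cscale power_add
        tlift_fun_comp[OF cbilinearD(2)[OF cbilinear_mult]])
  finally show ?thesis .
qed

lemma cov_deriv_pinc: "cov_deriv Z \<omega> (pinc Z p) =
    odiff Z (pinc Z p) - tlift (\<lambda>a h. pinc Z a * \<omega> (germ h)) (coact Z p)"
proof -
  have "ocoact Z (pinc Z p) = tmap id (einc0 Z) (tmap (pinc Z) id (coact Z p))"
    by (simp add: ocoact_pinc tmap_tmap clinear_pinc clinear_einc0 clinear_id)
  from cov_deriv_homogeneous[OF pinc_degree this] show ?thesis
    by (simp add: tlift_tmap cbilinear_connection_term clinear_pinc clinear_id cscale_one)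
qed

lemma clinear_cov_deriv_pinc: "clinear (\<lambda>p. cov_deriv Z \<omega> (pinc Z p))"
proof -
  have "cbilinear (\<lambda>a h. pinc Z a * \<omega> (germ h))"
    by (intro cbilinearI) (simp_all add: linear_simps form_linear germ_linear)
  then show ?thesis
    unfolding cov_deriv_pinc
    by (intro clinear_diff_fun clinear_comp[OF clinear_odiff clinear_pinc] clinear_tlift_arg coact_linear)
qed

text \<open>In the coaction of \<omega>(\<pi>(b2)) multiplied by b1, the adjoint part contracts by
  \<open>ad_germ_mult\<close> and the inhomogeneous part sums to db by
  \<open>d_eq_germ\<close>.\<close>

lemma tlift_mult_connection:
  "tlift (\<lambda>h h'. tmap ((*) x) ((*) (einc0 Z h)) (ocoact Z (\<omega> (germ h')))) (comult Z b) =
    tlift (\<lambda>h h'. (x * \<omega> (germ h)) \<otimes> einc0 Z h') (comult Z b) + x \<otimes> einc1 Z (gdiff Z b)"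
proof -
  note m = cbilinearD(2)[OF cbilinear_mult]
  have lx: "clinear (\<lambda>\<theta>. x * \<omega> \<theta>)" by (rule clinear_comp[OF m clinear_connection])
  have "tmap ((*) x) ((*) (einc0 Z h)) (tmap \<omega> (einc0 Z) t) =
      tmap (\<lambda>\<theta>. x * \<omega> \<theta>) (einc0 Z) (tmap id ((*) h) t)" for h t
    by (simp add: tmap_tmap m clinear_connection clinear_einc0 clinear_id lx einc0_mult)
  then have "tlift (\<lambda>h h'. tmap ((*) x) ((*) (einc0 Z h)) (ocoact Z (\<omega> (germ h')))) (comult Z b) =
      tlift (\<lambda>h h'. tmap (\<lambda>\<theta>. x * \<omega> \<theta>) (einc0 Z) (tmap id ((*) h) (ad_germ h')) +
        x \<otimes> (einc1 Z (lact Z h (germ h')))) (comult Z b)"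
    by (simp add: ocoact_connection clinear_add[OF clinear_tmap[OF m m]] tmap_tensor m einc1_la)
  also have "\<dots> = tmap (\<lambda>\<theta>. x * \<omega> \<theta>) (einc0 Z) (tmap germ id (comult Z b)) + x \<otimes> einc1 Z (gdiff Z b)"
    by (simp add: tlift_fun_add
        flip: tlift_fun_comp[OF clinear_tmap[OF lx clinear_einc0]] ad_germ_mult d_eq_germ
          tlift_fun_comp[OF clinear_comp[OF cbilinearD(2)[OF cbilinear_tensor] clinear_einc1]])
  also have "tmap (\<lambda>\<theta>. x * \<omega> \<theta>) (einc0 Z) (tmap germ id (comult Z b)) =
      tlift (\<lambda>h h'. (x * \<omega> (germ h)) \<otimes> einc0 Z h') (comult Z b)"
    by (simp add: tmap_tmap lx clinear_einc0 clinear_germ clinear_id) (simp add: tmap_def)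
  finally show ?thesis .
qed

lemma ocoact_cov_deriv_pinc: "ocoact Z (cov_deriv Z \<omega> (pinc Z p)) =
    tmap (\<lambda>p. cov_deriv Z \<omega> (pinc Z p)) (einc0 Z) (coact Z p)"
proof -
  note m = cbilinearD(2)[OF cbilinear_mult]
  note cop = coassoc_tlift[OF coact_coassoc coact_linear clinear_comult]
  \<comment> \<open>\<open>?X\<close> comes from d on the second leg and occurs again as the
    inhomogeneous part of the connection term, so it cancels; \<open>?Y\<close> is the part that
    survives.\<close>
  let ?X = "tlift (\<lambda>a b. pinc Z a \<otimes> einc1 Z (gdiff Z b)) (coact Z p)"
  let ?Y = "tlift (\<lambda>a b. tlift (\<lambda>a' h. (pinc Z a' * \<omega> (germ h)) \<otimes> einc0 Z b) (coact Z a)) (coact Z p)"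
  have d: "ocoact Z (odiff Z (pinc Z p)) = tlift (\<lambda>a h. odiff Z (pinc Z a) \<otimes> einc0 Z h) (coact Z p) + ?X"
    by (simp add: ocoact_odiff ocoact_pinc tmap_def ediff_einc0 pinc_degree cscale_one
        tlift_fun_comp[OF left.clinear_gtdiff[OF clinear_odiff clinear_ediff]]
        left.gtdiff_tensor[OF clinear_odiff clinear_ediff pinc_degree] flip: tlift_fun_add)
  have "ocoact Z (tlift (\<lambda>a h. pinc Z a * \<omega> (germ h)) (coact Z p)) =
      tlift (\<lambda>a b. tlift (\<lambda>a' h. tmap ((*) (pinc Z a')) ((*) (einc0 Z h)) (ocoact Z (\<omega> (germ b)))) (coact Z a)) (coact Z p)"
    by (simp add: tlift_fun_comp[OF clinear_ocoact] ocoact_mult ocoact_pinc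
        gtmult_tmap_einc0[OF clinear_pinc] tact_def)
  \<comment> \<open>Coassociativity shifts the splitting from the first leg of the coaction to the
    second, where \<open>tlift_mult_connection\<close> applies; the reverse shift then produces
    \<open>?Y\<close>.\<close>
  also have "\<dots> = tlift (\<lambda>a b. tlift (\<lambda>h h'. tmap ((*) (pinc Z a)) ((*) (einc0 Z h)) (ocoact Z (\<omega> (germ h')))) (comult Z b)) (coact Z p)"
  proof (rule cop)
    note b = cbilinear_tact_aux[OF cbilinear_mult_comp(1)[OF clinear_pinc] cbilinear_mult_comp(2)[OF clinear_einc0]]
    show "ctrilinear (\<lambda>a h h'. tmap ((*) (pinc Z a)) ((*) (einc0 Z h)) (ocoact Z (\<omega> (germ h'))))"
      by (rule ctrilinearI; (rule cbilinearD(3-6)[OF b])?)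
        (simp_all add: form_linear germ_linear
          clinear_add[OF clinear_tmap[OF m m]] clinear_scale[OF clinear_tmap[OF m m]])
  qed
  also have "\<dots> = tlift (\<lambda>a b. tlift (\<lambda>h h'. (pinc Z a * \<omega> (germ h)) \<otimes> einc0 Z h') (comult Z b)) (coact Z p) + ?X"
    by (simp add: tlift_mult_connection tlift_fun_add)
  also have "tlift (\<lambda>a b. tlift (\<lambda>h h'. (pinc Z a * \<omega> (germ h)) \<otimes> einc0 Z h') (comult Z b)) (coact Z p) = ?Y"
    by (rule cop[symmetric])
      (intro ctrilinearI; simp add: linear_simps form_linear germ_linear)
  finally have "ocoact Z (cov_deriv Z \<omega> (pinc Z p)) =
      tlift (\<lambda>a h. odiff Z (pinc Z a) \<otimes> einc0 Z h) (coact Z p) - ?Y"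
    by (simp add: cov_deriv_pinc clinear_diff[OF clinear_ocoact] d)
  also have "\<dots> = tlift (\<lambda>a b. cov_deriv Z \<omega> (pinc Z a) \<otimes> einc0 Z b) (coact Z p)"
    by (simp add: cov_deriv_pinc tensor_diff_left tlift_fun_diff
        tlift_fun_comp[OF cbilinearD(1)[OF cbilinear_tensor]])
  finally show ?thesis by (simp add: tmap_def)
qed

end

section \<open>Finite-dimensional inner product spaces\<close>

locale inner_space =
  fixes ip :: "'v::complex_space \<Rightarrow> 'v \<Rightarrow> complex"
  assumes inner_product: "inner_product_on UNIV ip"
    and finite_span: "\<exists>A. finite A \<and> cspan A = (UNIV :: 'v set)"
begin

lemma ip_add_right: "ip x (y + z) = ip x y + ip x z"
  and ip_scale_right: "ip x (c *\<^sub>C y) = c * ip x y"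
  and ip_cnj: "cnj (ip x y) = ip y x"
  and ip_pos: "x \<noteq> 0 \<Longrightarrow> Re (ip x x) > 0"
proof -
  note props = inner_product[unfolded inner_product_on_def, unfolded ball_UNIV]
  show "ip x (y + z) = ip x y + ip x z" by (rule props[THEN conjunct1, rule_format])
  show "ip x (c *\<^sub>C y) = c * ip x y" by (rule props[THEN conjunct2, THEN conjunct1, rule_format])
  show "cnj (ip x y) = ip y x"
    by (rule props[THEN conjunct2, THEN conjunct2, THEN conjunct1, rule_format, symmetric])
  show "x \<noteq> 0 \<Longrightarrow> Re (ip x x) > 0"
    by (rule props[THEN conjunct2, THEN conjunct2, THEN conjunct2, rule_format])
qed

lemma ip_add_left: "ip (x + y) z = ip x z + ip y z"
  by (metis complex_cnj_add ip_add_right ip_cnj)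

lemma ip_scale_left: "ip (c *\<^sub>C x) y = cnj c * ip x y"
  by (metis complex_cnj_mult ip_cnj ip_scale_right)

lemma clinear_ip: "clinear (ip x)"
  by (intro clinearI) (simp_all add: ip_add_right ip_scale_right cscale_complex_def)

lemma ip_sum_right: "ip x (\<Sum>i\<in>A. f i) = (\<Sum>i\<in>A. ip x (f i))"
  by (rule clinear_sum[OF clinear_ip])

lemma ip_0 [simp]: "ip x 0 = 0" "ip 0 x = 0"
  by (metis clinear_0 clinear_ip) (metis clinear_0 clinear_ip complex_cnj_zero ip_cnj)

lemma ip_diff_right: "ip x (y - z) = ip x y - ip x z"
  by (rule clinear_diff[OF clinear_ip])

text \<open>The orthogonal projection onto the span when \<open>e\<close> is orthonormal. Linear
  maps are total on the type, so subspaces enter the later arguments through such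
  projections.\<close>

definition proj :: "nat \<Rightarrow> (nat \<Rightarrow> 'v) \<Rightarrow> 'v \<Rightarrow> 'v" where
  "proj n e x = (\<Sum>i<n. ip (e i) x *\<^sub>C e i)"

lemma clinear_proj: "clinear (proj n e)"
  by (intro clinearI)
    (simp_all add: proj_def ip_add_right ip_scale_right cscale_add_left sum.distrib
      cvs.scale_sum_right cscale_cscale)

lemma ip_onb: "orthonormal_basis U ip n e \<Longrightarrow> i < n \<Longrightarrow> j < n \<Longrightarrow> ip (e i) (e j) = (if i = j then 1 else 0)"
  by (simp add: orthonormal_basis_def)

lemma onb_in: "orthonormal_basis U ip n e \<Longrightarrow> i < n \<Longrightarrow> e i \<in> U"
  unfolding orthonormal_basis_def by (metis cvs.span_base imageI lessThan_iff)

lemma onb_subspace: "orthonormal_basis U ip n e \<Longrightarrow> csubspace U"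
  unfolding orthonormal_basis_def by (metis cvs.subspace_span)

lemma proj_in:
  assumes "orthonormal_basis U ip n e"
  shows "proj n e x \<in> U"
  unfolding proj_def using onb_subspace[OF assms]
  by (intro cvs.subspace_sum cvs.subspace_scale) (simp_all add: onb_in[OF assms])

lemma proj_onb:
  assumes "orthonormal_basis U ip n e" "j < n"
  shows "proj n e (e j) = e j"
proof -
  have "proj n e (e j) = (\<Sum>i<n. if i = j then e j else 0)"
    unfolding proj_def by (intro sum.cong) (auto simp: ip_onb[OF assms(1)] assms(2) cscale_one)
  then show ?thesis using assms(2) by simp
qed

lemma proj_ident:
  assumes "orthonormal_basis U ip n e" "x \<in> U"
  shows "proj n e x = x"
proof -
  have "x \<in> cspan (e ` {..<n})" using assms by (simp add: orthonormal_basis_def)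
  then show ?thesis
    by (induction rule: cvs.span_induct_alt)
      (auto simp: clinear_0[OF clinear_proj] clinear_add[OF clinear_proj]
        clinear_scale[OF clinear_proj] proj_onb[OF assms(1)])
qed

lemma ip_proj:
  assumes "orthonormal_basis U ip n e" "j < n"
  shows "ip (e j) (proj n e x) = ip (e j) x"
proof -
  have "ip (e j) (proj n e x) = (\<Sum>i<n. if i = j then ip (e j) x else 0)"
    unfolding proj_def ip_sum_right
    by (intro sum.cong) (auto simp: ip_scale_right ip_onb[OF assms(1)] assms(2))
  then show ?thesis using assms(2) by simp
qed

text \<open>Pairing a vanishing combination with e_j isolates its j-th coefficient. Dimensions are
  compared through the lengths of orthonormal bases in the induction that builds frames.\<close>

lemma onb_dim:
  assumes "orthonormal_basis U ip n e"
  shows "cvs.dim U = n"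
proof -
  have inj: "inj_on e {..<n}"
  proof (rule inj_onI)
    fix i j assume "i \<in> {..<n}" "j \<in> {..<n}" "e i = e j"
    then show "i = j"
      using ip_onb[OF assms, of i i] ip_onb[OF assms, of i j] by (auto split: if_splits)
  qed
  have "cvs.independent (e ` {..<n})"
  proof (rule cvs.independent_if_scalars_zero)
    fix f x assume sum: "(\<Sum>x\<in>e ` {..<n}. f x *\<^sub>C x) = 0" and "x \<in> e ` {..<n}"
    then obtain j where j: "j < n" "x = e j" by blast
    have "0 = ip (e j) (\<Sum>i<n. f (e i) *\<^sub>C e i)"
      using sum by (simp add: sum.reindex[OF inj])
    also have "\<dots> = (\<Sum>i<n. if i = j then f (e j) else 0)"
      unfolding ip_sum_right
      by (intro sum.cong) (auto simp: ip_scale_right ip_onb[OF assms] j)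
    finally show "f x = 0" using j by simp
  qed simp
  then have "cvs.dim (cspan (e ` {..<n})) = card (e ` {..<n})"
    by (rule cvs.dim_span_eq_card_independent)
  moreover have "cspan (e ` {..<n}) = U" using assms by (simp add: orthonormal_basis_def)
  ultimately show ?thesis by (simp only: card_image[OF inj] card_lessThan)
qed

lemma ex_onb_span:
  assumes "finite A"
  shows "\<exists>n e. orthonormal_basis (cspan A) ip n e"
  using assms
proof (induction A)
  case empty
  have "orthonormal_basis (cspan {}) ip 0 (\<lambda>_. 0)" by (simp add: orthonormal_basis_def)
  then show ?case by blast
next
  case (insert a A)
  then obtain n e where e: "orthonormal_basis (cspan A) ip n e" by blast
  \<comment> \<open>Gram-Schmidt: the component of \<open>a\<close> orthogonal to the span so far.
    If it vanishes the basis is kept, otherwise it is normalised and appended.\<close>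
  define b where "b = a - proj n e a"
  have ortho: "ip (e i) b = 0" "ip b (e i) = 0" if "i < n" for i
  proof -
    show "ip (e i) b = 0" using ip_proj[OF e that, of a] by (simp add: b_def ip_diff_right)
    then show "ip b (e i) = 0" using ip_cnj[of "e i" b] by simp
  qed
  show ?case
  proof (cases "b = 0")
    case True
    then have "a \<in> cspan A" using proj_in[OF e, of a] by (simp add: b_def)
    then have "cspan (insert a A) = cspan A" by (rule cvs.span_redundant)
    with e show ?thesis by auto
  next
    case False
    define r where "r = sqrt (Re (ip b b))"
    have ipb: "ip b b = complex_of_real (r * r)" and r: "r \<noteq> 0"
      using ip_pos[OF False] ip_cnj[of b b] by (auto simp: r_def complex_eq_iff)
    define e' where "e' = e(n := (1 / complex_of_real r) *\<^sub>C b)"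
    have e'_n: "e' n = (1 / complex_of_real r) *\<^sub>C b" and e'_less: "\<And>i. i < n \<Longrightarrow> e' i = e i"
      by (simp_all add: e'_def)
    have image: "e' ` {..<Suc n} = insert (e' n) (e ` {..<n})"
      by (simp add: lessThan_Suc e'_less)
    have spanA: "cspan (e ` {..<n}) = cspan A" using e by (simp add: orthonormal_basis_def)
    have sub: "cspan A \<subseteq> cspan (insert a A)" by (intro cvs.span_mono) blast
    have "cspan (insert (e' n) (e ` {..<n})) = cspan (insert a A)"
    proof (rule cvs.span_eq[THEN iffD2], safe)
      have "b \<in> cspan (insert a A)"
        using proj_in[OF e, of a] sub unfolding b_def by (intro cvs.span_diff) (auto intro: cvs.span_base)
      then show "e' n \<in> cspan (insert a A)" unfolding e'_n by (rule cvs.span_scale)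
      show "e i \<in> cspan (insert a A)" if "i < n" for i using onb_in[OF e that] sub by blast
      have *: "cspan A \<subseteq> cspan (insert (e' n) (e ` {..<n}))"
        unfolding spanA[symmetric] by (intro cvs.span_mono) blast
      have "a = complex_of_real r *\<^sub>C e' n + proj n e a"
        using r by (simp add: e'_n b_def cscale_one)
      moreover have "complex_of_real r *\<^sub>C e' n + proj n e a \<in> cspan (insert (e' n) (e ` {..<n}))"
        using proj_in[OF e, of a] * by (intro cvs.span_add cvs.span_scale) (auto intro: cvs.span_base)
      ultimately show "a \<in> cspan (insert (e' n) (e ` {..<n}))" by metis
      show "x \<in> cspan (insert (e' n) (e ` {..<n}))" if "x \<in> A" for x
        using that * cvs.span_base by blast
    qed
    moreover have "ip (e' i) (e' j) = (if i = j then 1 else 0)" if "i < Suc n" "j < Suc n" for i j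
      using that ip_onb[OF e, of i j] ortho r
      by (cases "i = n"; cases "j = n")
        (auto simp: e'_less e'_n ip_scale_left ip_scale_right ipb less_Suc_eq)
    ultimately have "orthonormal_basis (cspan (insert a A)) ip (Suc n) e'"
      by (simp add: orthonormal_basis_def image)
    then show ?thesis by blast
  qed
qed

lemma ex_onb:
  assumes "csubspace U"
  shows "\<exists>n e. orthonormal_basis U ip n e"
proof -
  obtain A where A: "finite A" "cspan A = (UNIV :: 'v set)" using finite_span by blast
  obtain B where B: "B \<subseteq> U" "cvs.independent B" "U \<subseteq> cspan B"
    using cvs.maximal_independent_subset by blast
  have "finite B" using cvs.independent_span_bound[OF A(1) B(2)] A(2) by simp
  moreover have "cspan B = U" using B assms by (simp add: cvs.span_minimal subset_antisym)
  ultimately show ?thesis using ex_onb_span by metis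
qed

end


section \<open>Unitary corepresentations\<close>

definition invariant :: "('v::complex_space \<Rightarrow> ('v, 'h::star_algebra) tensor) \<Rightarrow> 'v set \<Rightarrow> bool" where
  "invariant \<delta> U \<longleftrightarrow> csubspace U \<and> (\<forall>x\<in>U. \<delta> x \<in> subtensor U UNIV)"

lemma star_0: "star (0 :: 'a::involutive_space) = 0"
  using star_cscale[of 0 "0::'a"] by simp

lemma star_sum: "star (\<Sum>i\<in>A. f i :: 'a::involutive_space) = (\<Sum>i\<in>A. star (f i))"
  by (induction A rule: infinite_finite_induct) (simp_all add: star_0 star_add)

locale unitary_corep = hopf \<Delta> \<epsilon> S + inner_space ip
  for \<Delta> :: "'h::star_algebra \<Rightarrow> ('h, 'h) tensor" and \<epsilon> S
    and ip :: "'v::complex_space \<Rightarrow> 'v \<Rightarrow> complex" +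
  fixes \<delta> :: "'v \<Rightarrow> ('v, 'h) tensor"
  assumes unitary: "unitary_corepresentation \<Delta> \<epsilon> UNIV \<delta> ip"
begin

lemma clinear_corep: "clinear \<delta>"
  and corep_counit: "tlift (\<lambda>w h. \<epsilon> h *\<^sub>C w) (\<delta> v) = v"
  and corep_coassoc: "tassoc (tmap \<delta> id (\<delta> v)) = tmap id \<Delta> (\<delta> v)"
proof -
  have "corepresentation \<Delta> \<epsilon> UNIV \<delta>"
    using unitary by (simp only: unitary_corepresentation_def)
  then show "clinear \<delta>" "tlift (\<lambda>w h. \<epsilon> h *\<^sub>C w) (\<delta> v) = v"
    "tassoc (tmap \<delta> id (\<delta> v)) = tmap id \<Delta> (\<delta> v)"
    by (simp_all add: corepresentation_def)
qed

text \<open>The matrix coefficient without a choice of basis, antilinear in the first argument: in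
  an orthonormal basis \<open>coeff (e i) (e j)\<close> is the entry u_ij. This allows free passage
  between bases of different invariant subspaces.\<close>

definition coeff :: "'v \<Rightarrow> 'v \<Rightarrow> 'h" where
  "coeff x y = tlift (\<lambda>v h. ip x v *\<^sub>C h) (\<delta> y)"

lemma cbilinear_coeff_aux: "cbilinear (\<lambda>v h. ip x v *\<^sub>C (h :: 'h))"
  by (intro cbilinearI)
    (simp_all add: ip_add_right ip_scale_right cscale_add_left cscale_add_right cscale_cscale mult.commute)

lemma clinear_coeff: "clinear (coeff x)"
  unfolding coeff_def[abs_def] by (rule clinear_tlift_arg[OF cbilinear_coeff_aux clinear_corep])

lemma coeff_add_left: "coeff (x + y) z = coeff x z + coeff y z"
  by (simp add: coeff_def ip_add_left cscale_add_left tlift_fun_add)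

lemma coeff_scale_left: "coeff (c *\<^sub>C x) y = cnj c *\<^sub>C coeff x y"
  by (simp add: coeff_def ip_scale_left flip: tlift_fun_cscale)

lemma coeff_sum_left: "coeff (\<Sum>i\<in>A. f i) y = (\<Sum>i\<in>A. coeff (f i) y)"
proof -
  have "coeff 0 y = 0" using coeff_scale_left[of 0 0 y] by simp
  then show ?thesis
    by (induction A rule: infinite_finite_induct) (simp_all add: coeff_add_left)
qed

lemma comult_coeff_tlift: "\<Delta> (coeff x y) = tlift (\<lambda>v h. coeff x v \<otimes> h) (\<delta> y)"
proof -
  have ctr: "ctrilinear (\<lambda>a b c. ip x a *\<^sub>C ((b :: 'h) \<otimes> (c :: 'h)))"
    by (intro ctrilinearI)
      (simp_all add: ip_add_right ip_scale_right linear_simps cscale_add_left cscale_cscale mult.commute)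
  have "\<Delta> (coeff x y) = tlift (\<lambda>a b. tlift (\<lambda>b' b''. ip x a *\<^sub>C (b' \<otimes> b'')) (\<Delta> b)) (\<delta> y)"
    by (simp add: coeff_def tlift_fun_comp[OF clinear_comult] hopf_linear tlift_fun_cscale tlift_tensor_id)
  also have "\<dots> = tlift (\<lambda>a b. tlift (\<lambda>a' a''. ip x a' *\<^sub>C (a'' \<otimes> b)) (\<delta> a)) (\<delta> y)"
    by (rule coassoc_tlift[OF corep_coassoc clinear_corep clinear_comult ctr, symmetric])
  also have "\<dots> = tlift (\<lambda>v h. coeff x v \<otimes> h) (\<delta> y)"
    by (simp add: coeff_def tlift_fun_comp[OF cbilinearD(1)[OF cbilinear_tensor]] tensor_cscale_left)
  finally show ?thesis .
qed

lemma counit_coeff: "\<epsilon> (coeff x y) = ip x y"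
proof -
  have "\<epsilon> (coeff x y) = tlift (\<lambda>v h. ip x (\<epsilon> h *\<^sub>C v)) (\<delta> y)"
    by (simp add: coeff_def tlift_fun_comp[OF clinear_counit] hopf_linear ip_scale_right
        cscale_complex_def mult.commute)
  also have "\<dots> = ip x y"
    using tlift_fun_comp[OF clinear_ip, of x "\<lambda>v h. \<epsilon> h *\<^sub>C v" "\<delta> y"] by (simp add: corep_counit)
  finally show ?thesis .
qed

lemma tensor_onb_expand:
  fixes t :: "('v, 'h) tensor"
  assumes "orthonormal_basis U ip n e" "t \<in> subtensor U UNIV"
  shows "t = (\<Sum>i<n. e i \<otimes> tlift (\<lambda>v h. ip (e i) v *\<^sub>C h) t)"
  using assms(2)
proof (induction rule: subtensor_induct)
  case zero
  then show ?case by (simp add: clinear_0[OF clinear_tlift[OF cbilinear_coeff_aux]])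
next
  case (step c v w s)
  let ?F = "\<lambda>i. tlift (\<lambda>v h. ip (e i) v *\<^sub>C (h :: 'h))"
  have "v \<otimes> w = (\<Sum>i<n. e i \<otimes> (ip (e i) v *\<^sub>C w))"
    using proj_ident[OF assms(1) step(1)]
    by (simp add: proj_def tensor_cscale_right flip: tensor_cscale_left tensor_sum_left)
  also have "\<dots> = (\<Sum>i<n. e i \<otimes> ?F i (v \<otimes> w))"
    by (simp add: tlift_tensor[OF cbilinear_coeff_aux])
  finally have vw: "v \<otimes> w = (\<Sum>i<n. e i \<otimes> ?F i (v \<otimes> w))" .
  have "(\<Sum>i<n. e i \<otimes> ?F i (c *\<^sub>C (v \<otimes> w) + s)) =
      c *\<^sub>C (\<Sum>i<n. e i \<otimes> ?F i (v \<otimes> w)) + (\<Sum>i<n. e i \<otimes> ?F i s)"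
    by (simp only: tlift_add[OF cbilinear_coeff_aux] tlift_cscale[OF cbilinear_coeff_aux]
        tensor_add_right tensor_cscale_right sum.distrib cvs.scale_sum_right)
  then show ?case using step(3) vw by metis
qed

lemma corep_expand:
  assumes "orthonormal_basis U ip n e" "\<delta> y \<in> subtensor U UNIV"
  shows "\<delta> y = (\<Sum>i<n. e i \<otimes> coeff (e i) y)"
  unfolding coeff_def by (rule tensor_onb_expand[OF assms])

text \<open>Only basis vectors of a subspace U with \<delta>(y) in U \<otimes> H occur, so the
  matrix comultiplication is available inside an invariant subspace.\<close>

lemma comult_coeff:
  assumes "orthonormal_basis U ip n e" "\<delta> y \<in> subtensor U UNIV"
  shows "\<Delta> (coeff x y) = (\<Sum>i<n. coeff x (e i) \<otimes> coeff (e i) y)"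
proof -
  have b: "cbilinear (\<lambda>v h. coeff x v \<otimes> (h :: 'h))"
    by (rule cbilinear_tensor_comp[OF clinear_coeff clinear_id(1)])
  show ?thesis
    unfolding comult_coeff_tlift
    by (subst corep_expand[OF assms]) (simp add: tlift_sum[OF b] tlift_tensor[OF b])
qed

lemma antipode_coeff_mult:
  assumes "orthonormal_basis U ip n e" "\<delta> y \<in> subtensor U UNIV"
  shows "(\<Sum>i<n. S (coeff x (e i)) * coeff (e i) y) = ip x y *\<^sub>C 1"
    "(\<Sum>i<n. coeff x (e i) * S (coeff (e i) y)) = ip x y *\<^sub>C 1"
proof -
  have b: "cbilinear (\<lambda>a b. S a * b)" "cbilinear (\<lambda>a b. a * S b)"
    by (intro cbilinearI; simp add: hopf_linear linear_simps)+
  show "(\<Sum>i<n. S (coeff x (e i)) * coeff (e i) y) = ip x y *\<^sub>C 1"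
    using antipode_left[of "coeff x y"]
    by (simp add: comult_coeff[OF assms] tlift_sum[OF b(1)] tlift_tensor[OF b(1)] counit_coeff)
  show "(\<Sum>i<n. coeff x (e i) * S (coeff (e i) y)) = ip x y *\<^sub>C 1"
    using antipode_right[of "coeff x y"]
    by (simp add: comult_coeff[OF assms] tlift_sum[OF b(2)] tlift_tensor[OF b(2)] counit_coeff)
qed

lemma corep_in: "\<delta> y \<in> subtensor UNIV UNIV"
  using tmap_in_subtensor[OF clinear_id(2) clinear_id(2), of UNIV UNIV "\<delta> y"] by (simp add: tmap_ident)

text \<open>For an orthonormal basis S(u) is a left inverse of the matrix u by the antipode axiom,
  and its adjoint is a right inverse by unitarity, so the two coincide; sesquilinear expansion gives
  the general case.\<close>

lemma antipode_coeff: "S (coeff x y) = star (coeff y x)"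
proof -
  obtain n e where e: "orthonormal_basis UNIV ip n e" using ex_onb[OF cvs.subspace_UNIV] by blast
  \<comment> \<open>This yields the matrix that unitarity provides for the chosen basis; its entries
    are then identified with \<open>coeff\<close>.\<close>
  note unitary[unfolded unitary_corepresentation_def, THEN conjunct2, THEN conjunct2, THEN conjunct2,
      rule_format, OF e]
  then obtain u where u: "\<And>j. j < n \<Longrightarrow> \<delta> (e j) = (\<Sum>i<n. e i \<otimes> u i j)"
    and uu: "\<And>i j. i < n \<Longrightarrow> j < n \<Longrightarrow> (\<Sum>k<n. u i k * star (u j k)) = (if i = j then 1 else 0)"
    by blast
  have coeff_u: "coeff (e i) (e j) = u i j" if "i < n" "j < n" for i j
  proof -
    have "coeff (e i) (e j) = (\<Sum>k<n. ip (e i) (e k) *\<^sub>C u k j)"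
      by (simp add: coeff_def u that tlift_sum[OF cbilinear_coeff_aux] tlift_tensor[OF cbilinear_coeff_aux])
    also have "\<dots> = (\<Sum>k<n. if k = i then u i j else 0)"
      by (intro sum.cong) (auto simp: ip_onb[OF e] that cscale_one)
    finally show ?thesis using that by simp
  qed
  have S_u: "S (u i l) = star (u l i)" if "i < n" "l < n" for i l
  proof -
    have Su: "(\<Sum>k<n. S (u i k) * u k j) = (if i = j then 1 else 0)" if "j < n" for j
    proof -
      have "(\<Sum>k<n. S (u i k) * u k j) = ip (e i) (e j) *\<^sub>C 1"
        using antipode_coeff_mult(1)[OF e corep_in, of "e i" "e j"] coeff_u \<open>i < n\<close> that by simp
      then show ?thesis using ip_onb[OF e, of i j] that \<open>i < n\<close> by (simp add: cscale_one)
    qed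
    have "S (u i l) = (\<Sum>k<n. if k = l then S (u i k) else 0)"
      using that by simp
    \<comment> \<open>Inserts u times its adjoint in place of the identity, in order to regroup S(u)
      with u.\<close>
    also have "\<dots> = (\<Sum>k<n. S (u i k) * (\<Sum>j<n. u k j * star (u l j)))"
      by (intro sum.cong) (auto simp: uu that)
    also have "\<dots> = (\<Sum>k<n. \<Sum>j<n. S (u i k) * u k j * star (u l j))"
      by (simp add: sum_distrib_left mult.assoc)
    also have "\<dots> = (\<Sum>j<n. (\<Sum>k<n. S (u i k) * u k j) * star (u l j))"
      by (subst sum.swap) (simp add: sum_distrib_right)
    also have "\<dots> = (\<Sum>j<n. if j = i then star (u l i) else 0)"
      by (intro sum.cong) (auto simp: Su)
    also have "\<dots> = star (u l i)" using that by simp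
    finally show ?thesis .
  qed
  have expand: "coeff x y = (\<Sum>i<n. \<Sum>j<n. (ip x (e i) * ip (e j) y) *\<^sub>C u i j)" for x y
  proof -
    have "coeff x y = coeff (proj n e x) (proj n e y)" by (simp add: proj_ident[OF e])
    then show ?thesis
      by (subst sum.swap)
        (simp add: proj_def coeff_sum_left clinear_sum[OF clinear_coeff] coeff_scale_left ip_cnj
          clinear_scale[OF clinear_coeff] coeff_u cscale_cscale cvs.scale_sum_right mult.commute)
  qed
  have "S (coeff x y) = (\<Sum>i<n. \<Sum>j<n. (ip x (e i) * ip (e j) y) *\<^sub>C star (u j i))"
    by (simp add: expand clinear_sum[OF clinear_antipode] hopf_linear S_u)
  also have "\<dots> = star (coeff y x)"
    by (subst sum.swap) (simp add: expand star_sum star_cscale ip_cnj mult.commute)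
  finally show ?thesis .
qed

text \<open>The antipode identities with S rewritten by \<open>antipode_coeff\<close>. They give
  unitarity in every orthonormal basis of an invariant subspace, while the definition speaks of
  bases of the whole space.\<close>

lemma unitary_coeff:
  assumes "orthonormal_basis U ip n e" "\<delta> y \<in> subtensor U UNIV"
  shows "(\<Sum>i<n. star (coeff (e i) x) * coeff (e i) y) = ip x y *\<^sub>C 1"
    "(\<Sum>i<n. coeff x (e i) * star (coeff y (e i))) = ip x y *\<^sub>C 1"
  using antipode_coeff_mult[OF assms, of x] by (simp_all add: antipode_coeff)

text \<open>For z orthogonal to U, invariance of U kills the coefficients
  \<open>coeff z (e k)\<close>, and \<open>antipode_coeff\<close> carries this over to
  \<open>coeff (e k) z\<close>. So y and its projection have the same coefficients against
  U.\<close>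

lemma proj_morphism:
  assumes e: "orthonormal_basis U ip n e" and U: "invariant \<delta> U"
  shows "tmap (proj n e) id (\<delta> y) = \<delta> (proj n e y)"
proof -
  have inv: "\<delta> x \<in> subtensor U UNIV" if "x \<in> U" for x using U that by (simp add: invariant_def)
  have "coeff (e k) (y - proj n e y) = 0" if k: "k < n" for k
  proof -
    let ?z = "y - proj n e y"
    have ortho: "ip ?z (e j) = 0" if "j < n" for j
      using ip_proj[OF e that, of y] ip_cnj[of "e j" ?z] by (simp add: ip_diff_right)
    have "coeff ?z (e k) = (\<Sum>j<n. ip ?z (e j) *\<^sub>C coeff (e j) (e k))"
      unfolding coeff_def[of ?z]
      by (subst corep_expand[OF e inv[OF onb_in[OF e k]]])
        (simp add: tlift_sum[OF cbilinear_coeff_aux] tlift_tensor[OF cbilinear_coeff_aux])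
    then have "coeff ?z (e k) = 0" by (simp add: ortho)
    then have "star (coeff (e k) ?z) = 0"
      using antipode_coeff[of ?z "e k"] clinear_0[OF clinear_antipode] by simp
    then show ?thesis by (metis star_0 star_star)
  qed
  then have coeff_eq: "coeff (e k) y = coeff (e k) (proj n e y)" if "k < n" for k
    using that by (simp add: clinear_diff[OF clinear_coeff])
  have "tmap (proj n e) id (\<delta> y) = (\<Sum>k<n. e k \<otimes> coeff (e k) y)"
    by (simp add: tmap_def proj_def coeff_def tensor_sum_left tensor_cscale_left tlift_fun_sum
        tlift_fun_comp[OF cbilinearD(2)[OF cbilinear_tensor]] tensor_cscale_right)
  also have "\<dots> = \<delta> (proj n e y)"
    by (simp add: corep_expand[OF e inv[OF proj_in[OF e]], of y] coeff_eq)
  finally show ?thesis .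
qed

lemma tmap_subtensor:
  assumes "t \<in> subtensor U UNIV" "clinear f" "f ` U \<subseteq> W"
  shows "tmap f id t \<in> subtensor W UNIV"
  using assms(1)
proof (induction rule: subtensor_induct)
  case zero
  then show ?case
    by (simp add: clinear_0[OF clinear_tmap] assms(2) clinear_id subtensor_def cvs.span_zero)
next
  case (step c v w s)
  then have "f v \<otimes> w \<in> subtensor W UNIV"
    unfolding subtensor_def using assms(3) by (intro cvs.span_base) blast
  with step show ?case
    by (simp add: clinear_add[OF clinear_tmap] clinear_scale[OF clinear_tmap] assms(2) clinear_id
        tmap_tensor subtensor_def cvs.span_add cvs.span_scale)
qed

text \<open>The map x - \<open>proj n e x\<close> is a morphism that sends U into the complement and
  fixes the complement; applied to the first leg of \<delta>(x) it changes nothing.\<close>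

lemma invariant_complement:
  assumes e: "orthonormal_basis W ip n e" and W: "invariant \<delta> W" and U: "invariant \<delta> U" "W \<subseteq> U"
  shows "invariant \<delta> {x \<in> U. proj n e x = 0}"
  unfolding invariant_def
proof (intro conjI ballI)
  let ?W' = "{x \<in> U. proj n e x = 0}"
  have sub: "csubspace U" using U by (simp add: invariant_def)
  show "csubspace ?W'"
    using sub by (intro cvs.subspaceI)
      (auto simp: cvs.subspace_0 cvs.subspace_add cvs.subspace_scale clinear_0[OF clinear_proj]
        clinear_add[OF clinear_proj] clinear_scale[OF clinear_proj])
  fix x assume x: "x \<in> ?W'"
  have lin: "clinear (\<lambda>x. x - proj n e x)" by (intro clinear_diff_fun clinear_id clinear_proj)
  have "tmap (\<lambda>x. x - proj n e x) id (\<delta> x) = tmap id id (\<delta> x) - tmap (proj n e) id (\<delta> x)"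
    by (simp add: tmap_def tensor_diff_left tlift_fun_diff)
  then have "\<delta> x = tmap (\<lambda>x. x - proj n e x) id (\<delta> x)"
    using x by (simp add: tmap_ident proj_morphism[OF e W] clinear_0[OF clinear_corep])
  moreover have "tmap (\<lambda>x. x - proj n e x) id (\<delta> x) \<in> subtensor ?W' UNIV"
  proof (rule tmap_subtensor[OF _ lin])
    show "\<delta> x \<in> subtensor U UNIV" using x U by (simp add: invariant_def)
    show "(\<lambda>x. x - proj n e x) ` U \<subseteq> ?W'"
      using proj_in[OF e] U(2) sub
      by (auto simp: clinear_diff[OF clinear_proj] proj_ident[OF e] cvs.subspace_diff subset_iff)
  qed
  ultimately show "\<delta> x \<in> subtensor ?W' UNIV" by simp
qed

end

subsection \<open>Frames for arbitrary corepresentations\<close>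

lemma sum_lessThan_add: "(\<Sum>k<a + b. f k) = (\<Sum>k<a. f k) + (\<Sum>k<b. f (a + k))"
  for a b :: nat and f :: "nat \<Rightarrow> 'a::comm_monoid_add"
  by (induction b) (simp_all add: add.assoc)

lemma tassoc_tmap:
  assumes "clinear f"
  shows "tassoc (tmap (tmap f id) id u) = tmap f id (tassoc u)"
proof (induction u rule: tensor_induct)
  case (pure s c)
  show ?case
  proof (induction s rule: tensor_induct)
    case (pure a b)
    then show ?case
      by (simp add: tmap_tensor clinear_tmap assms clinear_id tassoc_tensor)
  next
    case (add s t)
    then show ?case
      by (simp only: tensor_add_left clinear_add[OF clinear_tassoc]
          clinear_add[OF clinear_tmap[OF clinear_tmap[OF assms clinear_id(2)] clinear_id(2)]]
          clinear_add[OF clinear_tmap[OF assms clinear_id(2)]])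
  qed
next
  case (add s t)
  then show ?case
    by (simp only: clinear_add[OF clinear_tassoc]
        clinear_add[OF clinear_tmap[OF clinear_tmap[OF assms clinear_id(2)] clinear_id(2)]]
        clinear_add[OF clinear_tmap[OF assms clinear_id(2)]])
qed

context unitary_corep
begin

text \<open>The parameter \<open>p\<close> is the endomorphism that the family reproduces: the
  identity for a full frame, an orthogonal projection for a summand. Projections onto orthogonal
  summands add, and so do the sums over \<open>k\<close>.\<close>

definition frame ::
    "('p::star_algebra \<Rightarrow> ('p, 'h) tensor) \<Rightarrow> ('v \<Rightarrow> 'v) \<Rightarrow> nat \<Rightarrow> (nat \<Rightarrow> 'v \<Rightarrow> 'p) \<Rightarrow> bool" where
  "frame \<Delta>P p d T \<longleftrightarrow> (\<forall>k<d. T k \<in> Mor UNIV \<delta> UNIV \<Delta>P) \<and>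
     (\<forall>x y. (\<Sum>k<d. star (T k x) * T k y) = ip x (p y) *\<^sub>C 1)"

lemma frame_append:
  assumes "frame \<Delta>P p d T" "frame \<Delta>P p' d' T'"
  shows "frame \<Delta>P (\<lambda>x. p x + p' x) (d + d') (\<lambda>k. if k < d then T k else T' (k - d))"
  using assms by (auto simp: frame_def sum_lessThan_add ip_add_right cscale_add_left)

section \<open>Transport of an invariant subspace to finitely supported sequences\<close>

context
  fixes U :: "'v set" and n :: nat and e :: "nat \<Rightarrow> 'v"
  assumes onb: "orthonormal_basis U ip n e" and U: "invariant \<delta> U"
begin

text \<open>A formula cannot quantify over types, so \<open>has_left_frames\<close> speaks of
  subspaces of \<open>nat \<Rightarrow>\<^sub>0 complex\<close>; coordinates carry U there. On all
  of 'v this map kills the orthogonal complement of U, so \<open>from_seq\<close> after it is the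
  projection.\<close>

definition to_seq :: "'v \<Rightarrow> nat \<Rightarrow>\<^sub>0 complex" where
  "to_seq x = (\<Sum>i<n. ip (e i) x *\<^sub>C gen i)"

definition from_seq :: "(nat \<Rightarrow>\<^sub>0 complex) \<Rightarrow> 'v" where
  "from_seq q = (\<Sum>i<n. Poly_Mapping.lookup q i *\<^sub>C e i)"

abbreviation seq_space :: "(nat \<Rightarrow>\<^sub>0 complex) set" where
  "seq_space \<equiv> cspan (gen ` {..<n})"

definition seq_corep :: "(nat \<Rightarrow>\<^sub>0 complex) \<Rightarrow> (nat \<Rightarrow>\<^sub>0 complex, 'h) tensor" where
  "seq_corep q = tmap to_seq id (\<delta> (from_seq q))"

definition seq_ip :: "(nat \<Rightarrow>\<^sub>0 complex) \<Rightarrow> (nat \<Rightarrow>\<^sub>0 complex) \<Rightarrow> complex" where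
  "seq_ip p q = ip (from_seq p) (from_seq q)"

lemma clinear_to_seq: "clinear to_seq"
  by (intro clinearI)
    (simp_all add: to_seq_def ip_add_right ip_scale_right cscale_add_left sum.distrib
      cvs.scale_sum_right cscale_cscale)

lemma clinear_from_seq: "clinear from_seq"
  by (intro clinearI)
    (simp_all add: from_seq_def lookup_add cscale_add_left sum.distrib
      cvs.scale_sum_right cscale_cscale cscale_complex_def)

lemma from_seq_gen: "j < n \<Longrightarrow> from_seq (gen j) = e j"
proof -
  assume "j < n"
  have "from_seq (gen j) = (\<Sum>i<n. if i = j then e j else 0)"
    unfolding from_seq_def by (intro sum.cong) (auto simp: lookup_single cscale_one)
  with \<open>j < n\<close> show ?thesis by simp
qed

lemma to_seq_onb: "j < n \<Longrightarrow> to_seq (e j) = gen j"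
proof -
  assume "j < n"
  have "to_seq (e j) = (\<Sum>i<n. if i = j then gen j else 0)"
    unfolding to_seq_def using \<open>j < n\<close> by (intro sum.cong) (auto simp: ip_onb[OF onb] cscale_one)
  with \<open>j < n\<close> show ?thesis by simp
qed

lemma from_to_seq: "from_seq (to_seq x) = proj n e x"
  by (simp add: to_seq_def clinear_sum[OF clinear_from_seq] clinear_scale[OF clinear_from_seq]
      from_seq_gen proj_def)

lemma to_seq_proj: "to_seq (proj n e x) = to_seq x"
  by (simp add: proj_def clinear_sum[OF clinear_to_seq] clinear_scale[OF clinear_to_seq] to_seq_onb)
    (simp add: to_seq_def)

lemma to_from_seq:
  assumes "q \<in> seq_space"
  shows "to_seq (from_seq q) = q"
  using assms
  by (induction rule: cvs.span_induct_alt)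
    (auto simp: clinear_0[OF clinear_from_seq] clinear_0[OF clinear_to_seq]
      clinear_add[OF clinear_from_seq] clinear_add[OF clinear_to_seq]
      clinear_scale[OF clinear_from_seq] clinear_scale[OF clinear_to_seq] from_seq_gen to_seq_onb)

lemma to_seq_in: "to_seq x \<in> seq_space"
  unfolding to_seq_def by (intro cvs.span_sum cvs.span_scale cvs.span_base) simp

lemma from_seq_in: "from_seq q \<in> U"
  unfolding from_seq_def using onb_subspace[OF onb]
  by (intro cvs.subspace_sum cvs.subspace_scale) (simp_all add: onb_in[OF onb])

lemma clinear_seq_corep: "clinear seq_corep"
  unfolding seq_corep_def[abs_def]
  by (rule clinear_comp[OF clinear_tmap[OF clinear_to_seq clinear_id(2)]
        clinear_comp[OF clinear_corep clinear_from_seq]])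

text \<open>By \<open>proj_morphism\<close> the part of x orthogonal to U does not contribute. Hence
  \<open>to_seq\<close> intertwines the coactions on all of 'v, and morphisms out of sequences pull
  back to morphisms out of \<delta>.\<close>

lemma seq_corep_to_seq: "seq_corep (to_seq x) = tmap to_seq id (\<delta> x)"
proof -
  have "seq_corep (to_seq x) = tmap to_seq id (tmap (proj n e) id (\<delta> x))"
    by (simp add: seq_corep_def from_to_seq proj_morphism[OF onb U])
  then show ?thesis
    by (simp add: tmap_tmap clinear_proj clinear_to_seq clinear_id to_seq_proj id_def)
qed

lemma corepresentation_seq: "corepresentation \<Delta> \<epsilon> seq_space seq_corep"
  unfolding corepresentation_def
proof (intro conjI ballI cvs.subspace_span clinear_seq_corep)
  fix q assume q: "q \<in> seq_space"
  show "seq_corep q \<in> subtensor seq_space UNIV"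
    unfolding seq_corep_def using to_seq_in
    by (intro tmap_in_subtensor clinear_to_seq clinear_id) auto
  have b: "cbilinear (\<lambda>w h. \<epsilon> h *\<^sub>C (w :: nat \<Rightarrow>\<^sub>0 complex))"
    by (intro cbilinearI)
      (simp_all add: hopf_linear cscale_add_left cscale_add_right cscale_cscale cscale_complex_def mult.commute)
  have "tlift (\<lambda>w h. \<epsilon> h *\<^sub>C w) (seq_corep q) = to_seq (tlift (\<lambda>w h. \<epsilon> h *\<^sub>C w) (\<delta> (from_seq q)))"
    by (simp add: seq_corep_def tlift_tmap[OF b] clinear_to_seq clinear_id
        tlift_fun_comp[OF clinear_to_seq] clinear_scale[OF clinear_to_seq])
  then show "tlift (\<lambda>w h. \<epsilon> h *\<^sub>C w) (seq_corep q) = q"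
    by (simp add: corep_counit to_from_seq q)
  have "tmap seq_corep id (seq_corep q) =
      tmap (\<lambda>x. seq_corep (to_seq x)) id (\<delta> (from_seq q))"
    by (simp add: seq_corep_def[of q] tmap_tmap clinear_seq_corep clinear_to_seq clinear_id) (simp add: id_def)
  also have "\<dots> = tmap (tmap to_seq id) id (tmap \<delta> id (\<delta> (from_seq q)))"
    by (simp add: seq_corep_to_seq tmap_tmap clinear_tmap clinear_to_seq clinear_corep clinear_id) (simp add: id_def)
  finally have "tassoc (tmap seq_corep id (seq_corep q)) = tmap to_seq id (tmap id \<Delta> (\<delta> (from_seq q)))"
    by (simp add: tassoc_tmap clinear_to_seq corep_coassoc)
  also have "\<dots> = tmap id \<Delta> (seq_corep q)"
    by (simp add: seq_corep_def tmap_tmap clinear_to_seq clinear_id clinear_comult)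
  finally show "tassoc (tmap seq_corep id (seq_corep q)) = tmap id \<Delta> (seq_corep q)" .
qed

lemma inner_product_seq: "inner_product_on seq_space seq_ip"
  unfolding inner_product_on_def
proof (intro conjI ballI allI impI)
  fix p q assume "p \<in> seq_space" "q \<in> seq_space"
  show "seq_ip q p = cnj (seq_ip p q)" by (simp add: seq_ip_def ip_cnj)
next
  fix p assume "p \<in> seq_space" "p \<noteq> 0"
  then have "from_seq p \<noteq> 0" using to_from_seq[of p] clinear_0[OF clinear_to_seq] by auto
  then show "Re (seq_ip p p) > 0" unfolding seq_ip_def by (rule ip_pos)
qed (simp_all add: seq_ip_def clinear_add[OF clinear_from_seq] clinear_scale[OF clinear_from_seq]
    ip_add_right ip_scale_right)

lemma image_from_seq: "from_seq ` seq_space = U"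
proof -
  have "from_seq ` gen ` {..<n} = e ` {..<n}"
    unfolding image_image by (intro image_cong) (simp_all add: from_seq_gen)
  then have "from_seq ` seq_space = cspan (e ` {..<n})"
    by (simp add: cvp.linear_span_image[OF clinear_from_seq, symmetric])
  then show ?thesis using onb by (simp add: orthonormal_basis_def)
qed

text \<open>The condition ranges over all orthonormal bases of the sequence space.
  \<open>from_seq\<close> carries each to an orthonormal basis of U, where
  \<open>unitary_coeff\<close> applies.\<close>

lemma unitary_seq: "unitary_corepresentation \<Delta> \<epsilon> seq_space seq_corep seq_ip"
  unfolding unitary_corepresentation_def
proof (intro conjI allI impI corepresentation_seq inner_product_seq)
  show "\<exists>A. finite A \<and> cspan A = seq_space" by (intro exI[of _ "gen ` {..<n}"]) simp
  fix m f assume f: "orthonormal_basis seq_space seq_ip m f"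
  have f_in: "f j \<in> seq_space" if "j < m" for j
    using f that cvs.span_base[of "f j" "f ` {..<m}"] by (auto simp: orthonormal_basis_def)
  let ?g = "\<lambda>i. from_seq (f i)"
  have "cspan (?g ` {..<m}) = from_seq ` cspan (f ` {..<m})"
    by (simp add: cvp.linear_span_image[OF clinear_from_seq, symmetric] image_image)
  then have g: "orthonormal_basis U ip m ?g"
    using f by (simp add: orthonormal_basis_def image_from_seq seq_ip_def)
  have inv: "\<delta> (?g j) \<in> subtensor U UNIV" for j
    using U from_seq_in by (simp add: invariant_def)
  let ?u = "\<lambda>i j. coeff (?g i) (?g j)"
  have "seq_corep (f j) = (\<Sum>i<m. f i \<otimes> ?u i j)" for j
    unfolding seq_corep_def corep_expand[OF g inv]
    by (simp add: clinear_sum[OF clinear_tmap[OF clinear_to_seq clinear_id(2)]]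
        tmap_tensor[OF clinear_to_seq clinear_id(2)] to_from_seq f_in)
  moreover have "(\<Sum>k<m. star (?u k i) * ?u k j) = (if i = j then 1 else 0)"
    "(\<Sum>k<m. ?u i k * star (?u j k)) = (if i = j then 1 else 0)" if "i < m" "j < m" for i j
    using unitary_coeff[OF g inv, of "?g i" j] ip_onb[OF g that] by (simp_all add: cscale_one)
  ultimately show "\<exists>u. (\<forall>j<m. seq_corep (f j) = (\<Sum>i<m. f i \<otimes> u i j)) \<and>
      (\<forall>i<m. \<forall>j<m. (\<Sum>k<m. star (u k i) * u k j) = (if i = j then 1 else 0) \<and>
        (\<Sum>k<m. u i k * star (u j k)) = (if i = j then 1 else 0))"
    by (intro exI[of _ ?u]) simp
qed

text \<open>\<open>from_seq\<close> sends an invariant subspace of sequences to one of U, and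
  \<open>to_seq\<close> recovers it.\<close>

lemma irreducible_seq:
  assumes irr: "irreducible_corepresentation U \<delta>"
  shows "irreducible_corepresentation seq_space seq_corep"
  unfolding irreducible_corepresentation_def
proof (intro conjI allI impI)
  show "seq_space \<noteq> {0}"
    using irr image_from_seq clinear_0[OF clinear_from_seq]
    by (auto simp: irreducible_corepresentation_def)
  fix W assume W: "csubspace W \<and> W \<subseteq> seq_space \<and> (\<forall>x\<in>W. seq_corep x \<in> subtensor W UNIV)"
  have "\<delta> (from_seq w) \<in> subtensor (from_seq ` W) UNIV" if "w \<in> W" for w
  proof -
    have "tmap from_seq id (seq_corep w) = tmap (proj n e) id (\<delta> (from_seq w))"
      by (simp add: seq_corep_def tmap_tmap clinear_from_seq clinear_to_seq clinear_id from_to_seq id_def)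
    also have "\<dots> = \<delta> (from_seq w)"
      by (simp add: proj_morphism[OF onb U] proj_ident[OF onb from_seq_in])
    finally show ?thesis
      using tmap_subtensor[of "seq_corep w" W from_seq "from_seq ` W"] W that clinear_from_seq by simp
  qed
  moreover have "csubspace (from_seq ` W)"
    using W by (intro cvp.linear_subspace_image[OF clinear_from_seq]) simp
  moreover have "from_seq ` W \<subseteq> U" using from_seq_in by blast
  ultimately have "from_seq ` W = {0} \<or> from_seq ` W = U"
    using irr unfolding irreducible_corepresentation_def by blast
  moreover have "to_seq ` from_seq ` A = A" if "A \<subseteq> seq_space" for A
    using that to_from_seq by force
  ultimately show "W = {0} \<or> W = seq_space"
    using W image_from_seq clinear_0[OF clinear_to_seq]
    by (metis image_empty image_insert subset_refl)
qed

text \<open>The given maps are composed with \<open>to_seq\<close>, which discards the complement of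
  U; this is why the projection appears in place of the identity. Values on basis vectors extend
  sesquilinearly.\<close>

lemma frame_irreducible:
  assumes frames: "has_left_frames \<Delta> \<epsilon> \<Delta>P" and irr: "irreducible_corepresentation U \<delta>"
  shows "\<exists>d T. frame \<Delta>P (proj n e) d T"
proof -
  have gen: "orthonormal_basis seq_space seq_ip n gen"
    by (auto simp: orthonormal_basis_def seq_ip_def from_seq_gen ip_onb[OF onb])
  have "\<exists>(d::nat) T. (\<forall>k<d. T k \<in> Mor seq_space seq_corep UNIV \<Delta>P) \<and>
      (\<forall>i<n. \<forall>j<n. (\<Sum>k<d. star (T k (gen i)) * T k (gen j)) = (if i = j then 1 else 0))"
    by (rule frames[unfolded has_left_frames_def, THEN spec, THEN spec, THEN spec, THEN spec,
          THEN spec, THEN mp, OF conjI[OF unitary_seq conjI[OF irreducible_seq[OF irr] gen]]])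
  then obtain d :: nat and T where T: "\<And>k. k < d \<Longrightarrow> T k \<in> Mor seq_space seq_corep UNIV \<Delta>P"
    and sum: "\<And>i j. i < n \<Longrightarrow> j < n \<Longrightarrow> (\<Sum>k<d. star (T k (gen i)) * T k (gen j)) = (if i = j then 1 else 0)"
    by blast
  have T_lin: "clinear (T k)" if "k < d" for k using T[OF that] by (simp add: Mor_def)
  have "(\<lambda>x. T k (to_seq x)) \<in> Mor UNIV \<delta> UNIV \<Delta>P" if "k < d" for k
  proof -
    have "\<Delta>P (T k (to_seq x)) = tmap (T k) id (seq_corep (to_seq x))" for x
      using T[OF that] to_seq_in by (simp add: Mor_def)
    then show ?thesis
      using clinear_comp[OF T_lin[OF that] clinear_to_seq]
      by (simp add: Mor_def seq_corep_to_seq tmap_tmap T_lin[OF that] clinear_to_seq clinear_id id_def)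
  qed
  moreover have "(\<Sum>k<d. star (T k (to_seq x)) * T k (to_seq y)) = ip x (proj n e y) *\<^sub>C 1" for x y
  proof -
    have T_seq: "T k (to_seq z) = (\<Sum>i<n. ip (e i) z *\<^sub>C T k (gen i))" if "k < d" for k z
      by (simp add: to_seq_def clinear_sum[OF T_lin[OF that]] clinear_scale[OF T_lin[OF that]])
    have "(\<Sum>k<d. star (T k (to_seq x)) * T k (to_seq y)) =
        (\<Sum>k<d. \<Sum>i<n. \<Sum>j<n. (ip x (e i) * ip (e j) y) *\<^sub>C (star (T k (gen i)) * T k (gen j)))"
      by (intro sum.cong refl)
        (simp add: T_seq star_sum star_cscale ip_cnj sum_product cscale_mult_left cscale_mult_right
          cscale_cscale mult.commute[of "ip _ y"])
    also have "\<dots> = (\<Sum>i<n. \<Sum>k<d. \<Sum>j<n. (ip x (e i) * ip (e j) y) *\<^sub>C (star (T k (gen i)) * T k (gen j)))"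
      by (rule sum.swap)
    also have "\<dots> = (\<Sum>i<n. \<Sum>j<n. (ip x (e i) * ip (e j) y) *\<^sub>C
        (\<Sum>k<d. star (T k (gen i)) * T k (gen j)))"
      unfolding cvs.scale_sum_right by (intro sum.cong refl sum.swap)
    also have "\<dots> = (\<Sum>i<n. \<Sum>j<n. if j = i then (ip x (e i) * ip (e i) y) *\<^sub>C 1 else 0)"
      by (intro sum.cong refl) (auto simp: sum)
    also have "\<dots> = ip x (proj n e y) *\<^sub>C 1"
      by (simp add: proj_def ip_sum_right ip_scale_right cvs.scale_sum_left mult.commute)
    finally show ?thesis .
  qed
  ultimately have "frame \<Delta>P (proj n e) d (\<lambda>k x. T k (to_seq x))" by (simp add: frame_def)
  then show ?thesis by blast
qed

end

section \<open>Orthogonal splitting and induction on the dimension\<close>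

lemma onb_append:
  assumes U: "csubspace U" and W: "W \<subseteq> U" and g: "orthonormal_basis W ip m g"
    and g': "orthonormal_basis {x \<in> U. proj m g x = 0} ip m' g'"
  defines "h \<equiv> \<lambda>i. if i < m then g i else g' (i - m)"
  shows "orthonormal_basis U ip (m + m') h" "proj (m + m') h x = proj m g x + proj m' g' x"
proof -
  have g'_in: "g' j \<in> U" "proj m g (g' j) = 0" if "j < m'" for j
    using onb_in[OF g' that] by auto
  have ortho: "ip (g i) (g' j) = 0" "ip (g' j) (g i) = 0" if "i < m" "j < m'" for i j
  proof -
    show "ip (g i) (g' j) = 0" using ip_proj[OF g that(1), of "g' j"] g'_in(2)[OF that(2)] by simp
    then show "ip (g' j) (g i) = 0" using ip_cnj[of "g i" "g' j"] by simp
  qed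
  show proj_h: "proj (m + m') h x = proj m g x + proj m' g' x" for x
    by (simp add: proj_def h_def sum_lessThan_add)
  have h_in: "h i \<in> U" if "i < m + m'" for i
    using that g'_in W onb_in[OF g] by (auto simp: h_def)
  have "x \<in> cspan (h ` {..<m + m'})" if x: "x \<in> U" for x
  proof -
    have "proj m g x \<in> U" using proj_in[OF g] W by blast
    then have "x - proj m g x \<in> {x \<in> U. proj m g x = 0}"
      using x U by (simp add: cvs.subspace_diff clinear_diff[OF clinear_proj] proj_ident[OF g] proj_in[OF g])
    then have "proj m' g' (x - proj m g x) = x - proj m g x" by (rule proj_ident[OF g'])
    moreover have "ip (g' j) (proj m g x) = 0" if "j < m'" for j
      unfolding proj_def ip_sum_right by (rule sum.neutral) (simp add: ip_scale_right ortho that)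
    then have "proj m' g' (proj m g x) = 0" unfolding proj_def[of m' g'] by simp
    ultimately have "x = proj (m + m') h x"
      by (simp add: proj_h clinear_diff[OF clinear_proj])
    moreover have "proj (m + m') h x \<in> cspan (h ` {..<m + m'})"
      unfolding proj_def by (intro cvs.span_sum cvs.span_scale cvs.span_base) simp
    ultimately show ?thesis by simp
  qed
  moreover have "cspan (h ` {..<m + m'}) \<subseteq> U"
    using h_in U by (intro cvs.span_minimal) auto
  moreover have "ip (h i) (h j) = (if i = j then 1 else 0)" if "i < m + m'" "j < m + m'" for i j
    using that ip_onb[OF g, of i j] ip_onb[OF g', of "i - m" "j - m"] ortho
    by (auto simp: h_def)
  ultimately show "orthonormal_basis U ip (m + m') h"
    unfolding orthonormal_basis_def by blast
qed

text \<open>A subspace that is neither zero nor irreducible splits into two of smaller dimension.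
  The basis belongs to the conclusion because each projection is expressed by the basis that the
  induction hypothesis selects.\<close>

lemma ex_frame_invariant:
  assumes frames: "has_left_frames \<Delta> \<epsilon> \<Delta>P"
  shows "invariant \<delta> U \<Longrightarrow>
    \<exists>n e d T. orthonormal_basis U ip n e \<and> frame \<Delta>P (proj n e) d T"
proof (induction "cvs.dim U" arbitrary: U rule: less_induct)
  case less
  note U = less.prems
  have subU: "csubspace U" using U by (simp add: invariant_def)
  consider "U = {0}" | "irreducible_corepresentation U \<delta>"
    | W where "invariant \<delta> W" "W \<subseteq> U" "W \<noteq> {0}" "W \<noteq> U"
    unfolding irreducible_corepresentation_def invariant_def by blast
  then show ?case
  proof cases
    case 1
    have "orthonormal_basis U ip 0 (\<lambda>_. 0)" "frame \<Delta>P (proj 0 (\<lambda>_. 0)) 0 (\<lambda>_ _. 0)"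
      by (simp_all add: orthonormal_basis_def frame_def proj_def 1)
    then show ?thesis by blast
  next
    case 2
    obtain n e where e: "orthonormal_basis U ip n e" using ex_onb[OF subU] by blast
    with frame_irreducible[OF e U frames 2] show ?thesis by blast
  next
    case (3 W)
    \<comment> \<open>The basis stays a parameter: one basis of W only shows that W is smaller than
      U, whereas the complement actually used is formed with the basis returned by the induction
      hypothesis for W.\<close>
    define C where "C m g = {x \<in> U. proj m g x = 0}" for m g
    have dims: "cvs.dim W < cvs.dim U" "cvs.dim (C m g) < cvs.dim U"
      if g: "orthonormal_basis W ip m g" and g': "orthonormal_basis (C m g) ip m' g'" for m g m' g'
    proof -
      have "cvs.dim U = m + m'"
        using onb_dim[OF onb_append(1)[OF subU 3(2) g g'[unfolded C_def]]] .
      moreover have "m \<noteq> 0" using g 3(3) by (auto simp: orthonormal_basis_def)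
      moreover have "m' \<noteq> 0"
      proof
        assume "m' = 0"
        then have C0: "C m g = {0}" using g' by (simp add: orthonormal_basis_def)
        obtain x where x: "x \<in> U" "x \<notin> W" using 3(2,4) by blast
        have pW: "proj m g x \<in> W" by (rule proj_in[OF g])
        then have "x - proj m g x \<in> C m g"
          using x 3(2) subU
          by (auto simp: C_def cvs.subspace_diff clinear_diff[OF clinear_proj] proj_ident[OF g])
        then have "x = proj m g x" unfolding C0 by simp
        with pW x show False by simp
      qed
      ultimately show "cvs.dim W < cvs.dim U" "cvs.dim (C m g) < cvs.dim U"
        by (simp_all add: onb_dim[OF g] onb_dim[OF g'])
    qed
    have C: "invariant \<delta> (C m g)" if "orthonormal_basis W ip m g" for m g
      unfolding C_def by (rule invariant_complement[OF that 3(1) U 3(2)])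
    have ex_C: "\<exists>m' g'. orthonormal_basis (C m g) ip m' g'" if "orthonormal_basis W ip m g" for m g
      using C[OF that] ex_onb by (simp add: invariant_def)
    obtain m0 g0 where g0: "orthonormal_basis W ip m0 g0"
      using ex_onb 3(1) unfolding invariant_def by blast
    with ex_C[OF g0] have "cvs.dim W < cvs.dim U" using dims(1) by blast
    from less.hyps[OF this 3(1)]
    obtain m g d T where g: "orthonormal_basis W ip m g" "frame \<Delta>P (proj m g) d T" by blast
    have "cvs.dim (C m g) < cvs.dim U" using ex_C[OF g(1)] dims(2)[OF g(1)] by blast
    from less.hyps[OF this C[OF g(1)]]
    obtain m' g' d' T' where g': "orthonormal_basis (C m g) ip m' g'" "frame \<Delta>P (proj m' g') d' T'"
      by blast
    note app = onb_append[OF subU 3(2) g(1) g'(1)[unfolded C_def]]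
    have "frame \<Delta>P (proj (m + m') (\<lambda>i. if i < m then g i else g' (i - m))) (d + d')
        (\<lambda>k. if k < d then T k else T' (k - d))"
      using frame_append[OF g(2) g'(2)] by (simp add: app(2)[abs_def])
    with app(1) show ?thesis by blast
  qed
qed

lemma ex_frame:
  assumes frames: "has_left_frames \<Delta> \<epsilon> \<Delta>P"
  obtains d :: nat and T where "\<And>k. k < d \<Longrightarrow> T k \<in> Mor UNIV \<delta> UNIV \<Delta>P"
    "\<And>x y. (\<Sum>k<d. star (T k x) * T k y) = ip x y *\<^sub>C 1"
proof -
  have "invariant \<delta> UNIV" by (simp add: invariant_def corep_in)
  from ex_frame_invariant[OF frames this]
  obtain n e d T where "orthonormal_basis UNIV ip n e" "frame \<Delta>P (proj n e) d T" by blast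
  then show thesis using that[of d T] by (simp add: frame_def proj_ident)
qed

end

section \<open>The exterior covariant derivative\<close>

text \<open>Turns a support condition into membership in a span, so that span induction reduces to
  pure generators.\<close>

lemma cspan_gen_iff: "p \<in> cspan (gen ` K) \<longleftrightarrow> Poly_Mapping.keys p \<subseteq> K"
proof
  assume "p \<in> cspan (gen ` K)"
  then show "Poly_Mapping.keys p \<subseteq> K"
  proof (induction rule: cvs.span_induct_alt)
    case (step c x y)
    then show ?case
      by (auto simp: in_keys_iff lookup_add cscale_complex_def lookup_single when_def subset_iff
          split: if_splits)
  qed simp
next
  assume "Poly_Mapping.keys p \<subseteq> K"
  then show "p \<in> cspan (gen ` K)"
    by (subst poly_mapping_sum_gen) (intro cvs.span_sum cvs.span_scale cvs.span_base, blast)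
qed

lemma lin_ext_0: "lin_ext f 0 = 0"
  by (simp add: lin_ext_def)

lemma lin_ext_sum: "lin_ext f (\<Sum>i\<in>A. g i) = (\<Sum>i\<in>A. lin_ext f (g i))"
  by (rule clinear_sum[OF clinear_lin_ext])

lemmas lin_ext_simps = lin_ext_0 lin_ext_add lin_ext_diff lin_ext_cscale lin_ext_sum lin_ext_gen

lemma sum_fun_apply: "(\<Sum>i\<in>A. f i) v = (\<Sum>i\<in>A. f i v :: 'b::ab_group_add)"
  by (induction A rule: infinite_finite_induct) simp_all

lemma cscale_fun_apply: "(c *\<^sub>C f) v = c *\<^sub>C f v"
  by (simp add: cscale_fun_def)

section \<open>Horizontal morphisms and sections of the associated bundle\<close>

locale associated_bundle = qpb_connection Z \<omega> +
    unitary_corep "comult Z" "counit Z" "antipode Z" ip \<delta>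
  for Z :: "('h::star_algebra, 'p::star_algebra, 'g::involutive_space,
      'e::involutive_algebra, 'o::involutive_algebra) qpb_calculus"
    and \<omega> :: "'g \<Rightarrow> 'o" and ip :: "'v::complex_space \<Rightarrow> 'v \<Rightarrow> complex"
    and \<delta> :: "'v \<Rightarrow> ('v, 'h) tensor" +
  assumes frames: "has_left_frames (comult Z) (counit Z) (coact Z)"
begin

abbreviation hor_mor :: "('v \<Rightarrow> 'o) set" where
  "hor_mor \<equiv> Mor UNIV \<delta> (Hor Z) (coact_Hor Z)"

lemma assoc_bundle_iff:
  "T \<in> assoc_bundle Z \<delta> \<longleftrightarrow> clinear T \<and> (\<forall>v. coact Z (T v) = tmap T id (\<delta> v))"
  by (auto simp: assoc_bundle_def Mor_def)

lemma hor_mor_linear: "\<tau> \<in> hor_mor \<Longrightarrow> clinear \<tau>" and hor_mor_Hor: "\<tau> \<in> hor_mor \<Longrightarrow> \<tau> v \<in> Hor Z"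
  by (auto simp: Mor_def)

lemma subspace_hor_mor: "csubspace hor_mor"
proof (rule cvs.subspaceI)
  show "0 \<in> hor_mor"
    by (simp add: Mor_Hor_iff tmap_def clinearI clinear_0[OF clinear_ocoact])
  show "\<tau> + \<sigma> \<in> hor_mor" if "\<tau> \<in> hor_mor" "\<sigma> \<in> hor_mor" for \<tau> \<sigma>
    using that clinear_add_fun[of \<tau> \<sigma>]
    by (simp add: Mor_Hor_iff tmap_def form_linear linear_simps plus_fun_def)
  show "c *\<^sub>C \<tau> \<in> hor_mor" if "\<tau> \<in> hor_mor" for c \<tau>
    using that clinear_cscale_fun[of \<tau> c]
    by (simp add: Mor_Hor_iff tmap_def form_linear linear_simps cscale_fun_def)
qed

lemma mult_hor_mor:
  assumes "\<mu> \<in> base_forms Z" "\<tau> \<in> hor_mor"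
  shows "(\<lambda>v. \<mu> * \<tau> v) \<in> hor_mor"
  using assms clinear_comp[OF cbilinearD(2)[OF cbilinear_mult] hor_mor_linear[OF assms(2)], of \<mu>]
  by (simp add: Mor_Hor_iff ocoact_mult base_forms_def gtmult_tensor_1)

lemma pinc_hor_mor:
  assumes "T \<in> assoc_bundle Z \<delta>"
  shows "(\<lambda>v. pinc Z (T v)) \<in> hor_mor"
  using assms
  by (simp add: Mor_Hor_iff assoc_bundle_iff ocoact_pinc tmap_tmap clinear_comp clinear_pinc
      clinear_einc0 clinear_id)

text \<open>Covariance in degree 0, composed with T. It places the argument of
  \<open>Upsilon\<close> in \<open>linear_connection\<close> inside the domain.\<close>

lemma cov_deriv_pinc_hor_mor:
  assumes "T \<in> assoc_bundle Z \<delta>"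
  shows "(\<lambda>v. cov_deriv Z \<omega> (pinc Z (T v))) \<in> hor_mor"
proof -
  have T: "clinear T" "coact Z (T v) = tmap T id (\<delta> v)" for v
    using assms by (auto simp: assoc_bundle_iff)
  show ?thesis
    by (simp add: Mor_Hor_iff ocoact_cov_deriv_pinc T(2) tmap_tmap T(1) clinear_cov_deriv_pinc
        clinear_einc0 clinear_id clinear_comp[OF clinear_cov_deriv_pinc T(1)])
qed

lemma assoc_bundle_add:
  "T \<in> assoc_bundle Z \<delta> \<Longrightarrow> U \<in> assoc_bundle Z \<delta> \<Longrightarrow> T + U \<in> assoc_bundle Z \<delta>"
  using clinear_add_fun[of T U]
  by (simp add: assoc_bundle_iff tmap_def clinear_add[OF coact_linear] linear_simps plus_fun_def)

lemma assoc_bundle_0: "0 \<in> assoc_bundle Z \<delta>"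
  by (simp add: assoc_bundle_iff tmap_def clinearI clinear_0[OF coact_linear])

lemma assoc_bundle_sum:
  "(\<And>i. i \<in> A \<Longrightarrow> U i \<in> assoc_bundle Z \<delta>) \<Longrightarrow> (\<Sum>i\<in>A. U i) \<in> assoc_bundle Z \<delta>"
  by (induction A rule: infinite_finite_induct) (simp_all add: assoc_bundle_0 assoc_bundle_add)

lemma coact_mult: "coact Z (p * q) = tmult (coact Z p) (coact Z q)"
  using bundle_Z by (simp add: quantum_principal_bundle_def star_hom_tensor_def)

lemma assoc_bundle_mult:
  assumes "b \<in> base Z" "T \<in> assoc_bundle Z \<delta>"
  shows "(\<lambda>v. b * T v) \<in> assoc_bundle Z \<delta>"
proof -
  have "coact Z b = b \<otimes> 1" using assms by (simp add: coact_eq_iff)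
  moreover have "tmult (b \<otimes> 1) (tmap T id t) = tmap (\<lambda>v. b * T v) id t"
    for t :: "('v, 'h) tensor"
    unfolding tmap_def tlift_fun_comp[OF cbilinearD(2)[OF cbilinear_tmult]] by (simp add: tmult_tensor)
  ultimately show ?thesis
    using assms clinear_comp[OF cbilinearD(2)[OF cbilinear_mult], of T b]
    by (simp add: assoc_bundle_iff coact_mult)
qed


subsection \<open>The bijection between the tensor product and horizontal morphisms\<close>

abbreviation rels :: "('o, 'p, 'v) bfree set" where
  "rels \<equiv> cspan (btensor_rels Z \<delta>)"

abbreviation free :: "('o, 'p, 'v) bfree set" where
  "free \<equiv> cspan (gen ` (base_forms Z \<times> assoc_bundle Z \<delta>))"

text \<open>\<open>Upsilon_inv\<close> on representatives, where linear algebra and span induction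
  are available.\<close>

definition ev :: "('o, 'p, 'v) bfree \<Rightarrow> 'v \<Rightarrow> 'o" where
  "ev p = lin_ext (\<lambda>(\<mu>, T) v. \<mu> * pinc Z (T v)) p"

lemma btensor_eq: "btensor Z \<delta> = bcoset Z \<delta> ` free"
proof -
  have "free = {p. Poly_Mapping.keys p \<subseteq> base_forms Z \<times> assoc_bundle Z \<delta>}"
    by (rule set_eqI) (simp only: cspan_gen_iff mem_Collect_eq)
  then show ?thesis by (simp only: btensor_def)
qed

lemma gen_free: "\<mu> \<in> base_forms Z \<Longrightarrow> T \<in> assoc_bundle Z \<delta> \<Longrightarrow> gen (\<mu>, T) \<in> free"
  by (rule cvs.span_base, rule imageI) simp

lemma bcoset_eq_iff: "bcoset Z \<delta> p = bcoset Z \<delta> q \<longleftrightarrow> p - q \<in> rels"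
proof
  assume "bcoset Z \<delta> p = bcoset Z \<delta> q"
  moreover have "p \<in> bcoset Z \<delta> p" by (simp add: bcoset_def cvs.span_zero)
  ultimately show "p - q \<in> rels" by (simp add: bcoset_def)
next
  assume pq: "p - q \<in> rels"
  have "r - p \<in> rels \<longleftrightarrow> r - q \<in> rels" for r
    using cvs.span_add[OF _ pq, of "r - p"] cvs.span_diff[OF _ pq, of "r - q"] by auto
  then show "bcoset Z \<delta> p = bcoset Z \<delta> q" by (simp add: bcoset_def)
qed

text \<open>The coset operations are unions over representatives; a union collapses as soon as all
  its members agree.\<close>

lemma bcoset_UN:
  assumes "\<And>x. x - p \<in> rels \<Longrightarrow> bcoset Z \<delta> (f x) = bcoset Z \<delta> (f p)"
  shows "(\<Union>x\<in>bcoset Z \<delta> p. bcoset Z \<delta> (f x)) = bcoset Z \<delta> (f p)"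
proof -
  have "p \<in> bcoset Z \<delta> p" by (simp add: bcoset_def cvs.span_zero)
  moreover have "bcoset Z \<delta> (f x) = bcoset Z \<delta> (f p)" if "x \<in> bcoset Z \<delta> p" for x
    using that by (intro assms) (simp add: bcoset_def)
  ultimately show ?thesis by (metis (no_types, lifting) SUP_eq_const empty_iff)
qed

lemma bscale_bcoset: "bscale Z \<delta> c (bcoset Z \<delta> p) = bcoset Z \<delta> (c *\<^sub>C p)"
  unfolding bscale_def
  by (rule bcoset_UN)
    (unfold bcoset_eq_iff cvs.scale_right_diff_distrib[symmetric], rule cvs.span_scale)

lemma badd_bcoset: "badd Z \<delta> (bcoset Z \<delta> p) (bcoset Z \<delta> q) = bcoset Z \<delta> (p + q)"
proof -
  have "(\<Union>y\<in>bcoset Z \<delta> q. bcoset Z \<delta> (x + y)) = bcoset Z \<delta> (x + q)" for x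
    by (rule bcoset_UN) (simp add: bcoset_eq_iff)
  moreover have "(\<Union>x\<in>bcoset Z \<delta> p. bcoset Z \<delta> (x + q)) = bcoset Z \<delta> (p + q)"
    by (rule bcoset_UN) (simp add: bcoset_eq_iff)
  ultimately show ?thesis by (simp add: badd_def)
qed

abbreviation left_mult :: "'o \<Rightarrow> ('o, 'p, 'v) bfree \<Rightarrow> ('o, 'p, 'v) bfree" where
  "left_mult \<mu> \<equiv> lin_ext (\<lambda>(\<nu>, T). gen (\<mu> * \<nu>, T))"

text \<open>Base forms are closed under products, so each defining relation goes to a relation of
  the same kind.\<close>

lemma left_mult_rels:
  assumes "\<mu> \<in> base_forms Z" "r \<in> rels"
  shows "left_mult \<mu> r \<in> rels"
  using assms(2)
proof (induction rule: cvs.span_induct_alt)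
  case base
  show ?case by (simp add: lin_ext_0 cvs.span_zero)
next
  case (step c x y)
  have "left_mult \<mu> x \<in> btensor_rels Z \<delta>"
    using step(1) unfolding btensor_rels_def
  proof (elim UnE CollectE exE conjE, goal_cases)
    case (1 \<nu> \<nu>' T)
    then have "left_mult \<mu> x = gen (\<mu> * \<nu> + \<mu> * \<nu>', T) - gen (\<mu> * \<nu>, T) - gen (\<mu> * \<nu>', T)"
      by (simp add: lin_ext_simps distrib_left)
    with 1 show ?case using base_forms_mult[OF assms(1)] by blast
  next
    case (2 \<nu> T U)
    then have "left_mult \<mu> x = gen (\<mu> * \<nu>, T + U) - gen (\<mu> * \<nu>, T) - gen (\<mu> * \<nu>, U)"
      by (simp add: lin_ext_simps)
    with 2 show ?case using base_forms_mult[OF assms(1)] by blast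
  next
    case (3 c \<nu> T)
    then have "left_mult \<mu> x = gen (c *\<^sub>C (\<mu> * \<nu>), T) - c *\<^sub>C gen (\<mu> * \<nu>, T)"
      by (simp add: lin_ext_simps cscale_mult_right)
    with 3 show ?case using base_forms_mult[OF assms(1)] by blast
  next
    case (4 \<nu> b T)
    then have "left_mult \<mu> x = gen (\<mu> * \<nu> * pinc Z b, T) - gen (\<mu> * \<nu>, \<lambda>v. b * T v)"
      by (simp add: lin_ext_simps mult.assoc)
    with 4 show ?case using base_forms_mult[OF assms(1)] by blast
  qed
  then show ?case
    using step by (simp add: lin_ext_simps cvs.span_add cvs.span_scale cvs.span_base)
qed

lemma blmult_bcoset:
  assumes "\<mu> \<in> base_forms Z"
  shows "blmult Z \<delta> \<mu> (bcoset Z \<delta> p) = bcoset Z \<delta> (left_mult \<mu> p)"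
  unfolding blmult_def
proof (rule bcoset_UN)
  show "bcoset Z \<delta> (left_mult \<mu> x) = bcoset Z \<delta> (left_mult \<mu> p)" if "x - p \<in> rels" for x
    using left_mult_rels[OF assms that] by (simp only: bcoset_eq_iff lin_ext_diff)
qed

lemma left_mult_free:
  assumes "\<mu> \<in> base_forms Z" "p \<in> free"
  shows "left_mult \<mu> p \<in> free"
  using assms(2)
proof (induction rule: cvs.span_induct_alt)
  case base
  show ?case by (simp add: lin_ext_0 cvs.span_zero)
next
  case (step c x y)
  then show ?case
    using gen_free base_forms_mult[OF assms(1)]
    by (auto simp: lin_ext_simps intro!: cvs.span_add cvs.span_scale)
qed

lemma ev_simps: "ev 0 = 0" "ev (p + q) = ev p + ev q" "ev (p - q) = ev p - ev q"
  "ev (c *\<^sub>C p) = c *\<^sub>C ev p" "ev (\<Sum>i\<in>A. g i) = (\<Sum>i\<in>A. ev (g i))"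
  "ev (gen (\<mu>, T)) = (\<lambda>v. \<mu> * pinc Z (T v))"
  by (simp_all add: ev_def lin_ext_simps)

lemma ev_left_mult: "ev (left_mult \<mu> p) = (\<lambda>v. \<mu> * ev p v)"
proof -
  have "p \<in> cspan (gen ` UNIV)" by (simp add: cspan_gen_iff)
  then show ?thesis
    by (induction rule: cvs.span_induct_alt)
      (auto simp: lin_ext_simps ev_simps cscale_fun_def linear_simps mult.assoc fun_eq_iff)
qed

lemma ev_rels:
  assumes "r \<in> rels"
  shows "ev r = 0"
  using assms
proof (induction rule: cvs.span_induct_alt)
  case (step c x y)
  have "ev x = 0"
    using step(1) unfolding btensor_rels_def
    by (elim UnE CollectE exE conjE)
      (simp_all add: ev_simps fun_eq_iff cscale_fun_def linear_simps form_linear pinc_mult mult.assoc)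
  with step show ?case by (simp add: ev_simps)
qed (simp add: ev_simps)

lemma ev_hor_mor:
  assumes "p \<in> free"
  shows "ev p \<in> hor_mor"
  using assms
proof (induction rule: cvs.span_induct_alt)
  case base
  show ?case using cvs.subspace_0[OF subspace_hor_mor] by (simp only: ev_simps)
next
  case (step c x y)
  then have "ev x \<in> hor_mor" using mult_hor_mor pinc_hor_mor by (auto simp: ev_simps)
  with step show ?case
    unfolding ev_simps by (intro cvs.subspace_add cvs.subspace_scale subspace_hor_mor)
qed

lemma Upsilon_inv_bcoset: "Upsilon_inv Z (bcoset Z \<delta> p) = ev p"
proof -
  have ev: "ev p = ev x" if "x \<in> bcoset Z \<delta> p" for x
    using that ev_rels[of "x - p"] by (simp add: bcoset_def ev_simps)
  have p: "p \<in> bcoset Z \<delta> p" by (simp add: bcoset_def cvs.span_zero)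
  show ?thesis
    unfolding Upsilon_inv_def ev_def[symmetric]
  proof (rule the_equality)
    show "\<forall>x\<in>bcoset Z \<delta> p. ev p = ev x" by (rule ballI) (rule ev)
    show "\<tau> = ev p" if "\<forall>x\<in>bcoset Z \<delta> p. \<tau> = ev x" for \<tau>
      using that p by (rule bspec)
  qed
qed

section \<open>Expansion of horizontal morphisms in a frame\<close>

definition frame_coeff :: "nat \<Rightarrow> (nat \<Rightarrow> 'v) \<Rightarrow> ('v \<Rightarrow> 'p) \<Rightarrow> ('v \<Rightarrow> 'o) \<Rightarrow> 'o" where
  "frame_coeff n e T \<tau> = (\<Sum>i<n. \<tau> (e i) * pinc Z (star (T (e i))))"

text \<open>The second leg of the coaction collects the sums of u_ai star(u_bi) over i. These are
  the entries of u times its adjoint, so only the diagonal terms remain, with second leg 1.\<close>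

lemma frame_coeff_base:
  assumes e: "orthonormal_basis UNIV ip n e" and T: "T \<in> assoc_bundle Z \<delta>" and \<tau>: "\<tau> \<in> hor_mor"
  shows "frame_coeff n e T \<tau> \<in> base_forms Z"
proof -
  let ?u = "\<lambda>i j. coeff (e i) (e j)"
  have T': "clinear T" "coact Z (T v) = tmap T id (\<delta> v)" for v
    using T by (auto simp: assoc_bundle_iff)
  have \<tau>': "clinear \<tau>" "ocoact Z (\<tau> v) = tmap \<tau> (einc0 Z) (\<delta> v)" for v
    using \<tau> by (auto simp: Mor_Hor_iff)
  have \<delta>e: "\<delta> (e i) = (\<Sum>a<n. e a \<otimes> ?u a i)" for i by (rule corep_expand[OF e corep_in])
  have tau_i: "ocoact Z (\<tau> (e i)) = (\<Sum>a<n. \<tau> (e a) \<otimes> einc0 Z (?u a i))" for i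
    by (simp add: \<tau>' \<delta>e clinear_sum[OF clinear_tmap] clinear_einc0 tmap_tensor)
  have tstar_sum: "tstar (\<Sum>i\<in>A. f i) = (\<Sum>i\<in>A. tstar (f i))" for A and f :: "nat \<Rightarrow> ('o, 'e) tensor"
    by (induction A rule: infinite_finite_induct)
      (use tstar_cscale[of 0 0] in \<open>simp_all add: tstar_add\<close>)
  have star_i: "ocoact Z (pinc Z (star (T (e i)))) =
      (\<Sum>b<n. pinc Z (star (T (e b))) \<otimes> einc0 Z (star (?u b i)))" for i
  proof -
    have "ocoact Z (pinc Z (T (e i))) = (\<Sum>b<n. pinc Z (T (e b)) \<otimes> einc0 Z (?u b i))"
      by (simp add: ocoact_pinc T' \<delta>e clinear_sum[OF clinear_tmap] clinear_einc0 clinear_pinc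
          clinear_id tmap_tensor)
    then show ?thesis
      by (simp add: pinc_star ocoact_star tstar_sum tstar_tensor einc0_star)
  qed
  have "ocoact Z (frame_coeff n e T \<tau>) = (\<Sum>i<n. \<Sum>b<n. \<Sum>a<n.
      (\<tau> (e a) * pinc Z (star (T (e b)))) \<otimes> einc0 Z (?u a i * star (?u b i)))"
    by (simp add: frame_coeff_def clinear_sum[OF clinear_ocoact] ocoact_mult tau_i star_i
        clinear_sum[OF cbilinearD(1)[OF cbilinear_gtmult]] clinear_sum[OF cbilinearD(2)[OF cbilinear_gtmult]]
        gtmult_tensor_degree_0_left einc0_degree einc0_mult)
  also have "\<dots> = (\<Sum>i<n. \<Sum>a<n. \<Sum>b<n.
      (\<tau> (e a) * pinc Z (star (T (e b)))) \<otimes> einc0 Z (?u a i * star (?u b i)))"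
    by (intro sum.cong refl sum.swap)
  also have "\<dots> = (\<Sum>a<n. \<Sum>i<n. \<Sum>b<n.
      (\<tau> (e a) * pinc Z (star (T (e b)))) \<otimes> einc0 Z (?u a i * star (?u b i)))"
    by (rule sum.swap)
  also have "\<dots> = (\<Sum>a<n. \<Sum>b<n. (\<tau> (e a) * pinc Z (star (T (e b)))) \<otimes>
      einc0 Z (\<Sum>i<n. ?u a i * star (?u b i)))"
    unfolding clinear_sum[OF clinear_einc0] tensor_sum_right by (intro sum.cong refl sum.swap)
  also have "\<dots> = (\<Sum>a<n. \<Sum>b<n. if b = a then (\<tau> (e a) * pinc Z (star (T (e a)))) \<otimes> 1 else 0)"
    by (intro sum.cong refl)
      (auto simp: unitary_coeff(2)[OF e corep_in] ip_onb[OF e] cscale_one einc0_1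
        clinear_0[OF clinear_einc0])
  also have "\<dots> = frame_coeff n e T \<tau> \<otimes> 1"
    by (simp add: frame_coeff_def tensor_sum_left)
  finally show ?thesis by (simp add: base_forms_def)
qed

text \<open>The relations contain binary additivity only; the empty sum is settled by applying it to
  0 + 0.\<close>

lemma gen_sum_rels:
  assumes "\<mu> \<in> base_forms Z" "\<And>k. k \<in> A \<Longrightarrow> U k \<in> assoc_bundle Z \<delta>" "finite A"
  shows "gen (\<mu>, \<Sum>k\<in>A. U k) - (\<Sum>k\<in>A. gen (\<mu>, U k)) \<in> rels"
  using assms(3,2)
proof (induction A)
  have add: "gen (\<mu>, T + U) - gen (\<mu>, T) - gen (\<mu>, U) \<in> rels"
    if "T \<in> assoc_bundle Z \<delta>" "U \<in> assoc_bundle Z \<delta>" for T U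
    using that assms(1) unfolding btensor_rels_def by (intro cvs.span_base) blast
  {
    case empty
    have "- gen (\<mu>, 0) \<in> rels" using add[OF assoc_bundle_0 assoc_bundle_0] by simp
    from cvs.span_neg[OF this] show ?case by (simp add: zero_fun_def)
  next
    case (insert k A)
    then have "gen (\<mu>, \<Sum>k\<in>A. U k) - (\<Sum>k\<in>A. gen (\<mu>, U k)) \<in> rels" by simp
    from cvs.span_add[OF this add[of "U k" "\<Sum>k\<in>A. U k"]] insert show ?case
      by (simp add: assoc_bundle_sum algebra_simps plus_fun_def)
  }
qed

lemma base_sum_rels:
  assumes "\<And>k. k \<in> A \<Longrightarrow> \<mu> k \<in> base_forms Z" "T \<in> assoc_bundle Z \<delta>" "finite A"
  shows "gen (\<Sum>k\<in>A. \<mu> k, T) - (\<Sum>k\<in>A. gen (\<mu> k, T)) \<in> rels"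
  using assms(3,1)
proof (induction A)
  have add: "gen (\<mu> + \<nu>, T) - gen (\<mu>, T) - gen (\<nu>, T) \<in> rels"
    if "\<mu> \<in> base_forms Z" "\<nu> \<in> base_forms Z" for \<mu> \<nu>
    using that assms(2) unfolding btensor_rels_def by (intro cvs.span_base) blast
  note sub = subspace_base_forms
  {
    case empty
    have "- gen (0, T) \<in> rels" using add[OF cvs.subspace_0[OF sub] cvs.subspace_0[OF sub]] by simp
    from cvs.span_neg[OF this] show ?case by simp
  next
    case (insert k A)
    then have "gen (\<Sum>k\<in>A. \<mu> k, T) - (\<Sum>k\<in>A. gen (\<mu> k, T)) \<in> rels" by simp
    from cvs.span_add[OF this add[of "\<mu> k" "\<Sum>k\<in>A. \<mu> k"]] insert show ?case
      by (simp add: cvs.subspace_sum[OF sub] algebra_simps)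
  }
qed

(* Expanding a horizontal morphism in the frame inverts ev modulo the relations. *)
lemma ex_inverse:
  "\<exists>N. (\<forall>\<tau>\<in>hor_mor. N \<tau> \<in> free \<and> ev (N \<tau>) = \<tau>) \<and> (\<forall>p\<in>free. p - N (ev p) \<in> rels)"
proof -
  obtain n e where e: "orthonormal_basis UNIV ip n e" using ex_onb[OF cvs.subspace_UNIV] by blast
  obtain d :: nat and T where T: "\<And>k. k < d \<Longrightarrow> T k \<in> assoc_bundle Z \<delta>"
    and sum_T: "\<And>x y. (\<Sum>k<d. star (T k x) * T k y) = ip x y *\<^sub>C 1"
    using ex_frame[OF frames] unfolding assoc_bundle_def by metis
  let ?M = "\<lambda>k. frame_coeff n e (T k)"
  define N where "N \<tau> = (\<Sum>k<d. gen (?M k \<tau>, T k))" for \<tau>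
  have M_base: "?M k \<tau> \<in> base_forms Z" if "\<tau> \<in> hor_mor" "k < d" for \<tau> k
    by (rule frame_coeff_base[OF e T[OF that(2)] that(1)])
  have expand: "(\<Sum>k<d. ?M k \<tau> * pinc Z (T k v)) = \<tau> v" if "clinear \<tau>" for \<tau> v
  proof -
    have "(\<Sum>k<d. ?M k \<tau> * pinc Z (T k v)) =
        (\<Sum>i<n. \<tau> (e i) * pinc Z (\<Sum>k<d. star (T k (e i)) * T k v))"
      unfolding frame_coeff_def sum_distrib_right
      by (subst sum.swap)
        (simp add: clinear_sum[OF clinear_pinc] pinc_mult sum_distrib_left mult.assoc)
    also have "\<dots> = \<tau> (proj n e v)"
      by (simp add: sum_T clinear_scale[OF clinear_pinc] pinc_1 cscale_mult_right proj_def
          clinear_sum[OF that] clinear_scale[OF that])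
    finally show ?thesis by (simp add: proj_ident[OF e])
  qed
  \<comment> \<open>\<open>gen\<close> is not additive in its first entry, so N is linear only
    modulo the relations.\<close>
  have N_add: "N (\<tau> + \<sigma>) - (N \<tau> + N \<sigma>) \<in> rels" if "\<tau> \<in> hor_mor" "\<sigma> \<in> hor_mor" for \<tau> \<sigma>
  proof -
    have "?M k (\<tau> + \<sigma>) = ?M k \<tau> + ?M k \<sigma>" for k
      by (simp add: frame_coeff_def distrib_right sum.distrib)
    then have "N (\<tau> + \<sigma>) - (N \<tau> + N \<sigma>) =
        (\<Sum>k<d. gen (?M k \<tau> + ?M k \<sigma>, T k) - gen (?M k \<tau>, T k) - gen (?M k \<sigma>, T k))"
      by (simp add: N_def sum_subtractf)
    also have "\<dots> \<in> rels"
      using M_base that T unfolding btensor_rels_def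
      by (intro cvs.span_sum cvs.span_base) blast
    finally show ?thesis .
  qed
  have N_scale: "N (c *\<^sub>C \<tau>) - c *\<^sub>C N \<tau> \<in> rels" if "\<tau> \<in> hor_mor" for c \<tau>
  proof -
    have "?M k (c *\<^sub>C \<tau>) = c *\<^sub>C ?M k \<tau>" for k
      by (simp add: frame_coeff_def cscale_fun_apply cscale_mult_left cvs.scale_sum_right)
    then have "N (c *\<^sub>C \<tau>) - c *\<^sub>C N \<tau> = (\<Sum>k<d. gen (c *\<^sub>C ?M k \<tau>, T k) - c *\<^sub>C gen (?M k \<tau>, T k))"
      by (simp add: N_def sum_subtractf cvs.scale_sum_right)
    also have "\<dots> \<in> rels"
      using M_base that T unfolding btensor_rels_def
      by (intro cvs.span_sum cvs.span_base) blast
    finally show ?thesis .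
  qed
  \<comment> \<open>The frame coefficients b_k of U lie in B and so move across the balanced tensor
    sign: \<mu> b_k \<otimes> T_k is equivalent to \<mu> \<otimes> b_k T_k, and these add up to
    \<mu> \<otimes> U.\<close>
  have N_gen: "gen (\<mu>, U) - N (ev (gen (\<mu>, U))) \<in> rels"
    if \<mu>: "\<mu> \<in> base_forms Z" and U: "U \<in> assoc_bundle Z \<delta>" for \<mu> U
  proof -
    define b where "b k = (\<Sum>i<n. U (e i) * star (T k (e i)))" for k
    have U_lin: "clinear U" using U by (simp add: assoc_bundle_iff)
    have pinc_b: "pinc Z (b k) = ?M k (\<lambda>v. pinc Z (U v))" for k
      by (simp add: b_def frame_coeff_def clinear_sum[OF clinear_pinc] pinc_mult)
    then have b: "b k \<in> base Z" if "k < d" for k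
      using M_base[OF pinc_hor_mor[OF U] that] by (simp flip: pinc_base_forms_iff)
    have "pinc Z (\<Sum>k<d. b k * T k v) = pinc Z (U v)" for v
      using expand[OF clinear_comp[OF clinear_pinc U_lin], of v]
      by (simp add: clinear_sum[OF clinear_pinc] pinc_mult pinc_b)
    then have "(\<Sum>k<d. b k * T k v) = U v" for v using inj_pinc by (auto dest: injD)
    then have U_eq: "U = (\<Sum>k<d. (\<lambda>v. b k * T k v))" by (simp add: fun_eq_iff sum_fun_apply)
    have M_eq: "?M k (ev (gen (\<mu>, U))) = \<mu> * pinc Z (b k)" for k
      by (simp add: pinc_b ev_simps frame_coeff_def sum_distrib_left mult.assoc)
    have "gen (\<mu>, U) - (\<Sum>k<d. gen (\<mu>, \<lambda>v. b k * T k v)) \<in> rels"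
      by (subst U_eq, rule gen_sum_rels[OF \<mu>]) (simp_all add: assoc_bundle_mult b T)
    moreover have "(\<Sum>k<d. gen (\<mu> * pinc Z (b k), T k) - gen (\<mu>, \<lambda>v. b k * T k v)) \<in> rels"
      using b T \<mu> unfolding btensor_rels_def by (intro cvs.span_sum cvs.span_base) blast
    ultimately have "gen (\<mu>, U) - (\<Sum>k<d. gen (\<mu>, \<lambda>v. b k * T k v)) -
        (\<Sum>k<d. gen (\<mu> * pinc Z (b k), T k) - gen (\<mu>, \<lambda>v. b k * T k v)) \<in> rels"
      by (rule cvs.span_diff)
    then show ?thesis by (simp add: N_def M_eq sum_subtractf)
  qed
  show ?thesis
  proof (intro exI conjI ballI)
    show "N \<tau> \<in> free" if "\<tau> \<in> hor_mor" for \<tau>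
      unfolding N_def using M_base[OF that] T by (intro cvs.span_sum gen_free) simp_all
    show "ev (N \<tau>) = \<tau>" if "\<tau> \<in> hor_mor" for \<tau>
      by (simp add: N_def ev_simps fun_eq_iff sum_fun_apply expand[OF hor_mor_linear[OF that]])
    show "p - N (ev p) \<in> rels" if "p \<in> free" for p
    proof -
      \<comment> \<open>Membership in \<open>free\<close> is carried along because additivity of N
        is known only on horizontal morphisms, and \<open>ev\<close> of the partial sum has to be
        one.\<close>
      from that have "p \<in> free \<and> p - N (ev p) \<in> rels"
      proof (induction rule: cvs.span_induct_alt)
        case base
        have "N (0 *\<^sub>C 0) - 0 *\<^sub>C N 0 \<in> rels"
          by (rule N_scale[OF cvs.subspace_0[OF subspace_hor_mor]])
        then have "N 0 \<in> rels" by simp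
        from cvs.span_neg[OF this] show ?case unfolding ev_simps by (simp add: cvs.span_zero zero_fun_def)
      next
        case (step c x y)
        then have x: "x \<in> free" "x - N (ev x) \<in> rels" and y: "y \<in> free" "y - N (ev y) \<in> rels"
          using N_gen gen_free by auto
        note hor = ev_hor_mor[OF x(1)] ev_hor_mor[OF y(1)]
        have "c *\<^sub>C (x - N (ev x)) + (y - N (ev y)) - (N (c *\<^sub>C ev x) - c *\<^sub>C N (ev x)) -
            (N (c *\<^sub>C ev x + ev y) - (N (c *\<^sub>C ev x) + N (ev y))) \<in> rels"
          by (rule cvs.span_diff[OF cvs.span_diff[OF cvs.span_add[OF cvs.span_scale[OF x(2)] y(2)]
                N_scale[OF hor(1)]] N_add[OF cvs.subspace_scale[OF subspace_hor_mor hor(1)] hor(2)]])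
        then have "c *\<^sub>C x + y - N (ev (c *\<^sub>C x + y)) \<in> rels"
          by (simp add: ev_simps cvs.scale_right_diff_distrib)
        then show ?case using cvs.span_add[OF cvs.span_scale[OF x(1)] y(1)] by blast
      qed
      then show ?thesis ..
    qed
  qed
qed

text \<open>Both representatives are equivalent to N of their common value. This is injectivity of
  \<open>Upsilon_inv\<close>.\<close>

lemma ev_eq_iff:
  assumes "p \<in> free" "q \<in> free"
  shows "ev p = ev q \<longleftrightarrow> bcoset Z \<delta> p = bcoset Z \<delta> q"
proof
  assume eq: "ev p = ev q"
  obtain N where N: "\<And>p. p \<in> free \<Longrightarrow> p - N (ev p) \<in> rels"
    using ex_inverse by blast
  from cvs.span_diff[OF N[OF assms(1)] N[OF assms(2)]]
  show "bcoset Z \<delta> p = bcoset Z \<delta> q" by (simp add: eq bcoset_eq_iff)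
next
  assume "bcoset Z \<delta> p = bcoset Z \<delta> q"
  then show "ev p = ev q" using Upsilon_inv_bcoset by metis
qed

lemma ex_ev:
  assumes "\<tau> \<in> hor_mor"
  shows "\<exists>p\<in>free. ev p = \<tau>"
  using ex_inverse assms by blast

lemma Upsilon_ev:
  assumes "p \<in> free"
  shows "Upsilon Z \<delta> (ev p) = bcoset Z \<delta> p"
proof -
  have "inj_on (Upsilon_inv Z) (btensor Z \<delta>)"
    unfolding btensor_eq by (intro inj_onI) (elim imageE, simp add: Upsilon_inv_bcoset ev_eq_iff)
  then have "the_inv_into (btensor Z \<delta>) (Upsilon_inv Z) (ev p) = bcoset Z \<delta> p"
    by (rule the_inv_into_f_eq) (simp_all add: Upsilon_inv_bcoset btensor_eq assms)
  then show ?thesis by (simp add: Upsilon_def ev_hor_mor[OF assms])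
qed

section \<open>The covariant derivative of horizontal morphisms\<close>

lemma cov_deriv_comp_hor_mor_linear:
  assumes "\<tau> \<in> hor_mor" "\<sigma> \<in> hor_mor"
  shows "cov_deriv Z \<omega> \<circ> (\<tau> + \<sigma>) = (cov_deriv Z \<omega> \<circ> \<tau>) + (cov_deriv Z \<omega> \<circ> \<sigma>)"
    "cov_deriv Z \<omega> \<circ> (c *\<^sub>C \<tau>) = c *\<^sub>C (cov_deriv Z \<omega> \<circ> \<tau>)"
  using hor_mor_Hor[OF assms(1)] hor_mor_Hor[OF assms(2)]
  by (simp_all add: fun_eq_iff cscale_fun_apply cov_deriv_linear)

lemma cov_deriv_ev_gen:
  assumes "\<mu> \<in> base_forms Z" "\<mu> \<in> ograde Z k" "T \<in> assoc_bundle Z \<delta>"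
  shows "cov_deriv Z \<omega> \<circ> ev (gen (\<mu>, T)) =
    ev (gen (odiff Z \<mu>, T)) + (-1) ^ k *\<^sub>C (\<lambda>v. \<mu> * cov_deriv Z \<omega> (pinc Z (T v)))"
  using hor_mor_Hor[OF pinc_hor_mor[OF assms(3)]]
  by (simp add: fun_eq_iff ev_simps cscale_fun_apply cov_deriv_mult[OF assms(1,2) _ pinc_degree])

text \<open>The coaction is computed in degree 0 only; expanding \<tau> into terms \<mu>T reduces
  everything to that case. The Leibniz rule wants homogeneous \<mu>, so base forms are split into
  components, which are base forms too.\<close>

lemma cov_deriv_hor_mor:
  assumes "\<tau> \<in> hor_mor"
  shows "cov_deriv Z \<omega> \<circ> \<tau> \<in> hor_mor"
proof -
  let ?D = "{\<tau> \<in> hor_mor. cov_deriv Z \<omega> \<circ> \<tau> \<in> hor_mor}"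
  note zero = cvs.subspace_0[OF subspace_hor_mor]
  have D0: "cov_deriv Z \<omega> \<circ> 0 = (0 :: 'v \<Rightarrow> 'o)"
    using cov_deriv_comp_hor_mor_linear(2)[OF zero zero, of 0] by simp
  have sub: "csubspace ?D"
    by (rule cvs.subspaceI)
      (auto simp: zero D0 cov_deriv_comp_hor_mor_linear cvs.subspace_add[OF subspace_hor_mor]
        cvs.subspace_scale[OF subspace_hor_mor])
  have hom: "ev (gen (\<mu>, T)) \<in> ?D"
    if "\<mu> \<in> base_forms Z" "\<mu> \<in> ograde Z k" "T \<in> assoc_bundle Z \<delta>" for \<mu> T k
    using that ev_hor_mor[OF gen_free] base_forms_odiff mult_hor_mor[OF _ cov_deriv_pinc_hor_mor]
    by (simp add: cov_deriv_ev_gen cvs.subspace_add[OF subspace_hor_mor]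
        cvs.subspace_scale[OF subspace_hor_mor])
  have gen: "ev (gen (\<mu>, T)) \<in> ?D" if \<mu>: "\<mu> \<in> base_forms Z" and T: "T \<in> assoc_bundle Z \<delta>" for \<mu> T
  proof -
    have "ev (gen (\<mu>, T)) = ev (gen (\<Sum>k\<in>degs (ograde Z) \<mu>. hcomp (ograde Z) k \<mu>, T))"
      by (simp add: left.sum_hcomp)
    also have "\<dots> = (\<Sum>k\<in>degs (ograde Z) \<mu>. ev (gen (hcomp (ograde Z) k \<mu>, T)))"
      by (simp add: ev_simps fun_eq_iff sum_fun_apply sum_distrib_right)
    also have "\<dots> \<in> ?D"
      using hom[OF base_forms_hcomp[OF \<mu>] left.hcomp_in T] by (intro cvs.subspace_sum[OF sub])
    finally show ?thesis .
  qed
  obtain p where p: "p \<in> free" "ev p = \<tau>" using ex_ev[OF assms] by blast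
  from p(1) have "ev p \<in> ?D"
  proof (induction rule: cvs.span_induct_alt)
    case base
    show ?case unfolding ev_simps by (rule cvs.subspace_0[OF sub])
  next
    case (step c x y)
    then have "ev x \<in> ?D" using gen by blast
    with step(2) show ?case
      unfolding ev_simps by (intro cvs.subspace_add[OF sub] cvs.subspace_scale[OF sub])
  qed
  with p show ?thesis by simp
qed

section \<open>Characterization of the exterior covariant derivative\<close>

definition ext_cov_deriv_spec ::
    "(('o, 'p, 'v) bfree set \<Rightarrow> ('o, 'p, 'v) bfree set) \<Rightarrow> bool" where
  "ext_cov_deriv_spec f \<longleftrightarrow> f \<in> btensor Z \<delta> \<rightarrow>\<^sub>E btensor Z \<delta> \<and>
     (\<forall>X\<in>btensor Z \<delta>. \<forall>Y\<in>btensor Z \<delta>. f (badd Z \<delta> X Y) = badd Z \<delta> (f X) (f Y)) \<and>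
     (\<forall>c. \<forall>X\<in>btensor Z \<delta>. f (bscale Z \<delta> c X) = bscale Z \<delta> c (f X)) \<and>
     (\<forall>k. \<forall>\<mu>\<in>base_forms Z \<inter> ograde Z k. \<forall>T\<in>assoc_bundle Z \<delta>.
        f (bpure Z \<delta> \<mu> T) =
          badd Z \<delta> (bpure Z \<delta> (odiff Z \<mu>) T)
            (bscale Z \<delta> ((-1) ^ k) (blmult Z \<delta> \<mu> (linear_connection Z \<omega> \<delta> T))))"

text \<open>The representatives on which both maps agree form a subspace; it contains the generators
  with homogeneous forms and, modulo the relations, all others. Outside \<open>btensor\<close>
  extensionality fixes the values.\<close>

lemma ext_cov_deriv_spec_unique:
  assumes f: "ext_cov_deriv_spec f" and g: "ext_cov_deriv_spec g"
  shows "f = g"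
proof -
  let ?E = "{p \<in> free. f (bcoset Z \<delta> p) = g (bcoset Z \<delta> p)}"
  have in_b: "bcoset Z \<delta> p \<in> btensor Z \<delta>" if "p \<in> free" for p using that by (simp add: btensor_eq)
  have add: "h (bcoset Z \<delta> (p + q)) = badd Z \<delta> (h (bcoset Z \<delta> p)) (h (bcoset Z \<delta> q))"
    and scale: "h (bcoset Z \<delta> (c *\<^sub>C p)) = bscale Z \<delta> c (h (bcoset Z \<delta> p))"
    if "ext_cov_deriv_spec h" "p \<in> free" "q \<in> free" for h p q c
    using that in_b unfolding ext_cov_deriv_spec_def badd_bcoset[symmetric] bscale_bcoset[symmetric]
    by blast+
  \<comment> \<open>Cosets form no vector space type, so preservation of zero is derived: the value
    is the coset of some q, and scaling by 0 turns it into the zero coset.\<close>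
  have zero: "h (bcoset Z \<delta> 0) = bcoset Z \<delta> 0" if h: "ext_cov_deriv_spec h" for h
  proof -
    have "h (bcoset Z \<delta> 0) \<in> btensor Z \<delta>"
      using h in_b[OF cvs.span_zero] unfolding ext_cov_deriv_spec_def by (auto dest: PiE_mem)
    then obtain q where "h (bcoset Z \<delta> 0) = bcoset Z \<delta> q" by (auto simp: btensor_eq)
    then show ?thesis
      using scale[OF h cvs.span_zero cvs.span_zero, of 0] by (simp add: bscale_bcoset)
  qed
  have sub: "csubspace ?E"
    by (rule cvs.subspaceI)
      (auto simp: zero[OF f] zero[OF g] add[OF f] add[OF g] scale[OF f] scale[OF g]
        cvs.span_zero cvs.span_add cvs.span_scale)
  have hom: "gen (\<mu>, T) \<in> ?E"
    if "\<mu> \<in> base_forms Z" "\<mu> \<in> ograde Z k" "T \<in> assoc_bundle Z \<delta>" for \<mu> T k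
    using f g that gen_free unfolding ext_cov_deriv_spec_def bpure_def by simp
  have gen: "gen (\<mu>, T) \<in> ?E" if \<mu>: "\<mu> \<in> base_forms Z" and T: "T \<in> assoc_bundle Z \<delta>" for \<mu> T
  proof -
    let ?p = "\<Sum>k\<in>degs (ograde Z) \<mu>. gen (hcomp (ograde Z) k \<mu>, T)"
    have "?p \<in> ?E"
      using hom[OF base_forms_hcomp[OF \<mu>] left.hcomp_in T] by (intro cvs.subspace_sum[OF sub])
    moreover have "gen (\<mu>, T) - ?p \<in> rels"
      using base_sum_rels[OF base_forms_hcomp[OF \<mu>] T left.finite_degs, of "\<lambda>k. k" \<mu>]
      by (simp add: left.sum_hcomp)
    ultimately show ?thesis using gen_free[OF \<mu> T] by (simp flip: bcoset_eq_iff)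
  qed
  have "p \<in> ?E" if "p \<in> free" for p
  proof -
    have "free \<subseteq> ?E" using gen by (intro cvs.span_minimal sub) blast
    with that show ?thesis by blast
  qed
  then have eq: "f X = g X" if "X \<in> btensor Z \<delta>" for X using that by (auto simp: btensor_eq)
  have "f \<in> extensional (btensor Z \<delta>)" "g \<in> extensional (btensor Z \<delta>)"
    using f g by (auto simp: ext_cov_deriv_spec_def PiE_def)
  then show ?thesis by (rule extensionalityI) (rule eq)
qed

text \<open>The composite is evaluated at a coset by exhibiting q in \<open>free\<close> with
  \<open>ev q\<close> equal to the derivative of \<open>ev p\<close>; such q exists because the
  derivative preserves horizontal morphisms.\<close>

lemma ext_cov_deriv_spec_Upsilon:
  "ext_cov_deriv_spec (\<lambda>X\<in>btensor Z \<delta>. Upsilon Z \<delta> (cov_deriv Z \<omega> \<circ> Upsilon_inv Z X))"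
proof -
  define F where "F X = Upsilon Z \<delta> (cov_deriv Z \<omega> \<circ> Upsilon_inv Z X)" for X
  have F_bcoset: "F (bcoset Z \<delta> p) = bcoset Z \<delta> q"
    if "q \<in> free" "ev q = cov_deriv Z \<omega> \<circ> ev p" for p q
    using Upsilon_ev[OF that(1)] that(2) by (simp add: F_def Upsilon_inv_bcoset)
  have ex: "\<exists>q\<in>free. ev q = cov_deriv Z \<omega> \<circ> ev p" if "p \<in> free" for p
    by (rule ex_ev[OF cov_deriv_hor_mor[OF ev_hor_mor[OF that]]])
  have in_b: "bcoset Z \<delta> p \<in> btensor Z \<delta>" if "p \<in> free" for p using that by (simp add: btensor_eq)
  have F_in: "F X \<in> btensor Z \<delta>" if "X \<in> btensor Z \<delta>" for X
    using that ex F_bcoset by (force simp: btensor_eq)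
  have add: "badd Z \<delta> X Y \<in> btensor Z \<delta> \<and> F (badd Z \<delta> X Y) = badd Z \<delta> (F X) (F Y)"
    if XY: "X \<in> btensor Z \<delta>" "Y \<in> btensor Z \<delta>" for X Y
  proof -
    obtain p q where p: "p \<in> free" "X = bcoset Z \<delta> p" and q: "q \<in> free" "Y = bcoset Z \<delta> q"
      using XY by (auto simp: btensor_eq)
    obtain p' q' where p': "p' \<in> free" "ev p' = cov_deriv Z \<omega> \<circ> ev p"
      and q': "q' \<in> free" "ev q' = cov_deriv Z \<omega> \<circ> ev q"
      using ex[OF p(1)] ex[OF q(1)] by blast
    have "ev (p' + q') = cov_deriv Z \<omega> \<circ> ev (p + q)"
      using p' q' by (simp add: ev_simps cov_deriv_comp_hor_mor_linear ev_hor_mor p q)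
    from F_bcoset[OF cvs.span_add[OF p'(1) q'(1)] this] show ?thesis
      using in_b[OF cvs.span_add[OF p(1) q(1)]]
      by (simp add: p(2) q(2) F_bcoset[OF p'] F_bcoset[OF q'] badd_bcoset)
  qed
  have scale: "bscale Z \<delta> c X \<in> btensor Z \<delta> \<and> F (bscale Z \<delta> c X) = bscale Z \<delta> c (F X)"
    if X: "X \<in> btensor Z \<delta>" for c X
  proof -
    obtain p where p: "p \<in> free" "X = bcoset Z \<delta> p" using X by (auto simp: btensor_eq)
    obtain p' where p': "p' \<in> free" "ev p' = cov_deriv Z \<omega> \<circ> ev p" using ex[OF p(1)] by blast
    have "ev (c *\<^sub>C p') = cov_deriv Z \<omega> \<circ> ev (c *\<^sub>C p)"
      using p' by (simp add: ev_simps cov_deriv_comp_hor_mor_linear(2)[OF ev_hor_mor ev_hor_mor] p)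
    from F_bcoset[OF cvs.span_scale[OF p'(1)] this] show ?thesis
      using in_b[OF cvs.span_scale[OF p(1)]]
      by (simp add: p(2) F_bcoset[OF p'] bscale_bcoset)
  qed
  have pure: "bpure Z \<delta> \<mu> T \<in> btensor Z \<delta> \<and> F (bpure Z \<delta> \<mu> T) =
      badd Z \<delta> (bpure Z \<delta> (odiff Z \<mu>) T)
        (bscale Z \<delta> ((-1) ^ k) (blmult Z \<delta> \<mu> (linear_connection Z \<omega> \<delta> T)))"
    if \<mu>: "\<mu> \<in> base_forms Z" "\<mu> \<in> ograde Z k" and T: "T \<in> assoc_bundle Z \<delta>" for \<mu> k T
  proof -
    obtain q where q: "q \<in> free" "ev q = (\<lambda>v. cov_deriv Z \<omega> (pinc Z (T v)))"
      using ex_ev[OF cov_deriv_pinc_hor_mor[OF T]] by blast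
    then have conn: "linear_connection Z \<omega> \<delta> T = bcoset Z \<delta> q"
      using Upsilon_ev[OF q(1)] by (simp add: linear_connection_def comp_def)
    \<comment> \<open>The coset of \<open>?r\<close> is the prescribed value at \<mu> \<otimes> T,
      and \<open>cov_deriv_ev_gen\<close> shows that \<open>ev\<close> maps \<open>?r\<close> to the
      derivative of \<mu>T.\<close>
    let ?r = "gen (odiff Z \<mu>, T) + (-1) ^ k *\<^sub>C left_mult \<mu> q"
    have "?r \<in> free"
      by (intro cvs.span_add cvs.span_scale left_mult_free gen_free base_forms_odiff \<mu>(1) q(1) T)
    moreover have "ev ?r = cov_deriv Z \<omega> \<circ> ev (gen (\<mu>, T))"
      unfolding cov_deriv_ev_gen[OF \<mu> T] by (simp only: ev_simps(2,4) ev_left_mult q(2))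
    ultimately have "F (bcoset Z \<delta> (gen (\<mu>, T))) = bcoset Z \<delta> ?r" by (rule F_bcoset)
    then show ?thesis
      using in_b[OF gen_free[OF \<mu>(1) T]]
      by (simp add: bpure_def conn blmult_bcoset[OF \<mu>(1)] bscale_bcoset badd_bcoset)
  qed
  have "ext_cov_deriv_spec (restrict F (btensor Z \<delta>))"
    unfolding ext_cov_deriv_spec_def
  proof (intro conjI allI ballI)
    fix k \<mu> T assume "\<mu> \<in> base_forms Z \<inter> ograde Z k" "T \<in> assoc_bundle Z \<delta>"
    then show "restrict F (btensor Z \<delta>) (bpure Z \<delta> \<mu> T) =
        badd Z \<delta> (bpure Z \<delta> (odiff Z \<mu>) T)
          (bscale Z \<delta> ((-1) ^ k) (blmult Z \<delta> \<mu> (linear_connection Z \<omega> \<delta> T)))"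
      using pure[of \<mu> k T] by simp
  qed (use F_in add scale in simp_all)
  then show ?thesis by (simp add: F_def[abs_def])
qed

lemma ext_cov_deriv_eq:
  assumes "X \<in> btensor Z \<delta>"
  shows "ext_cov_deriv Z \<omega> \<delta> X = Upsilon Z \<delta> (cov_deriv Z \<omega> \<circ> Upsilon_inv Z X)"
proof -
  have "ext_cov_deriv Z \<omega> \<delta> = (THE f. ext_cov_deriv_spec f)"
    by (simp add: ext_cov_deriv_def ext_cov_deriv_spec_def)
  also have "\<dots> = (\<lambda>X\<in>btensor Z \<delta>. Upsilon Z \<delta> (cov_deriv Z \<omega> \<circ> Upsilon_inv Z X))"
    by (rule the_equality[where P = ext_cov_deriv_spec, OF ext_cov_deriv_spec_Upsilon
          ext_cov_deriv_spec_unique[OF _ ext_cov_deriv_spec_Upsilon]])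
  finally show ?thesis using assms by simp
qed

end

theorem proposition3p5:
  fixes Z :: "('h::star_algebra, 'p::star_algebra, 'g::involutive_space,
    'e::involutive_algebra, 'o::involutive_algebra) qpb_calculus"
    and \<omega> :: "'g \<Rightarrow> 'o"
    and \<delta> :: "'v::complex_space \<Rightarrow> ('v, 'h) tensor"
    and ip :: "'v \<Rightarrow> 'v \<Rightarrow> complex"
  assumes "compact_matrix_quantum_group (comult Z) (counit Z) (antipode Z)"
    and "quantum_principal_bundle (comult Z) (counit Z) (base Z) (coact Z)"
    and "cstar_completable (base Z)"
    and "has_left_frames (comult Z) (counit Z) (coact Z)"
    and "differential_calculus Z"
    and "quantum_principal_connection Z \<omega>"
    and "unitary_corepresentation (comult Z) (counit Z) UNIV \<delta> ip"
  shows "\<forall>X\<in>btensor Z \<delta>.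
    ext_cov_deriv Z \<omega> \<delta> X = Upsilon Z \<delta> (cov_deriv Z \<omega> \<circ> Upsilon_inv Z X)"
proof -
  have hopf: "star_hopf_algebra (comult Z) (counit Z) (antipode Z)"
    using assms(1) by (simp only: compact_matrix_quantum_group_def)
  have inner: "inner_product_on UNIV ip" "\<exists>A. finite A \<and> cspan A = (UNIV :: 'v set)"
    using assms(7) by (simp_all only: unitary_corepresentation_def)
  interpret associated_bundle Z \<omega> ip \<delta>
    by unfold_locales (fact hopf assms inner)+
  show ?thesis using ext_cov_deriv_eq by blast
qed

end
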